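(* Let $G$ be a connected graph with canonical split decomposition $(T,\mu)$. Then $G$ belongs to DH $\cap$ co-DH if and only if all of the following hold: (i) every internal node $t$ of $T$ has $\mu(t)$ a star or a clique; (ii) either there is an edge $e$ of $T$ such that every internal node labelled by a star points towards $e$, or there are two internal nodes $s\neq s'$ of $T$, both labelled by stars, with $s$ not pointing towards $s'$ and $s'$ not pointing towards $s$, such that either $s,s'$ are adjacent in $T$, or the path in $T$ between $s$ and $s'$ has exactly one internal node $s''$ and $\mu(s'')$ is a clique; and every internal node labelled by a star other than $s,s'$ points towards the set consisting of $s,s'$ (and $s''$ if it exists).
   Context: All graphs are finite and simple. A graph is distance-hereditary if it has no induced subgraph isomorphic to a hole (an induced cycle of length at least $5$), the house (a $5$-cycle plus one chord), the domino (a $6$-cycle $v_1\dots v_6$ plus the chord $v_1v_4$), or the gem ($P_4$ plus a vertex adjacent to all four of its vertices). DH $\cap$ co-DH is the class of graphs $G$ such that both $G$ and its complement are distance-hereditary. A split of $G=(V,E)$ is a bipartition $(A,B)$ of $V$ with $|A|,|B|\ge 2$ such that every vertex of $A$ having a neighbour in $B$ is adjacent to every vertex of $B$ having a neighbour in $A$; it is strong if no other split $(A',B')$ has all four of $A\cap A',A\cap B',B\cap A',B\cap B'$ nonempty. The canonical split decomposition (Cunningham) of a connected graph $G$ is the unique pair $(T,\mu)$ where $T$ is an undirected tree whose leaves are in bijection with $V(G)$ and whose internal nodes have degree at least $3$, each internal node $t$ is labelled by a graph $\mu(t)$ whose vertices are in bijection with the edges of $T$ incident to $t$, such that: two vertices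 $u,v$ of $G$ are adjacent iff for every internal node $t$ on the $T$-path $P$ between the leaves of $u$ and $v$, the two vertices of $\mu(t)$ corresponding to the edges of $P$ at $t$ are adjacent in $\mu(t)$; and the bipartitions of the leaves obtained by deleting an internal edge of $T$ are exactly the strong splits of $G$. A star is a graph $K_{1,k}$ ($k\ge2$), whose center is its vertex of degree $k$; a clique is a complete graph. If $\mu(t)$ is a star whose center corresponds to the edge $f$ of $T$ incident to $t$, then $t$ points towards a node or edge $x$ of $T$ (resp. a set of nodes) if the path in $T$ from $t$ to $x$ (resp. to that set, including $x$ itself when $x$ is an edge) contains $f$.
   Formalization: The graph G is assumed to have at least two vertices: for the one-vertex graph the tree T has no edge and no internal node, so condition (ii) fails although G belongs to DH ∩ co-DH. *)

theory Defs
  imports Main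
begin

definition graph :: "'a set \<Rightarrow> ('a \<Rightarrow> 'a \<Rightarrow> bool) \<Rightarrow> bool" where
  "graph V E \<longleftrightarrow> finite V \<and> (\<forall>x y. E x y \<longrightarrow> x \<in> V \<and> y \<in> V \<and> x \<noteq> y \<and> E y x)"

definition connected_graph :: "'a set \<Rightarrow> ('a \<Rightarrow> 'a \<Rightarrow> bool) \<Rightarrow> bool" where
  "connected_graph V E \<longleftrightarrow> V \<noteq> {} \<and> (\<forall>x\<in>V. \<forall>y\<in>V. E\<^sup>*\<^sup>* x y)"

definition complement :: "'a set \<Rightarrow> ('a \<Rightarrow> 'a \<Rightarrow> bool) \<Rightarrow> 'a \<Rightarrow> 'a \<Rightarrow> bool" where
  "complement V E x y \<longleftrightarrow> x \<in> V \<and> y \<in> V \<and> x \<noteq> y \<and> \<not> E x y"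

definition has_induced :: "'a set \<Rightarrow> ('a \<Rightarrow> 'a \<Rightarrow> bool) \<Rightarrow> 'b set \<Rightarrow> ('b \<Rightarrow> 'b \<Rightarrow> bool) \<Rightarrow> bool" where
  "has_induced V E VH EH \<longleftrightarrow>
     (\<exists>f. inj_on f VH \<and> f ` VH \<subseteq> V \<and> (\<forall>x\<in>VH. \<forall>y\<in>VH. E (f x) (f y) \<longleftrightarrow> EH x y))"

definition edges_graph :: "(nat \<times> nat) list \<Rightarrow> nat \<Rightarrow> nat \<Rightarrow> bool" where
  "edges_graph l x y \<longleftrightarrow> (x, y) \<in> set l \<or> (y, x) \<in> set l"

definition cycle_adj :: "nat \<Rightarrow> nat \<Rightarrow> nat \<Rightarrow> bool" where
  "cycle_adj n x y \<longleftrightarrow> x < n \<and> y < n \<and> x \<noteq> y \<and> (y = Suc x mod n \<or> x = Suc y mod n)"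

definition house_adj :: "nat \<Rightarrow> nat \<Rightarrow> bool" where
  "house_adj = edges_graph [(0,1),(1,2),(2,3),(3,4),(4,0),(0,2)]"

definition domino_adj :: "nat \<Rightarrow> nat \<Rightarrow> bool" where
  "domino_adj = edges_graph [(0,1),(1,2),(2,3),(3,4),(4,5),(5,0),(0,3)]"

definition gem_adj :: "nat \<Rightarrow> nat \<Rightarrow> bool" where
  "gem_adj = edges_graph [(0,1),(1,2),(2,3),(4,0),(4,1),(4,2),(4,3)]"

definition distance_hereditary :: "'a set \<Rightarrow> ('a \<Rightarrow> 'a \<Rightarrow> bool) \<Rightarrow> bool" where
  "distance_hereditary V E \<longleftrightarrow>
     (\<forall>n\<ge>5. \<not> has_induced V E {0..<n} (cycle_adj n)) \<and>
     \<not> has_induced V E {0..<5} house_adj \<and>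
     \<not> has_induced V E {0..<6} domino_adj \<and>
     \<not> has_induced V E {0..<5} gem_adj"

definition DH_coDH :: "'a set \<Rightarrow> ('a \<Rightarrow> 'a \<Rightarrow> bool) \<Rightarrow> bool" where
  "DH_coDH V E \<longleftrightarrow> distance_hereditary V E \<and> distance_hereditary V (complement V E)"

definition is_split :: "'a set \<Rightarrow> ('a \<Rightarrow> 'a \<Rightarrow> bool) \<Rightarrow> 'a set \<Rightarrow> 'a set \<Rightarrow> bool" where
  "is_split V E A B \<longleftrightarrow> A \<union> B = V \<and> A \<inter> B = {} \<and> card A \<ge> 2 \<and> card B \<ge> 2 \<and>
     (\<forall>a\<in>A. \<forall>b\<in>B. (\<exists>b'\<in>B. E a b') \<longrightarrow> (\<exists>a'\<in>A. E a' b) \<longrightarrow> E a b)"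

definition is_strong_split :: "'a set \<Rightarrow> ('a \<Rightarrow> 'a \<Rightarrow> bool) \<Rightarrow> 'a set \<Rightarrow> 'a set \<Rightarrow> bool" where
  "is_strong_split V E A B \<longleftrightarrow> is_split V E A B \<and>
     (\<forall>A' B'. is_split V E A' B' \<longrightarrow>
        \<not> (A \<inter> A' \<noteq> {} \<and> A \<inter> B' \<noteq> {} \<and> B \<inter> A' \<noteq> {} \<and> B \<inter> B' \<noteq> {}))"

definition tadj :: "'n set set \<Rightarrow> 'n \<Rightarrow> 'n \<Rightarrow> bool" where
  "tadj ET x y \<longleftrightarrow> {x, y} \<in> ET \<and> x \<noteq> y"

definition is_tree :: "'n set \<Rightarrow> 'n set set \<Rightarrow> bool" where
  "is_tree N ET \<longleftrightarrow> finite N \<and> N \<noteq> {} \<and>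
     (\<forall>e\<in>ET. \<exists>x y. x \<in> N \<and> y \<in> N \<and> x \<noteq> y \<and> e = {x, y}) \<and>
     (\<forall>x\<in>N. \<forall>y\<in>N. (tadj ET)\<^sup>*\<^sup>* x y) \<and>
     \<not> (\<exists>c. length c \<ge> 3 \<and> distinct c \<and>
            (\<forall>i. Suc i < length c \<longrightarrow> {c ! i, c ! Suc i} \<in> ET) \<and> {last c, hd c} \<in> ET)"

definition incident :: "'n set set \<Rightarrow> 'n \<Rightarrow> 'n set set" where
  "incident ET t = {e \<in> ET. t \<in> e}"

definition tleaves :: "'n set \<Rightarrow> 'n set set \<Rightarrow> 'n set" where
  "tleaves N ET = {x \<in> N. card (incident ET x) \<le> 1}"

definition tinternal :: "'n set \<Rightarrow> 'n set set \<Rightarrow> 'n set" where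
  "tinternal N ET = N - tleaves N ET"

definition tpath :: "'n set set \<Rightarrow> 'n \<Rightarrow> 'n \<Rightarrow> 'n list \<Rightarrow> bool" where
  "tpath ET x y p \<longleftrightarrow> p \<noteq> [] \<and> hd p = x \<and> last p = y \<and> distinct p \<and>
     (\<forall>i. Suc i < length p \<longrightarrow> {p ! i, p ! Suc i} \<in> ET)"

definition edge_on_path :: "'n set \<Rightarrow> 'n list \<Rightarrow> bool" where
  "edge_on_path f p \<longleftrightarrow> (\<exists>i. Suc i < length p \<and> f = {p ! i, p ! Suc i})"

definition side :: "'a set \<Rightarrow> 'n set set \<Rightarrow> ('a \<Rightarrow> 'n) \<Rightarrow> 'n set \<Rightarrow> 'n \<Rightarrow> 'a set" where
  "side V ET lf e x = {v \<in> V. (\<lambda>a b. tadj (ET - {e}) a b)\<^sup>*\<^sup>* x (lf v)}"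

definition label_graph :: "'n set set \<Rightarrow> ('n set \<Rightarrow> 'n set \<Rightarrow> bool) \<Rightarrow> bool" where
  "label_graph inc M \<longleftrightarrow> (\<forall>f g. M f g \<longrightarrow> f \<in> inc \<and> g \<in> inc \<and> f \<noteq> g \<and> M g f)"

definition star_with_center :: "'n set set \<Rightarrow> ('n set \<Rightarrow> 'n set \<Rightarrow> bool) \<Rightarrow> 'n set \<Rightarrow> bool" where
  "star_with_center inc M c \<longleftrightarrow> c \<in> inc \<and> finite inc \<and> card inc \<ge> 3 \<and>
     (\<forall>f g. M f g \<longleftrightarrow> f \<in> inc \<and> g \<in> inc \<and> f \<noteq> g \<and> (f = c \<or> g = c))"

definition is_star :: "'n set set \<Rightarrow> ('n set \<Rightarrow> 'n set \<Rightarrow> bool) \<Rightarrow> bool" where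
  "is_star inc M \<longleftrightarrow> (\<exists>c. star_with_center inc M c)"

definition is_clique :: "'n set set \<Rightarrow> ('n set \<Rightarrow> 'n set \<Rightarrow> bool) \<Rightarrow> bool" where
  "is_clique inc M \<longleftrightarrow> (\<forall>f g. M f g \<longleftrightarrow> f \<in> inc \<and> g \<in> inc \<and> f \<noteq> g)"

definition canonical_split_decomposition ::
  "'a set \<Rightarrow> ('a \<Rightarrow> 'a \<Rightarrow> bool) \<Rightarrow> 'n set \<Rightarrow> 'n set set \<Rightarrow> ('n \<Rightarrow> 'n set \<Rightarrow> 'n set \<Rightarrow> bool)
     \<Rightarrow> ('a \<Rightarrow> 'n) \<Rightarrow> bool" where
  "canonical_split_decomposition V E N ET mu lf \<longleftrightarrow>
     is_tree N ET \<and>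
     bij_betw lf V (tleaves N ET) \<and>
     (\<forall>t\<in>tinternal N ET. card (incident ET t) \<ge> 3 \<and> label_graph (incident ET t) (mu t)) \<and>
     (\<forall>u\<in>V. \<forall>v\<in>V. u \<noteq> v \<longrightarrow>
        (E u v \<longleftrightarrow> (\<forall>p. tpath ET (lf u) (lf v) p \<longrightarrow>
           (\<forall>i. 0 < i \<and> Suc i < length p \<longrightarrow>
              mu (p ! i) {p ! (i - 1), p ! i} {p ! i, p ! Suc i})))) \<and>
     {{A, B} | A B. is_strong_split V E A B} =
     {{side V ET lf e x, side V ET lf e y} | e x y.
        e \<in> ET \<and> e = {x, y} \<and> x \<noteq> y \<and> x \<in> tinternal N ET \<and> y \<in> tinternal N ET}"

definition points_to_node :: "'n set set \<Rightarrow> ('n \<Rightarrow> 'n set \<Rightarrow> 'n set \<Rightarrow> bool) \<Rightarrow> 'n \<Rightarrow> 'n \<Rightarrow> bool" where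
  "points_to_node ET mu t x \<longleftrightarrow> (\<exists>c. star_with_center (incident ET t) (mu t) c \<and>
      (\<forall>p. tpath ET t x p \<longrightarrow> edge_on_path c p))"

text \<open>Towards an edge e = {a,b}: the path from t to e, including e, is the path to the
  farther endpoint, whose edges are the union of the edges of the paths to a and to b.\<close>
definition points_to_edge :: "'n set set \<Rightarrow> ('n \<Rightarrow> 'n set \<Rightarrow> 'n set \<Rightarrow> bool) \<Rightarrow> 'n \<Rightarrow> 'n set \<Rightarrow> bool" where
  "points_to_edge ET mu t e \<longleftrightarrow> (\<exists>c. star_with_center (incident ET t) (mu t) c \<and>
      (\<exists>z\<in>e. \<forall>p. tpath ET t z p \<longrightarrow> edge_on_path c p))"

definition points_to_set :: "'n set set \<Rightarrow> ('n \<Rightarrow> 'n set \<Rightarrow> 'n set \<Rightarrow> bool) \<Rightarrow> 'n \<Rightarrow> 'n set \<Rightarrow> bool" where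
  "points_to_set ET mu t S \<longleftrightarrow> (\<exists>c. star_with_center (incident ET t) (mu t) c \<and>
      (\<forall>z\<in>S. \<forall>p. tpath ET t z p \<and> (\<forall>z'\<in>S. \<forall>p'. tpath ET t z' p' \<longrightarrow> length p \<le> length p')
          \<longrightarrow> edge_on_path c p))"

end

theory Submission
  imports Defs
begin

text \<open>
  A graph is in DH \<inter> co-DH iff it has no induced C5, P5, house, gem or co-gem. These five are exactly the
  forbidden ways of attaching a fifth vertex \<open>x\<close> to an induced P4 \<open>a b c d\<close>, so membership means: \<open>x\<close> is
  never adjacent to both ends and always adjacent to a middle vertex (\<open>P4_dominated\<close>).

  If \<open>G\<close> is in the class, so is every label, being an induced subgraph of \<open>G\<close>. A connected graph of the class
  on at least four vertices has a split, and a connected graph with a split but no strong split is a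
  star or a clique (Cunningham); a strong split of a label would lift to a strong split of \<open>G\<close> that is not
  an edge of \<open>T\<close>. Hence all labels are stars or cliques.

  A P4 of \<open>G\<close> corresponds to two star nodes pointing away from each other. Without such a pair,
  the star whose centre side is smallest has all stars pointing to its centre edge. With a
  closest such pair \<open>s, s'\<close>, only cliques lie between, and at most one since \<open>T\<close> is canonical; a third star \<open>t\<close>
  not pointing to the pair has a leaf branch that is anticomplete to the middle of a P4 at \<open>s, s'\<close>.
  Conversely, under (ii) the pair is unique and every vertex is accessible from it, so each vertex
  attaches to each P4 in an allowed way.
\<close>

section \<open>Forbidden subgraphs via P4s\<close>

text \<open>Adjacency, \<open>side\<close> and the pointing relations are given through paths in
  \<open>T\<close>. They are rewritten through \<open>dir\<close>: a node lies strictly inside the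
  path from \<open>x\<close> to \<open>y\<close> iff it sees them in different directions, so most
  arguments become case distinctions on \<open>dir\<close> at one or two nodes. Labels inherit
  domination from \<open>G\<close>, but \<open>T\<close> records strong splits of \<open>G\<close>
  only. A strong cut of a label lifts because a split of \<open>G\<close> crossing the lift cannot
  cut a branch, hence comes from a cut of the label. Behind Cunningham's theorem is submodularity of
  the rank of the adjacency matrix between a set and its complement: this rank is 1 for splits and,
  by connectedness, never 0. To have a split at all, a P4 is turned into one directly, and P4-free
  graphs are handled by Seinsche's theorem. The hypothesis \<open>card V \<ge> 2\<close> excludes
  the one-vertex graph, which is in the class although its tree has no edge that could serve as
  \<open>e\<close>.\<close>

definition induced_P4 :: "('a \<Rightarrow> 'a \<Rightarrow> bool) \<Rightarrow> 'a \<Rightarrow> 'a \<Rightarrow> 'a \<Rightarrow> 'a \<Rightarrow> bool" where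
  "induced_P4 E a b c d \<longleftrightarrow> E a b \<and> E b c \<and> E c d \<and> \<not> E a c \<and> \<not> E b d \<and> \<not> E a d"

definition P4_dominated :: "'a set \<Rightarrow> ('a \<Rightarrow> 'a \<Rightarrow> bool) \<Rightarrow> bool" where
  "P4_dominated W E \<longleftrightarrow> (\<forall>a\<in>W. \<forall>b\<in>W. \<forall>c\<in>W. \<forall>d\<in>W. \<forall>x\<in>W. induced_P4 E a b c d \<longrightarrow>
     \<not> (E x a \<and> E x d) \<and> (E x b \<or> E x c))"

lemma graphD:
  assumes "graph W E"
  shows "finite W" "E x y \<Longrightarrow> x \<in> W" "E x y \<Longrightarrow> y \<in> W" "\<not> E x x" "E x y \<longleftrightarrow> E y x"
  using assms unfolding graph_def by blast+

lemma P4_dominatedD: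
  assumes "P4_dominated W E" "graph W E" "induced_P4 E a b c d" "x \<in> W"
  shows "\<not> (E x a \<and> E x d)" "E x b \<or> E x c"
proof -
  have "E a b" "E c d" using assms(3) unfolding induced_P4_def by auto
  then have "a \<in> W" "b \<in> W" "c \<in> W" "d \<in> W" using graphD(2,3)[OF assms(2)] by simp_all
  then have "\<not> (E x a \<and> E x d) \<and> (E x b \<or> E x c)" using assms(1,3,4) unfolding P4_dominated_def by blast
  then show "\<not> (E x a \<and> E x d)" "E x b \<or> E x c" by blast+
qed

lemma has_induced_listI:
  assumes "distinct l" "set l \<subseteq> V" "length l = n"
    "\<And>i j. i < n \<Longrightarrow> j < n \<Longrightarrow> E (l ! i) (l ! j) \<longleftrightarrow> EH i j"
  shows "has_induced V E {0..<n} EH"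
  unfolding has_induced_def
proof (intro exI[of _ "nth l"] conjI ballI)
  show "inj_on (nth l) {0..<n}" using assms(1,3) by (auto simp: inj_on_def nth_eq_iff_index_eq)
  show "nth l ` {0..<n} \<subseteq> V" using assms(2,3) by auto
qed (use assms(4) in auto)

lemma all_less_5: "(\<forall>i<5::nat. P i) \<longleftrightarrow> P 0 \<and> P 1 \<and> P 2 \<and> P 3 \<and> P 4"
  by (simp add: eval_nat_numeral All_less_Suc) auto

lemma has_induced5I:
  assumes "distinct [v0, v1, v2, v3, v4]" "{v0, v1, v2, v3, v4} \<subseteq> V"
    "\<forall>i<5. \<forall>j<5. E ([v0, v1, v2, v3, v4] ! i) ([v0, v1, v2, v3, v4] ! j) \<longleftrightarrow> EH i j"
  shows "has_induced V E {0..<5} EH"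
  by (rule has_induced_listI[of "[v0, v1, v2, v3, v4]"]) (use assms in auto)

text \<open>A vertex \<open>x\<close> off the P4 that sees both ends gives a C5, a house or a gem.
  One that sees no middle vertex and at most one end gives, in the complement, a gem or a house, the
  latter being the complement of P5.\<close>

lemma DH_coDH_imp_P4_dominated:
  assumes g: "graph V E" and dh: "DH_coDH V E"
  shows "P4_dominated V E"
  unfolding P4_dominated_def
proof (intro ballI impI)
  fix a b c d x assume V: "a \<in> V" "b \<in> V" "c \<in> V" "d \<in> V" "x \<in> V" and p: "induced_P4 E a b c d"
  note irr = graphD(4)[OF g]
  have sym: "E u v \<Longrightarrow> E v u" for u v using graphD(5)[OF g] by blast
  have e: "E a b" "E b c" "E c d" "\<not> E a c" "\<not> E b d" "\<not> E a d" using p unfolding induced_P4_def by auto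
  have e': "E b a" "E c b" "E d c" "\<not> E c a" "\<not> E d b" "\<not> E d a" using e sym by blast+
  have dist: "a \<noteq> b" "b \<noteq> c" "c \<noteq> d" "a \<noteq> c" "b \<noteq> d" "a \<noteq> d" using e e' irr by auto
  have xs: "E a x \<longleftrightarrow> E x a" "E b x \<longleftrightarrow> E x b" "E c x \<longleftrightarrow> E x c" "E d x \<longleftrightarrow> E x d" using sym by blast+
  have no: "\<not> has_induced V E {0..<5} (cycle_adj 5)" "\<not> has_induced V E {0..<5} house_adj"
    "\<not> has_induced V E {0..<5} gem_adj" "\<not> has_induced V (complement V E) {0..<5} house_adj"
    "\<not> has_induced V (complement V E) {0..<5} gem_adj"
    using dh unfolding DH_coDH_def distance_hereditary_def by auto
  note chk = all_less_5 cycle_adj_def house_adj_def gem_adj_def edges_graph_def complement_def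
  show "\<not> (E x a \<and> E x d) \<and> (E x b \<or> E x c)"
  proof (cases "x \<in> {a, b, c, d}")
    case True
    then show ?thesis using e e' irr by auto
  next
    case False
    then have nx: "x \<noteq> a" "x \<noteq> b" "x \<noteq> c" "x \<noteq> d" "a \<noteq> x" "b \<noteq> x" "c \<noteq> x" "d \<noteq> x" by auto
    note s = e e' dist dist[symmetric] irr xs nx V
    show ?thesis
    proof (rule ccontr)
      assume "\<not> ?thesis"
      then consider "E x a" "E x d" "\<not> E x b" "\<not> E x c" | "E x a" "E x d" "E x b" "\<not> E x c"
        | "E x a" "E x d" "\<not> E x b" "E x c" | "E x a" "E x d" "E x b" "E x c"
        | "\<not> E x a" "\<not> E x d" "\<not> E x b" "\<not> E x c"
        | "E x a" "\<not> E x d" "\<not> E x b" "\<not> E x c" | "\<not> E x a" "E x d" "\<not> E x b" "\<not> E x c"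
        by blast
      then show False
      proof cases
        case 1
        have "has_induced V E {0..<5} (cycle_adj 5)"
          by (rule has_induced5I[of x a b c d]) (use 1 s in \<open>simp_all add: chk\<close>)
        then show False using no by blast
      next
        case 2
        have "has_induced V E {0..<5} house_adj"
          by (rule has_induced5I[of x a b c d]) (use 2 s in \<open>simp_all add: chk\<close>)
        then show False using no by blast
      next
        case 3
        have "has_induced V E {0..<5} house_adj"
          by (rule has_induced5I[of x d c b a]) (use 3 s in \<open>simp_all add: chk\<close>)
        then show False using no by blast
      next
        case 4
        have "has_induced V E {0..<5} gem_adj"
          by (rule has_induced5I[of a b c d x]) (use 4 s in \<open>simp_all add: chk\<close>)
        then show False using no by blast
      next
        case 5
        have "has_induced V (complement V E) {0..<5} gem_adj"
          by (rule has_induced5I[of b d a c x]) (use 5 s in \<open>simp_all add: chk\<close>)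
        then show False using no by blast
      next
        case 6
        have "has_induced V (complement V E) {0..<5} house_adj"
          by (rule has_induced5I[of x b d a c]) (use 6 s in \<open>simp_all add: chk\<close>)
        then show False using no by blast
      next
        case 7
        have "has_induced V (complement V E) {0..<5} house_adj"
          by (rule has_induced5I[of x c a d b]) (use 7 s in \<open>simp_all add: chk\<close>)
        then show False using no by blast
      qed
    qed
  qed
qed

text \<open>A P4 \<open>a b c d\<close> of the complement is the P4 \<open>b d a c\<close> of
  \<open>E\<close>. Ends and middle vertices change places, and so do the two halves of
  domination.\<close>

lemma P4_dominated_complement:
  assumes "graph V E" "P4_dominated V E" shows "P4_dominated V (complement V E)"
  unfolding P4_dominated_def
proof (intro ballI impI)
  fix a b c d x assume V: "a \<in> V" "b \<in> V" "c \<in> V" "d \<in> V" "x \<in> V" and p: "induced_P4 (complement V E) a b c d"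
  note g = graphD(4,5)[OF assms(1)]
  have c: "complement V E a b" "complement V E b c" "complement V E c d"
    "\<not> complement V E a c" "\<not> complement V E b d" "\<not> complement V E a d" using p unfolding induced_P4_def by auto
  have "complement V E a c \<longleftrightarrow> complement V E c a" using g(2)[of a c] unfolding complement_def by auto
  then have ne: "a \<noteq> c" "b \<noteq> d" "a \<noteq> d" using c by auto
  have E: "\<not> E a b" "\<not> E b c" "\<not> E c d" "E a c" "E b d" "E a d"
    using c V ne unfolding complement_def by auto
  then have q: "induced_P4 E b d a c"
    using g(2)[of b a] g(2)[of d a] g(2)[of d c] unfolding induced_P4_def by simp
  have "\<not> (E x b \<and> E x c)" "E x d \<or> E x a" using P4_dominatedD[OF assms(2,1) q V(5)] by simp_all
  \<comment> \<open>\<open>complement\<close> is irreflexive, so non-adjacency of \<open>x\<close>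
    and \<open>b\<close> says nothing when \<open>x = b\<close>; there the complement edge
    \<open>b c\<close> serves.\<close>
  moreover have "x = b \<or> x = c \<Longrightarrow> complement V E x b \<or> complement V E x c"
    using c(2) g(2)[of b c] V unfolding complement_def by auto
  ultimately show "\<not> (complement V E x a \<and> complement V E x d) \<and> (complement V E x b \<or> complement V E x c)"
    using V unfolding complement_def by auto
qed

lemma graph_complement: "graph V E \<Longrightarrow> graph V (complement V E)"
  unfolding graph_def complement_def by blast

text \<open>Each forbidden graph contains a P4 with a fifth vertex that violates domination. Long
  holes and the domino are covered because they contain P5.\<close>

lemma P4_dominated_distance_hereditary:
  assumes g: "graph V E" and p: "P4_dominated V E" shows "distance_hereditary V E"
proof -
  have key: "\<not> has_induced V E {0..<n} EH"
    if n: "{a, b, c, d, x} \<subseteq> {0..<n}" and P: "induced_P4 EH a b c d" and x: "EH x a \<and> EH x d \<or> \<not> EH x b \<and> \<not> EH x c"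
    for n a b c d x and EH :: "nat \<Rightarrow> nat \<Rightarrow> bool"
  proof
    assume "has_induced V E {0..<n} EH"
    then obtain f where "inj_on f {0..<n} \<and> f ` {0..<n} \<subseteq> V \<and>
        (\<forall>i\<in>{0..<n}. \<forall>j\<in>{0..<n}. E (f i) (f j) \<longleftrightarrow> EH i j)"
      unfolding has_induced_def by (rule exE)
    then have f: "f ` {0..<n} \<subseteq> V" "\<And>i j. i \<in> {0..<n} \<Longrightarrow> j \<in> {0..<n} \<Longrightarrow> E (f i) (f j) \<longleftrightarrow> EH i j"
      by simp_all
    have n': "a \<in> {0..<n}" "b \<in> {0..<n}" "c \<in> {0..<n}" "d \<in> {0..<n}" "x \<in> {0..<n}" using n by auto
    have q: "induced_P4 E (f a) (f b) (f c) (f d)"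
      using P unfolding induced_P4_def by (simp only: f(2) n') blast
    have fx: "f x \<in> V" using f(1) n'(5) by blast
    show False using P4_dominatedD[OF p g q fx] x by (simp only: f(2) n') blast
  qed
  have "\<not> has_induced V E {0..<n} (cycle_adj n)" if "n \<ge> 5" for n
  proof (rule key[of 0 1 2 3 4])
    have m: "Suc 0 mod n = 1" "Suc 1 mod n = 2" "Suc 2 mod n = 3" "Suc 3 mod n = 4" using that by simp_all
    \<comment> \<open>The only wrap-around among these vertices: the successor of \<open>4\<close>
      is \<open>0\<close> when \<open>n = 5\<close>. In either case \<open>4\<close> sees neither
      \<open>1\<close> nor \<open>2\<close>.\<close>
    have m5: "Suc 4 mod n = 0 \<or> Suc 4 mod n = 5" using that by (cases "n = 5") simp_all
    have l: "0 < n" "1 < n" "2 < n" "3 < n" "4 < n" using that by simp_all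
    show "{0, 1, 2, 3, 4} \<subseteq> {0..<n}" using l by simp
    show "induced_P4 (cycle_adj n) 0 1 2 3" unfolding induced_P4_def cycle_adj_def m using l by simp
    show "cycle_adj n 4 0 \<and> cycle_adj n 4 3 \<or> \<not> cycle_adj n 4 1 \<and> \<not> cycle_adj n 4 2"
      unfolding cycle_adj_def m using m5 l by auto
  qed
  moreover have "\<not> has_induced V E {0..<5} house_adj"
    by (rule key[of 1 2 3 4 0]) (auto simp: induced_P4_def house_adj_def edges_graph_def)
  moreover have "\<not> has_induced V E {0..<6} domino_adj"
    by (rule key[of 1 2 3 4 5]) (auto simp: induced_P4_def domino_adj_def edges_graph_def)
  moreover have "\<not> has_induced V E {0..<5} gem_adj"
    by (rule key[of 0 1 2 3 4]) (auto simp: induced_P4_def gem_adj_def edges_graph_def)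
  ultimately show ?thesis unfolding distance_hereditary_def by blast
qed

lemma DH_coDH_iff_P4_dominated:
  assumes "graph V E" shows "DH_coDH V E \<longleftrightarrow> P4_dominated V E"
  using DH_coDH_imp_P4_dominated[OF assms] P4_dominated_distance_hereditary[OF assms]
    P4_dominated_distance_hereditary[OF graph_complement[OF assms] P4_dominated_complement[OF assms]]
  unfolding DH_coDH_def by blast

section \<open>Cuts of rank one\<close>

text \<open>
  The witness \<open>f\<close> marks the frontier of the cut. A split is such a cut whose two sides both have at least two
  elements; dropping that condition makes the cuts closed under crossing intersections and symmetric differences.
\<close>
definition rank_one_cut :: "'a set \<Rightarrow> ('a \<Rightarrow> 'a \<Rightarrow> bool) \<Rightarrow> 'a set \<Rightarrow> bool" where
  "rank_one_cut W E A \<longleftrightarrow> A \<subseteq> W \<and> A \<noteq> {} \<and> A \<noteq> W \<and>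
     (\<exists>f. \<forall>a\<in>A. \<forall>b\<in>W - A. E a b \<longleftrightarrow> f a \<and> f b)"

text \<open>This is connectedness of \<open>W\<close>, in the form that labels inherit from
  \<open>G\<close> and that the rank arguments consume.\<close>

definition no_empty_cut :: "'a set \<Rightarrow> ('a \<Rightarrow> 'a \<Rightarrow> bool) \<Rightarrow> bool" where
  "no_empty_cut W E \<longleftrightarrow> (\<forall>A\<subseteq>W. A \<noteq> {} \<longrightarrow> A \<noteq> W \<longrightarrow> (\<exists>a\<in>A. \<exists>b\<in>W - A. E a b))"

definition crosses :: "'a set \<Rightarrow> 'a set \<Rightarrow> 'a set \<Rightarrow> bool" where
  "crosses W A C \<longleftrightarrow> A \<inter> C \<noteq> {} \<and> A - C \<noteq> {} \<and> C - A \<noteq> {} \<and> W - (A \<union> C) \<noteq> {}"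

lemma no_empty_cutE:
  assumes "no_empty_cut W E" "A \<subseteq> W" "A \<noteq> {}" "A \<noteq> W"
  obtains a b where "a \<in> A" "b \<in> W" "b \<notin> A" "E a b"
  using assms unfolding no_empty_cut_def by (meson DiffE)

lemma rank_one_cut_iff:
  assumes "A \<subseteq> W" "A \<noteq> {}" "A \<noteq> W" "graph W E"
  shows "rank_one_cut W E A \<longleftrightarrow>
    (\<forall>a\<in>A. \<forall>b\<in>W - A. (\<exists>b'\<in>W - A. E a b') \<longrightarrow> (\<exists>a'\<in>A. E a' b) \<longrightarrow> E a b)" (is "_ \<longleftrightarrow> ?R")
proof
  assume "rank_one_cut W E A"
  then obtain f where "\<forall>a\<in>A. \<forall>b\<in>W - A. E a b \<longleftrightarrow> f a \<and> f b" unfolding rank_one_cut_def by (elim conjE exE)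
  then show ?R by simp
next
  assume R: ?R
  \<comment> \<open>The frontier implicit in \<open>is_split\<close>: having a neighbour on the
    other side.\<close>
  define f where "f v \<longleftrightarrow> (if v \<in> A then \<exists>b\<in>W - A. E v b else \<exists>a\<in>A. E a v)" for v
  have "E a b \<longleftrightarrow> f a \<and> f b" if "a \<in> A" "b \<in> W - A" for a b
    using that R unfolding f_def by auto
  then show "rank_one_cut W E A" using assms(1-3) unfolding rank_one_cut_def by blast
qed

lemma rank_one_cut_compl:
  assumes "graph W E" "rank_one_cut W E A" shows "rank_one_cut W E (W - A)"
proof -
  obtain f where A: "A \<subseteq> W" "A \<noteq> {}" "A \<noteq> W" and f: "\<forall>a\<in>A. \<forall>b\<in>W - A. E a b \<longleftrightarrow> f a \<and> f b"
    using assms(2) unfolding rank_one_cut_def by (elim conjE exE)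
  have "E b a \<longleftrightarrow> f b \<and> f a" if "b \<in> W - A" "a \<in> W - (W - A)" for a b
    using that f graphD(5)[OF assms(1), of a b] A(1) by auto
  then show ?thesis using A unfolding rank_one_cut_def by blast
qed

text \<open>Submodularity: the ranks of \<open>A \<inter> C\<close> and \<open>A \<union> C\<close>
  add up to at most 2, and connectedness keeps both nonzero. The proof looks at the edges from the
  corner \<open>A \<inter> C\<close> to the corners \<open>A - C\<close>, \<open>C - A\<close> and
  \<open>W - (A \<union> C)\<close>.\<close>

lemma rank_one_cut_inter:
  assumes g: "graph W E" and con: "no_empty_cut W E"
    and A: "rank_one_cut W E A" and C: "rank_one_cut W E C"
    and ne: "A \<inter> C \<noteq> {}" "A \<union> C \<noteq> W"
  shows "rank_one_cut W E (A \<inter> C)"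
proof -
  note sym = graphD(5)[OF g]
  obtain f where AW: "A \<subseteq> W" "A \<noteq> W" and f: "\<And>a b. a \<in> A \<Longrightarrow> b \<in> W \<Longrightarrow> b \<notin> A \<Longrightarrow> E a b \<longleftrightarrow> f a \<and> f b"
    using A unfolding rank_one_cut_def by auto
  obtain h where CW: "C \<subseteq> W" "C \<noteq> W" and h: "\<And>a b. a \<in> C \<Longrightarrow> b \<in> W \<Longrightarrow> b \<notin> C \<Longrightarrow> E a b \<longleftrightarrow> h a \<and> h b"
    using C unfolding rank_one_cut_def by auto
  have "\<exists>k. \<forall>p\<in>A \<inter> C. \<forall>y\<in>W - A \<inter> C. E p y \<longleftrightarrow> k p \<and> k y"
  proof (cases "\<exists>p\<in>A \<inter> C. \<exists>s\<in>W - (A \<union> C). E p s")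
    case True
    then obtain p0 s0 where 0: "p0 \<in> A \<inter> C" "s0 \<in> W - (A \<union> C)" "E p0 s0" by blast
    \<comment> \<open>The edge \<open>p0 s0\<close> normalises both witnesses: on
      \<open>A \<inter> C\<close> each of \<open>f\<close> and \<open>h\<close> now expresses
      adjacency to \<open>s0\<close>.\<close>
    have fh: "f p \<longleftrightarrow> h p" if "p \<in> A \<inter> C" for p
      using that 0 f[of p s0] h[of p s0] f[of p0 s0] h[of p0 s0] by auto
    show ?thesis
      by (rule exI[of _ "\<lambda>v. if v \<in> A \<and> v \<notin> C then h v else f v"]) (use f h fh in auto)
  next
    case False
    then have nps: "\<not> E p s" if "p \<in> A" "p \<in> C" "s \<in> W" "s \<notin> A" "s \<notin> C" for p s using that by auto
    show ?thesis
    proof (cases "\<exists>p\<in>A \<inter> C. \<exists>q\<in>A - C. E p q")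
      case False
      then have npq: "\<not> E p q" if "p \<in> A" "p \<in> C" "q \<in> A" "q \<notin> C" for p q using that by auto
      have "E p y \<longleftrightarrow> f p \<and> f y \<and> y \<in> C" if "p \<in> A" "p \<in> C" "y \<in> W" "y \<notin> A \<or> y \<notin> C" for p y
        using that f[of p y] nps[of p y] npq[of p y] by (cases "y \<in> A"; cases "y \<in> C") simp_all
      then show ?thesis
        by (intro exI[of _ "\<lambda>v. f v \<and> v \<in> C"]) auto
    next
      case pq: True
      show ?thesis
      proof (cases "\<exists>p\<in>A \<inter> C. \<exists>r\<in>C - A. E p r")
        case False
        then have npr: "\<not> E p r" if "p \<in> A" "p \<in> C" "r \<in> C" "r \<notin> A" for p r using that by auto
        have "E p y \<longleftrightarrow> h p \<and> h y \<and> y \<in> A" if "p \<in> A" "p \<in> C" "y \<in> W" "y \<notin> A \<or> y \<notin> C" for p y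
          using that h[of p y] nps[of p y] npr[of p y] by (cases "y \<in> A"; cases "y \<in> C") simp_all
        then show ?thesis
          by (intro exI[of _ "\<lambda>v. h v \<and> v \<in> A"]) auto
      next
        case pr: True
        obtain p q where 1: "p \<in> A \<inter> C" "q \<in> A - C" "E p q" using pq by blast
        obtain p' r where 2: "p' \<in> A \<inter> C" "r \<in> C - A" "E p' r" using pr by blast
        \<comment> \<open>Edges from \<open>A \<inter> C\<close> to both adjacent corners but not to
          the opposite one make \<open>f\<close> and \<open>h\<close> vanish on the outer corner,
          which would then be isolated.\<close>
        have hp: "h p" using 1 h[of p q] AW by auto
        have fp: "f p'" using 2 f[of p' r] CW by auto
        have "W - (A \<union> C) \<subseteq> W" "W - (A \<union> C) \<noteq> {}" "W - (A \<union> C) \<noteq> W" using ne AW CW by auto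
        obtain s y where "s \<in> W - (A \<union> C)" "y \<in> W" "y \<notin> W - (A \<union> C)" "E s y"
          by (rule no_empty_cutE[OF con \<open>W - (A \<union> C) \<subseteq> W\<close> \<open>W - (A \<union> C) \<noteq> {}\<close> \<open>W - (A \<union> C) \<noteq> W\<close>])
        then have 3: "s \<in> W - (A \<union> C)" "y \<in> A \<union> C" "E s y" by auto
        have s: "s \<in> W" "s \<notin> A" "s \<notin> C" using 3 by auto
        have fs: "\<not> f s" using f[of p' s] fp nps[of p' s] 2 s by auto
        have hs: "\<not> h s" using h[of p s] hp nps[of p s] 1 s by auto
        have "E y s" using 3 sym by blast
        then have False using 3(2) f[of y s] h[of y s] fs hs s by auto
        then show ?thesis ..
      qed
    qed
  qed
  then show ?thesis using ne AW unfolding rank_one_cut_def by blast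
qed

text \<open>An edge between \<open>A \<inter> C\<close> and the outer corner forces \<open>f\<close>
  and \<open>h\<close> to agree on these two corners. If \<open>A - C\<close> and
  \<open>C - A\<close> are joined too, they agree there as well and \<open>f\<close> is a witness.
  Otherwise each of \<open>f\<close>, \<open>h\<close> vanishes on one of these two, and by
  connectedness not on the same one; then only one of \<open>A \<inter> C\<close> and the outer
  corner has edges to the symmetric difference.\<close>

lemma rank_one_cut_symdiff_aux:
  assumes g: "graph W E" and con: "no_empty_cut W E"
    and A: "rank_one_cut W E A" and C: "rank_one_cut W E C" and cr: "crosses W A C"
    and ps: "p0 \<in> A \<inter> C" "s0 \<in> W - (A \<union> C)" "E p0 s0"
  shows "rank_one_cut W E ((A - C) \<union> (C - A))"
proof -
  have sym: "E x y \<longleftrightarrow> E y x" for x y by (rule graphD(5)[OF g])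
  obtain f where AW: "A \<subseteq> W" "A \<noteq> W" and f: "\<And>a b. a \<in> A \<Longrightarrow> b \<in> W \<Longrightarrow> b \<notin> A \<Longrightarrow> E a b \<longleftrightarrow> f a \<and> f b"
    using A unfolding rank_one_cut_def by auto
  obtain h where CW: "C \<subseteq> W" "C \<noteq> W" and h: "\<And>a b. a \<in> C \<Longrightarrow> b \<in> W \<Longrightarrow> b \<notin> C \<Longrightarrow> E a b \<longleftrightarrow> h a \<and> h b"
    using C unfolding rank_one_cut_def by auto
  have f0: "f p0" "f s0" "h p0" "h s0" using ps f[of p0 s0] h[of p0 s0] by auto
  have P: "f p \<longleftrightarrow> h p" if "p \<in> A" "p \<in> C" for p
    using that ps f0 f[of p s0] h[of p s0] by auto
  have S: "f s \<longleftrightarrow> h s" if "s \<in> W" "s \<notin> A" "s \<notin> C" for s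
    using that ps f0 f[of p0 s] h[of p0 s] by auto
  have Q: "(f q \<and> f r \<longleftrightarrow> h q \<and> h r) \<and> (E q r \<longleftrightarrow> f q \<and> f r)" if "q \<in> A - C" "r \<in> C - A" for q r
    using that f[of q r] h[of r q] AW CW sym[of q r] by auto
  have qp: "E q p \<longleftrightarrow> h p \<and> h q" if "q \<in> A - C" "p \<in> A \<inter> C" for q p
    using that h[of p q] AW sym[of p q] by auto
  have qs: "E q s \<longleftrightarrow> f q \<and> f s" if "q \<in> A - C" "s \<in> W - (A \<union> C)" for q s
    using that f[of q s] by auto
  have rp: "E r p \<longleftrightarrow> f p \<and> f r" if "r \<in> C - A" "p \<in> A \<inter> C" for r p
    using that f[of p r] CW sym[of p r] by auto
  have rs: "E r s \<longleftrightarrow> h r \<and> h s" if "r \<in> C - A" "s \<in> W - (A \<union> C)" for r s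
    using that h[of r s] by auto
  have four: "(\<forall>x\<in>(A - C) \<union> (C - A). \<forall>y\<in>W - ((A - C) \<union> (C - A)). E x y \<longleftrightarrow> k x \<and> k y)"
    if "\<And>q p. q \<in> A - C \<Longrightarrow> p \<in> A \<inter> C \<Longrightarrow> E q p \<longleftrightarrow> k q \<and> k p"
      "\<And>q s. q \<in> A - C \<Longrightarrow> s \<in> W - (A \<union> C) \<Longrightarrow> E q s \<longleftrightarrow> k q \<and> k s"
      "\<And>r p. r \<in> C - A \<Longrightarrow> p \<in> A \<inter> C \<Longrightarrow> E r p \<longleftrightarrow> k r \<and> k p"
      "\<And>r s. r \<in> C - A \<Longrightarrow> s \<in> W - (A \<union> C) \<Longrightarrow> E r s \<longleftrightarrow> k r \<and> k s" for k
  proof (intro ballI)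
    fix x y assume "x \<in> (A - C) \<union> (C - A)" "y \<in> W - ((A - C) \<union> (C - A))"
    then have "x \<in> A - C \<or> x \<in> C - A" "y \<in> A \<inter> C \<or> y \<in> W - (A \<union> C)" by auto
    then show "E x y \<longleftrightarrow> k x \<and> k y" by (elim disjE) (simp_all add: that)
  qed
  have "\<exists>k. \<forall>x\<in>(A - C) \<union> (C - A). \<forall>y\<in>W - ((A - C) \<union> (C - A)). E x y \<longleftrightarrow> k x \<and> k y"
  proof (cases "\<exists>q\<in>A - C. \<exists>r\<in>C - A. f q \<and> f r")
    case True
    then obtain q0 r0 where 0: "q0 \<in> A - C" "r0 \<in> C - A" "f q0" "f r0" by blast
    then have h0: "h q0" "h r0" using Q[of q0 r0] by auto
    have fq: "f q \<longleftrightarrow> h q" if "q \<in> A - C" for q using Q[OF that 0(2)] h0 0 by auto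
    have fr: "f r \<longleftrightarrow> h r" if "r \<in> C - A" for r using Q[OF 0(1) that] h0 0 by auto
    show ?thesis
      by (rule exI[of _ f], rule four) (use qp qs rp rs fq fr P S in auto)
  next
    case False
    then have F: "(\<forall>q\<in>A - C. \<not> f q) \<or> (\<forall>r\<in>C - A. \<not> f r)" by blast
    have "\<not> (h q \<and> h r)" if "q \<in> A - C" "r \<in> C - A" for q r using Q[OF that] False that by auto
    then have H: "(\<forall>q\<in>A - C. \<not> h q) \<or> (\<forall>r\<in>C - A. \<not> h r)" by blast
    have noE: "\<not> E q r" if "q \<in> A - C" "r \<in> C - A" for q r using Q[OF that] False that by auto
    have isoQ: False if "\<forall>q\<in>A - C. \<not> f q" "\<forall>q\<in>A - C. \<not> h q"
    proof -
      have ne: "A - C \<subseteq> W" "A - C \<noteq> {}" "A - C \<noteq> W" using cr AW unfolding crosses_def by auto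
      obtain q y where y: "q \<in> A - C" "y \<in> W" "y \<notin> A - C" "E q y" by (rule no_empty_cutE[OF con ne])
      then have "y \<in> A \<inter> C \<or> y \<in> C - A \<or> y \<in> W - (A \<union> C)" by auto
      then show False using y(1,4) qp[of q y] qs[of q y] noE[of q y] that by auto
    qed
    have isoR: False if "\<forall>r\<in>C - A. \<not> f r" "\<forall>r\<in>C - A. \<not> h r"
    proof -
      have ne: "C - A \<subseteq> W" "C - A \<noteq> {}" "C - A \<noteq> W" using cr CW unfolding crosses_def by auto
      obtain q y where y: "q \<in> C - A" "y \<in> W" "y \<notin> C - A" "E q y" by (rule no_empty_cutE[OF con ne])
      then have "y \<in> A \<inter> C \<or> y \<in> A - C \<or> y \<in> W - (A \<union> C)" by auto
      then show False using y(1,4) rp[of q y] rs[of q y] noE[of y q] sym[of q y] that by auto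
    qed
    from F H consider "\<forall>q\<in>A - C. \<not> f q" "\<forall>r\<in>C - A. \<not> h r" | "\<forall>r\<in>C - A. \<not> f r" "\<forall>q\<in>A - C. \<not> h q"
      using isoQ isoR by blast
    then show ?thesis
    proof cases
      case 1
      show ?thesis
        by (rule exI[of _ "\<lambda>v. v \<in> A \<union> C \<and> (if v \<in> A then h v else f v)"], rule four)
          (use qp qs rp rs 1 P in auto)
    next
      case 2
      show ?thesis
        by (rule exI[of _ "\<lambda>v. \<not> (v \<in> A \<and> v \<in> C) \<and> (if v \<in> C then h v else f v)"], rule four)
          (use qp qs rp rs 2 S in auto)
    qed
  qed
  then show ?thesis using cr AW CW unfolding rank_one_cut_def crosses_def by blast
qed

text \<open>An edge between \<open>A \<inter> C\<close> and the outer corner is the auxiliary case;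
  one between \<open>A - C\<close> and \<open>C - A\<close> reduces to it on replacing
  \<open>C\<close> by its complement. Connectedness excludes that both diagonals are empty.\<close>

lemma rank_one_cut_symdiff:
  assumes g: "graph W E" and con: "no_empty_cut W E"
    and A: "rank_one_cut W E A" and C: "rank_one_cut W E C" and cr: "crosses W A C"
  shows "rank_one_cut W E ((A - C) \<union> (C - A))"
proof -
  have AW: "A \<subseteq> W" and CW: "C \<subseteq> W" using A C unfolding rank_one_cut_def by auto
  show ?thesis
  proof (cases "\<exists>p\<in>A \<inter> C. \<exists>s\<in>W - (A \<union> C). E p s")
    case True
    then show ?thesis using rank_one_cut_symdiff_aux[OF g con A C cr] by blast
  next
    case nps: False
    show ?thesis
    proof (cases "\<exists>q\<in>A - C. \<exists>r\<in>C - A. E q r")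
      case True
      then obtain q r where qr: "q \<in> A - C" "r \<in> C - A" "E q r" by blast
      have cr': "crosses W A (W - C)" using cr AW CW unfolding crosses_def by auto
      have m: "q \<in> A \<inter> (W - C)" "r \<in> W - (A \<union> (W - C))" using qr AW CW by auto
      have "rank_one_cut W E ((A - (W - C)) \<union> ((W - C) - A))"
        by (rule rank_one_cut_symdiff_aux[OF g con A rank_one_cut_compl[OF g C] cr' m qr(3)])
      from rank_one_cut_compl[OF g this] show ?thesis
        by (rule back_subst[where P="rank_one_cut W E"]) (use AW CW in auto)
    next
      case nqr: False
      have sym: "E x y \<longleftrightarrow> E y x" for x y by (rule graphD(5)[OF g])
      obtain f where f: "\<And>a b. a \<in> A \<Longrightarrow> b \<in> W \<Longrightarrow> b \<notin> A \<Longrightarrow> E a b \<longleftrightarrow> f a \<and> f b"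
        using A unfolding rank_one_cut_def by auto
      obtain h where h: "\<And>a b. a \<in> C \<Longrightarrow> b \<in> W \<Longrightarrow> b \<notin> C \<Longrightarrow> E a b \<longleftrightarrow> h a \<and> h b"
        using C unfolding rank_one_cut_def by auto
      have cut: "\<exists>x\<in>X. \<exists>y\<in>W - X. E x y" if "X \<subseteq> W" "X \<noteq> {}" "X \<noteq> W" for X
        using con that unfolding no_empty_cut_def by simp
      have edge: "a \<in> A \<inter> C \<and> b \<in> A - C \<and> h a \<and> h b \<or> a \<in> A \<inter> C \<and> b \<in> C - A \<and> f a \<and> f b
          \<or> a \<in> W - (A \<union> C) \<and> b \<in> A - C \<and> f a \<and> f b \<or> a \<in> W - (A \<union> C) \<and> b \<in> C - A \<and> h a \<and> h b"
        if e: "E a b" and a: "a \<in> A \<inter> C \<or> a \<in> W - (A \<union> C)" and b: "b \<in> A - C \<or> b \<in> C - A" for a b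
        using a b
      proof (elim disjE)
        assume "a \<in> A \<inter> C" "b \<in> A - C" then show ?thesis using h[of a b] e AW by auto
      next
        assume "a \<in> A \<inter> C" "b \<in> C - A" then show ?thesis using f[of a b] e CW by auto
      next
        assume "a \<in> W - (A \<union> C)" "b \<in> A - C" then show ?thesis using f[of b a] sym[of a b] e by auto
      next
        assume "a \<in> W - (A \<union> C)" "b \<in> C - A" then show ?thesis using h[of b a] sym[of a b] e by auto
      qed
      have neq: "A \<inter> C \<noteq> {}" "A - C \<noteq> {}" "C - A \<noteq> {}" "W - (A \<union> C) \<noteq> {}"
        using cr unfolding crosses_def by auto
      have f1: "\<not> (f p \<and> f s)" if "p \<in> A \<inter> C" "s \<in> W - (A \<union> C)" for p s
        using nps f[of p s] that by auto
      have h1: "\<not> (h p \<and> h s)" if "p \<in> A \<inter> C" "s \<in> W - (A \<union> C)" for p s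
        using nps h[of p s] that by auto
      have f2: "\<not> (f q \<and> f r)" if "q \<in> A - C" "r \<in> C - A" for q r
        using nqr f[of q r] that CW by auto
      have h2: "\<not> (h q \<and> h r)" if "q \<in> A - C" "r \<in> C - A" for q r
        using nqr h[of r q] that AW sym[of q r] by auto
      have P: "\<exists>x\<in>A \<inter> C. f x \<or> h x"
      proof -
        obtain x y where xy: "x \<in> A \<inter> C" "y \<in> W - A \<inter> C" "E x y" using cut[of "A \<inter> C"] neq AW by blast
        then have "y \<in> A - C \<or> y \<in> C - A" using nps by auto
        then show ?thesis using edge[OF xy(3)] xy by auto
      qed
      have S: "\<exists>x\<in>W - (A \<union> C). f x \<or> h x"
      proof -
        obtain x y where xy: "x \<in> W - (A \<union> C)" "y \<in> W - (W - (A \<union> C))" "E x y"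
          using cut[of "W - (A \<union> C)"] neq AW by blast
        then have "y \<in> A - C \<or> y \<in> C - A" using nps sym[of x y] by auto
        then show ?thesis using edge[OF xy(3)] xy by auto
      qed
      have A': "\<exists>x\<in>A. \<exists>y\<in>W - A. f x \<and> f y" using cut[of A] f neq AW by blast
      have C': "\<exists>x\<in>C. \<exists>y\<in>W - C. h x \<and> h y" using cut[of C] h neq CW by blast
      have Q: "\<exists>x\<in>A - C. f x \<or> h x"
      proof -
        obtain x y where xy: "x \<in> A - C" "y \<in> W - (A - C)" "E x y"
          using cut[of "A - C"] neq AW by blast
        then have "y \<in> A \<inter> C \<or> y \<in> W - (A \<union> C)" using nqr AW CW by auto
        moreover have "E y x" using sym xy by blast
        ultimately show ?thesis using edge[of y x] xy by auto
      qed
      have R: "\<exists>x\<in>C - A. f x \<or> h x"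
      proof -
        obtain x y where xy: "x \<in> C - A" "y \<in> W - (C - A)" "E x y"
          using cut[of "C - A"] neq CW by blast
        then have "y \<in> A \<inter> C \<or> y \<in> W - (A \<union> C)" using nqr AW CW sym[of x y] by auto
        moreover have "E y x" using sym xy by blast
        ultimately show ?thesis using edge[of y x] xy by auto
      qed
      \<comment> \<open>With both diagonals empty, each witness vanishes on a corner of each
        diagonal, the two witnesses never vanish on the same corner, and neither vanishes on a whole
        side of its own cut. Going round the four corners, these requirements clash.\<close>
      define zero where "zero g X \<longleftrightarrow> (\<forall>x\<in>X. \<not> g x)" for g :: "'a \<Rightarrow> bool" and X
      have "\<not> (zero f (A \<inter> C) \<and> zero h (A \<inter> C))" "\<not> (zero f (W - (A \<union> C)) \<and> zero h (W - (A \<union> C)))"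
        "\<not> (zero f (A - C) \<and> zero h (A - C))" "\<not> (zero f (C - A) \<and> zero h (C - A))"
        using P Q R S unfolding zero_def by blast+
      moreover have "zero f (A \<inter> C) \<or> zero f (W - (A \<union> C))" "zero h (A \<inter> C) \<or> zero h (W - (A \<union> C))"
        "zero f (A - C) \<or> zero f (C - A)" "zero h (A - C) \<or> zero h (C - A)"
        using f1 h1 f2 h2 unfolding zero_def by blast+
      moreover have "\<not> (zero f (A \<inter> C) \<and> zero f (A - C))" "\<not> (zero f (C - A) \<and> zero f (W - (A \<union> C)))"
        using A' AW unfolding zero_def by blast+
      moreover have "\<not> (zero h (A \<inter> C) \<and> zero h (C - A))" "\<not> (zero h (A - C) \<and> zero h (W - (A \<union> C)))"
        using C' CW unfolding zero_def by blast+
      ultimately have False by blast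
      then show ?thesis ..
    qed
  qed
qed

text \<open>
  Consider a partition of \<open>W\<close> with as many blocks as possible such that all unions of blocks lie in \<open>G\<close>. A block with
  two elements is crossed by some \<open>Z\<close>, and cutting it along \<open>Z\<close> gives a finer partition of the same kind; so all
  blocks are singletons.
\<close>
lemma crossing_family_all:
  fixes G :: "'a set \<Rightarrow> bool"
  assumes fin: "finite W" and proper: "\<And>A. G A \<Longrightarrow> A \<subseteq> W \<and> A \<noteq> {} \<and> A \<noteq> W"
    and compl: "\<And>A. G A \<Longrightarrow> G (W - A)"
    and inter: "\<And>A C. G A \<Longrightarrow> G C \<Longrightarrow> A \<inter> C \<noteq> {} \<Longrightarrow> A \<union> C \<noteq> W \<Longrightarrow> G (A \<inter> C)"
    and symdiff: "\<And>A C. G A \<Longrightarrow> G C \<Longrightarrow> crosses W A C \<Longrightarrow> G ((A - C) \<union> (C - A))"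
    and start: "G A0" "card A0 \<ge> 2" "card (W - A0) \<ge> 2"
    and crossed: "\<And>A. G A \<Longrightarrow> card A \<ge> 2 \<Longrightarrow> card (W - A) \<ge> 2 \<Longrightarrow> \<exists>Z. G Z \<and> crosses W A Z"
    and A: "A \<subseteq> W" "A \<noteq> {}" "A \<noteq> W"
  shows "G A"
proof -
  \<comment> \<open>The last conjunct ensures that the complement of a block has two elements: for
    the initial partition by \<open>start\<close>, otherwise because at least two other blocks
    remain.\<close>
  define part where "part P \<longleftrightarrow> \<Union>P = W \<and> {} \<notin> P \<and> (\<forall>X\<in>P. \<forall>Y\<in>P. X \<noteq> Y \<longrightarrow> X \<inter> Y = {})
    \<and> (\<forall>Q\<subseteq>P. Q \<noteq> {} \<longrightarrow> Q \<noteq> P \<longrightarrow> G (\<Union>Q)) \<and> (P = {A0, W - A0} \<or> card P \<ge> 3)" for P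
  have union: "G (A \<union> C)" if "G A" "G C" "A \<inter> C \<noteq> {}" "A \<union> C \<noteq> W" for A C
  proof -
    have "A \<subseteq> W" "C \<subseteq> W" using proper that by blast+
    then have "G ((W - A) \<inter> (W - C))" using inter[OF compl[OF that(1)] compl[OF that(2)]] that(3,4) by blast
    from compl[OF this] show ?thesis by (rule back_subst[where P=G]) (use \<open>A \<subseteq> W\<close> \<open>C \<subseteq> W\<close> in auto)
  qed
  have fin_part: "P \<subseteq> Pow W" if "part P" for P using that unfolding part_def by auto
  have "part {A0, W - A0}"
  proof -
    have p: "A0 \<subseteq> W" "A0 \<noteq> {}" "A0 \<noteq> W" using proper start by auto
    have "G (\<Union>Q)" if "Q \<subseteq> {A0, W - A0}" "Q \<noteq> {}" "Q \<noteq> {A0, W - A0}" for Q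
    proof -
      have "Q = {A0} \<or> Q = {W - A0}" using that by auto
      then show ?thesis using start compl by auto
    qed
    then show ?thesis using p unfolding part_def by auto
  qed
  moreover have "\<forall>P. part P \<longrightarrow> card P \<le> card (Pow W)"
    using fin_part fin by (simp add: card_mono)
  ultimately obtain P where P: "part P" and max: "\<And>P'. part P' \<Longrightarrow> card P' \<le> card P"
    using ex_has_greatest_nat[of part _ card] by (metis le_imp_less_Suc)
  have PW: "\<Union>P = W" "{} \<notin> P" and disj: "\<And>X Y. X \<in> P \<Longrightarrow> Y \<in> P \<Longrightarrow> X \<noteq> Y \<Longrightarrow> X \<inter> Y = {}"
    and GQ: "\<And>Q. Q \<subseteq> P \<Longrightarrow> Q \<noteq> {} \<Longrightarrow> Q \<noteq> P \<Longrightarrow> G (\<Union>Q)" and P3: "P = {A0, W - A0} \<or> card P \<ge> 3"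
    using P unfolding part_def by auto
  have finP: "finite P" using fin_part[OF P] fin finite_subset by blast
  have A0: "A0 \<noteq> W - A0" using start proper by blast
  then have c2: "card {A0, W - A0} = 2" unfolding card_2_iff by blast
  have P2: "card P \<ge> 2" using P3
  proof
    assume "P = {A0, W - A0}"
    then show ?thesis using c2 by (metis order_refl)
  qed linarith
  have single: "card X < 2" if X: "X \<in> P" for X
  proof (rule ccontr)
    assume "\<not> card X < 2"
    then have X2: "card X \<ge> 2" by simp
    have XW: "X \<subseteq> W" using PW X by auto
    have rest: "W - X = \<Union>(P - {X})" using PW disj X by blast
    have "P \<noteq> {X}" using P2 by force
    then have GX: "G X" using GQ[of "{X}"] X by simp
    have "card (W - X) \<ge> 2"
      using P3
    proof
      assume "P = {A0, W - A0}"
      then have "X = A0 \<or> X = W - A0" using X by auto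
      then have "W - X = W - A0 \<or> W - X = A0" using proper start(1) by blast
      then show ?thesis using start by auto
    next
      assume "card P \<ge> 3"
      then have "card (P - {X}) \<ge> 2" using X finP by (simp add: card_Diff_singleton)
      then have "\<not> card (P - {X}) \<le> Suc 0" by simp
      then obtain Y Z where YZ: "Y \<in> P - {X}" "Z \<in> P - {X}" "Y \<noteq> Z"
        by (metis card_le_Suc0_iff_eq finP finite_Diff)
      then have "Y \<noteq> {}" "Z \<noteq> {}" using PW by auto
      then obtain y z where yz: "y \<in> Y" "z \<in> Z" by blast
      have "y \<noteq> z" using disj[of Y Z] YZ yz by auto
      moreover have "{y, z} \<subseteq> W - X" using yz YZ rest by auto
      ultimately show ?thesis using card_mono[of "W - X" "{y, z}"] fin by simp
    qed
    then obtain Z where GZ: "G Z" and cr: "crosses W X Z" using crossed GX X2 by blast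
    have ZW: "Z \<subseteq> W" using proper GZ by blast
    have ne: "X \<inter> Z \<noteq> {}" "X - Z \<noteq> {}" "Z - X \<noteq> {}" "W - (X \<union> Z) \<noteq> {}"
      using cr unfolding crosses_def by auto
    have GXZ: "G (X \<inter> Z)" using inter[OF GX GZ] ne by auto
    have "G (X \<inter> (W - Z))" by (rule inter[OF GX compl[OF GZ]]) (use ne XW ZW in blast)+
    moreover have "X \<inter> (W - Z) = X - Z" using XW by auto
    ultimately have GXmZ: "G (X - Z)" by simp
    \<comment> \<open>Only the trace of \<open>T\<close> on \<open>X\<close> matters here, while
      \<open>main\<close> needs its set to meet \<open>U\<close> and to miss a point of the
      remaining blocks. If \<open>T\<close> fails, the complement of the symmetric difference of
      \<open>X\<close> and \<open>T\<close> has the same trace on \<open>X\<close> and the opposite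
      one outside \<open>X\<close>, and succeeds.\<close>
    have key: "G ((X \<inter> T) \<union> U)" if GT: "G T" and crT: "crosses W X T"
      and U: "U \<subseteq> W - X" "U \<noteq> {}" "U \<noteq> W - X" "G U" "G (U \<union> X)" for T U
    proof -
      have TW: "T \<subseteq> W" using proper GT by blast
      have main: "G ((X \<inter> T') \<union> U)" if "G T'" "T' \<inter> U \<noteq> {}" "W - X - U - T' \<noteq> {}" for T'
      proof -
        have "G (T' \<union> U)" by (rule union[OF that(1) U(4) that(2)]) (use that(3) in auto)
        then have "G ((T' \<union> U) \<inter> (U \<union> X))" by (rule inter[OF _ U(5)]) (use U that(3) in auto)
        then show ?thesis by (rule back_subst[where P=G]) (use U in auto)
      qed
      have neT: "T - X \<noteq> {}" "W - (X \<union> T) \<noteq> {}" using crT unfolding crosses_def by auto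
      show ?thesis
      proof (cases "T \<inter> U \<noteq> {} \<and> W - X - U - T \<noteq> {}")
        case True
        then show ?thesis using main[OF GT] by blast
      next
        case False
        let ?T = "W - ((X - T) \<union> (T - X))"
        have 1: "G ?T" by (rule compl[OF symdiff[OF GX GT crT]])
        have "U - T \<noteq> {} \<and> (W - X - U) \<inter> T \<noteq> {}" using False neT U TW by blast
        moreover have "?T \<inter> U = U - T" "W - X - U - ?T = (W - X - U) \<inter> T" using U by auto
        ultimately have "G ((X \<inter> ?T) \<union> U)" using main[OF 1] by simp
        then show ?thesis by (rule back_subst[where P=G]) (use XW in auto)
      qed
    qed
    let ?P' = "insert (X \<inter> Z) (insert (X - Z) (P - {X}))"
    have notin: "X \<inter> Z \<notin> P" "X - Z \<notin> P" using disj[OF X] ne by blast+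
    have neqP: "X \<inter> Z \<noteq> X - Z" using ne by blast
    have card': "card ?P' = Suc (card P)"
      using notin neqP finP X by (simp add: card_Diff_singleton) (use P2 in simp)
    have "part ?P'"
      unfolding part_def
    proof (intro conjI)
      show "\<Union>?P' = W" using PW X by auto
      show "{} \<notin> ?P'" using ne PW by auto
      have d: "X \<inter> Y = {}" if "Y \<in> P - {X}" for Y using that disj[OF X, of Y] by auto
      show "\<forall>Xa\<in>?P'. \<forall>Y\<in>?P'. Xa \<noteq> Y \<longrightarrow> Xa \<inter> Y = {}"
      proof (intro ballI impI)
        fix S T assume ST: "S \<in> ?P'" "T \<in> ?P'" "S \<noteq> T"
        have 1: "S = X \<inter> Z \<or> S = X - Z \<or> S \<in> P - {X}" "T = X \<inter> Z \<or> T = X - Z \<or> T \<in> P - {X}"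
          using ST by blast+
        show "S \<inter> T = {}"
        proof (cases "S \<in> P - {X} \<and> T \<in> P - {X}")
          case True then show ?thesis using disj ST(3) by blast
        next
          case False then show ?thesis using 1 ST(3) d[of S] d[of T] by blast
        qed
      qed
      show "\<forall>Q\<subseteq>?P'. Q \<noteq> {} \<longrightarrow> Q \<noteq> ?P' \<longrightarrow> G (\<Union>Q)"
      proof (intro allI impI)
        fix Q assume Q: "Q \<subseteq> ?P'" "Q \<noteq> {}" "Q \<noteq> ?P'"
        define Q0 where "Q0 = Q \<inter> (P - {X})"
        define U where "U = \<Union>Q0"
        have Q0P: "Q0 \<subseteq> P - {X}" unfolding Q0_def by auto
        have UX: "U \<subseteq> W - X" using Q0P rest unfolding U_def by auto
        have U0: "Q0 = {} \<longleftrightarrow> U = {}" using Q0P PW(2) unfolding U_def by auto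
        have U1: "Q0 = P - {X}" if UW: "U = W - X"
        proof (rule ccontr)
          assume "Q0 \<noteq> P - {X}"
          then obtain Y where Y: "Y \<in> P - {X}" "Y \<notin> Q0" using Q0P by blast
          then obtain y where y: "y \<in> Y" using PW(2) by (metis DiffD1 ex_in_conv)
          then have "y \<in> U" using UW rest Y by auto
          then obtain Y' where "Y' \<in> Q0" "y \<in> Y'" unfolding U_def by auto
          then show False using disj[of Y Y'] Y y Q0P by blast
        qed
        have GU: "G U" if "U \<noteq> {}"
        proof -
          have "Q0 \<subseteq> P" "Q0 \<noteq> {}" "Q0 \<noteq> P" using that U0 Q0P X by auto
          then show ?thesis using GQ unfolding U_def by blast
        qed
        have GUX: "G (U \<union> X)" if "U \<noteq> W - X"
        proof -
          have "Q0 \<noteq> P - {X}" using that rest unfolding U_def by auto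
          then have "insert X Q0 \<subseteq> P" "insert X Q0 \<noteq> {}" "insert X Q0 \<noteq> P" using Q0P X by auto
          then have "G (\<Union>(insert X Q0))" using GQ by blast
          then show ?thesis by (rule back_subst[where P=G]) (auto simp: U_def)
        qed
        have QU: "\<Union>Q = U \<union> (if X \<inter> Z \<in> Q then X \<inter> Z else {}) \<union> (if X - Z \<in> Q then X - Z else {})"
        proof -
          have "Q = Q0 \<union> (Q \<inter> {X \<inter> Z}) \<union> (Q \<inter> {X - Z})" using Q unfolding Q0_def by auto
          then have "\<Union>Q = U \<union> \<Union>(Q \<inter> {X \<inter> Z}) \<union> \<Union>(Q \<inter> {X - Z})" unfolding U_def by (metis Union_Un_distrib)
          then show ?thesis by auto
        qed
        have crC: "crosses W X (W - Z)" using cr XW ZW unfolding crosses_def by auto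
        have k1: "G (U \<union> (X \<inter> Z))"
        proof (cases "U = {} \<or> U = W - X")
          case True
          then show ?thesis
          proof
            assume "U = {}" then show ?thesis using GXZ by simp
          next
            assume U: "U = W - X"
            show ?thesis using compl[OF GXmZ] by (rule back_subst[where P=G]) (use U XW in auto)
          qed
        next
          case False
          then show ?thesis using key[OF GZ cr UX] GU GUX by (simp add: Un_commute)
        qed
        have k2: "G (U \<union> (X - Z))"
        proof (cases "U = {} \<or> U = W - X")
          case True
          then show ?thesis
          proof
            assume "U = {}" then show ?thesis using GXmZ by simp
          next
            assume U: "U = W - X"
            show ?thesis using compl[OF GXZ] by (rule back_subst[where P=G]) (use U XW in auto)
          qed
        next
          case False
          then have "G (X \<inter> (W - Z) \<union> U)" using key[OF compl[OF GZ] crC UX] GU GUX by blast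
          then show ?thesis by (rule back_subst[where P=G]) (use XW in auto)
        qed
        show "G (\<Union>Q)"
        proof (cases "X \<inter> Z \<in> Q"; cases "X - Z \<in> Q")
          assume b: "X \<inter> Z \<in> Q" "X - Z \<in> Q"
          have "U \<noteq> W - X"
          proof
            assume "U = W - X"
            then have "P - {X} \<subseteq> Q" using U1 unfolding Q0_def by auto
            then show False using b Q by auto
          qed
          moreover have "\<Union>Q = U \<union> X" using QU b by auto
          ultimately show ?thesis using GUX by simp
        next
          assume b: "X \<inter> Z \<in> Q" "X - Z \<notin> Q"
          then have "\<Union>Q = U \<union> (X \<inter> Z)" using QU by simp
          then show ?thesis using k1 by simp
        next
          assume b: "X \<inter> Z \<notin> Q" "X - Z \<in> Q"
          then have "\<Union>Q = U \<union> (X - Z)" using QU by simp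
          then show ?thesis using k2 by simp
        next
          assume b: "X \<inter> Z \<notin> Q" "X - Z \<notin> Q"
          then have "\<Union>Q = U" "Q = Q0" using QU Q unfolding Q0_def by auto
          then show ?thesis using GU U0 Q(2) by simp
        qed
      qed
      show "?P' = {A0, W - A0} \<or> 3 \<le> card ?P'" using card' P2 by simp
    qed
    then show False using max card' by fastforce
  qed
  have sing: "{x} \<in> P" if x: "x \<in> W" for x
  proof -
    obtain X where X: "X \<in> P" "x \<in> X" using PW(1) x by blast
    have "finite X" using X PW fin by (meson Union_upper finite_subset)
    then have "card X = 1" using single[OF X(1)] X(2) by (metis One_nat_def card_gt_0_iff empty_iff less_2_cases neq0_conv)
    then show ?thesis using X by (metis card_1_singletonE singletonD)
  qed
  let ?Q = "(\<lambda>x. {x}) ` A"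
  have "?Q \<subseteq> P" using sing A by auto
  moreover have "?Q \<noteq> {}" using A by auto
  moreover have "\<Union>?Q = A" by auto
  moreover have "?Q \<noteq> P" using A PW \<open>\<Union>?Q = A\<close> by metis
  ultimately show ?thesis using GQ by metis
qed

section \<open>Graphs in which every cut has rank one\<close>

definition complete_graph :: "'a set \<Rightarrow> ('a \<Rightarrow> 'a \<Rightarrow> bool) \<Rightarrow> bool" where
  "complete_graph W E \<longleftrightarrow> (\<forall>x\<in>W. \<forall>y\<in>W. x \<noteq> y \<longrightarrow> E x y)"

definition star_graph :: "'a set \<Rightarrow> ('a \<Rightarrow> 'a \<Rightarrow> bool) \<Rightarrow> bool" where
  "star_graph W E \<longleftrightarrow> (\<exists>c\<in>W. \<forall>x y. E x y \<longleftrightarrow> x \<in> W \<and> y \<in> W \<and> x \<noteq> y \<and> (x = c \<or> y = c))"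

text \<open>A connected graph that is not complete has an induced path \<open>u w v\<close>. The
  cuts \<open>{u, w}\<close> and \<open>{v, w}\<close> show that \<open>w\<close> is the only
  neighbour of \<open>u\<close> and of \<open>v\<close>, and the cut \<open>{w, y}\<close> then
  excludes any edge \<open>y z\<close> avoiding \<open>w\<close>.\<close>

lemma all_cuts_rank_one_star_or_complete:
  assumes g: "graph W E" and con: "no_empty_cut W E"
    and all: "\<And>A. A \<subseteq> W \<Longrightarrow> A \<noteq> {} \<Longrightarrow> A \<noteq> W \<Longrightarrow> rank_one_cut W E A"
  shows "star_graph W E \<or> complete_graph W E"
proof (cases "complete_graph W E")
  case False
  have sym: "E x y \<longleftrightarrow> E y x" for x y by (rule graphD(5)[OF g])
  have irr: "\<not> E x x" for x by (rule graphD(4)[OF g])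
  have EW: "x \<in> W \<and> y \<in> W" if "E x y" for x y using graphD(2,3)[OF g that] by blast
  have rect: "E a b" if "A \<subseteq> W" "a \<in> A" "a' \<in> A" "b \<notin> A" "b' \<notin> A" "E a b'" "E a' b" for A a a' b b'
  proof -
    have "b \<in> W" "b' \<in> W" using EW that(6,7) by blast+
    then have A: "A \<noteq> {}" "A \<noteq> W" using that by auto
    from all[OF that(1) this] show ?thesis
      unfolding rank_one_cut_iff[OF that(1) A g] using that \<open>b \<in> W\<close> \<open>b' \<in> W\<close> by blast
  qed
  obtain u v0 where u: "u \<in> W" "v0 \<in> W" "u \<noteq> v0" "\<not> E u v0" using False unfolding complete_graph_def by blast
  \<comment> \<open>An edge \<open>w v\<close> leaving the closed neighbourhood of \<open>u\<close>
    completes the induced path \<open>u w v\<close>.\<close>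
  let ?A = "{x \<in> W. x = u \<or> E u x}"
  have ne: "?A \<subseteq> W" "?A \<noteq> {}" "?A \<noteq> W" using u by auto
  obtain w v where "w \<in> ?A" "v \<in> W" "v \<notin> ?A" "E w v" by (rule no_empty_cutE[OF con ne])
  then have w: "E u w" "E w v" "\<not> E u v" "u \<noteq> v" by auto
  have uvw: "u \<noteq> w" "v \<noteq> w" "w \<in> W" "v \<in> W" using w irr EW by blast+
  have sw: "E w u" "E v w" "\<not> E v u" using w sym by blast+
  have nu: "z = w" if "E u z" for z
  proof (rule ccontr)
    assume "z \<noteq> w"
    then have "E u v" using rect[of "{u, w}" u w v z] that w uvw u(1) irr[of u] by auto
    then show False using w by blast
  qed
  have nv: "z = w" if "E v z" for z
  proof (rule ccontr)
    assume "z \<noteq> w"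
    then have "E v u" using rect[of "{v, w}" v w u z] that sw w uvw irr[of v] by auto
    then show False using sw by blast
  qed
  have center: "y = w \<or> z = w" if yz: "E y z" for y z
  proof (rule ccontr)
    assume n: "\<not> (y = w \<or> z = w)"
    have "y \<noteq> u" "z \<noteq> u" "y \<noteq> z" using n nu yz sym irr by blast+
    then have "E y u" using rect[of "{w, y}" y w u z] yz n sw uvw EW[OF yz] by auto
    then show False using nu[of y] sym n by blast
  qed
  have "E y w" if y: "y \<in> W" "y \<noteq> w" for y
  proof -
    have ne: "{y} \<subseteq> W" "{y} \<noteq> {}" "{y} \<noteq> W" using y uvw by auto
    obtain y' z where "y' \<in> {y}" "z \<in> W" "z \<notin> {y}" "E y' z" by (rule no_empty_cutE[OF con ne])
    then show ?thesis using center[of y z] y by auto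
  qed
  then have "E x y \<longleftrightarrow> x \<in> W \<and> y \<in> W \<and> x \<noteq> y \<and> (x = w \<or> y = w)" for x y
    using center[of x y] EW[of x y] irr[of x] sym[of x y] uvw by blast
  then show ?thesis using uvw unfolding star_graph_def by blast
qed simp

text \<open>Domination makes every vertex behave like one of \<open>a\<close>, \<open>b\<close> or
  like one of \<open>c\<close>, \<open>d\<close>; the two classes form a split whose frontiers are
  the neighbours of \<open>c\<close> in \<open>L\<close> and those of \<open>b\<close> outside. The
  choice is asymmetric: a vertex that sees exactly \<open>b\<close> and \<open>c\<close> goes with
  \<open>c\<close>, \<open>d\<close>. Any deviation from the frontier rule produces another P4 that
  is not dominated.\<close>

lemma P4_rank_one_cut:
  assumes g: "graph W E" and dom: "P4_dominated W E" and p: "induced_P4 E a b c d"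
  shows "\<exists>A. rank_one_cut W E A \<and> card A \<ge> 2 \<and> card (W - A) \<ge> 2"
proof -
  have sym: "E x y \<Longrightarrow> E y x" for x y using graphD(5)[OF g] by blast
  have irr: "\<not> E x x" for x by (rule graphD(4)[OF g])
  have fin: "finite W" by (rule graphD(1)[OF g])
  have EW: "x \<in> W \<and> y \<in> W" if "E x y" for x y using graphD(2,3)[OF g that] by blast
  note dom' = P4_dominatedD[OF dom g]
  have e: "E a b" "E b c" "E c d" "\<not> E a c" "\<not> E b d" "\<not> E a d" using p unfolding induced_P4_def by auto
  have e': "E b a" "E c b" "E d c" "\<not> E c a" "\<not> E d b" "\<not> E d a" using e sym by blast+
  have W: "a \<in> W" "b \<in> W" "c \<in> W" "d \<in> W" using EW e by blast+
  \<comment> \<open>the twins of \<open>a\<close> and of \<open>b\<close> relative to the P4\<close>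
  define L where "L = {x \<in> W. \<not> E x d \<and> (E x a \<or> \<not> E x c)}"
  have abL: "a \<in> L" "b \<in> L" "c \<notin> L" "d \<notin> L" using e e' W irr unfolding L_def by auto
  have "E y z \<longleftrightarrow> E y c \<and> E z b" if y: "y \<in> L" and z: "z \<in> W - L" for y z
  proof -
    have yW: "y \<in> W" "z \<in> W" using y z unfolding L_def by auto
    have yd: "\<not> E y d" "\<not> E d y" using y sym unfolding L_def by auto
    have ty: "E y b \<or> E y c" using dom'(2)[OF p yW(1)] .
    have tz: "E z b \<or> E z c" "\<not> (E z a \<and> E z d)" using dom'[OF p yW(2)] by blast+
    show ?thesis
    proof (cases "E y c")
      case False
      then have yb: "E y b" "E b y" using ty sym by blast+
      have yc: "\<not> E y c" "\<not> E c y" using False sym by blast+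
      have "\<not> E y z"
      proof
        assume yz: "E y z"
        then have zy: "E z y" using sym by blast
        show False
        proof (cases "E z d")
          case True
          have "induced_P4 E y b c d" using yb e yc yd unfolding induced_P4_def by blast
          then show False using dom'(1)[of y b c d z] True zy yW by blast
        next
          case zd: False
          then have za: "\<not> E z a" "\<not> E a z" and zc: "E z c" "E c z" using z sym unfolding L_def by blast+
          show False
          proof (cases "E z b")
            case True
            have "induced_P4 E y z c d" using yz zc e zd yc yd unfolding induced_P4_def by blast
            then show False using dom'(2)[of y z c d a] za(2) e(4) W by blast
          next
            case zb: False
            then have bz: "\<not> E b z" using sym by blast
            show False
            proof (cases "E y a")
              case True
              have "induced_P4 E a b c z" using e zc bz za unfolding induced_P4_def by blast
              then show False using dom'(1)[of a b c z y] True yz yW by blast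
            next
              case ya: False
              then have "\<not> E a y" using sym by blast
              then have "induced_P4 E a b y z" using e yb yz bz za unfolding induced_P4_def by blast
              then show False using dom'(2)[of a b y z d] e'(5) yd W by blast
            qed
          qed
        qed
      qed
      then show ?thesis using False by blast
    next
      case True
      then have ya: "E y a" "E a y" and yc: "E c y" using y sym unfolding L_def by auto
      show ?thesis
      proof (cases "E z b")
        case zb: False
        then have zc: "E z c" "E c z" and bz: "\<not> E b z" using tz sym by blast+
        have "\<not> E y z"
        proof
          assume yz: "E y z"
          show False
          proof (cases "E z a")
            case True
            then have "E z d" using z zc yW unfolding L_def by blast
            then show False using tz True by blast
          next
            case False
            then have "\<not> E a z" using sym by blast
            then have "induced_P4 E a b c z" using e zc bz unfolding induced_P4_def by blast
            then show False using dom'(1)[of a b c z y] ya yz yW by blast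
          qed
        qed
        then show ?thesis using zb by blast
      next
        case zb: True
        then have bz: "E b z" using sym by blast
        have "E y z"
        proof (rule ccontr)
          assume yz: "\<not> E y z"
          then have zy: "\<not> E z y" using sym by blast
          have za: "\<not> E z a" "\<not> E a z"
          proof -
            show "\<not> E z a" using z tz(2) yW unfolding L_def by blast
            then show "\<not> E a z" using sym by blast
          qed
          have zc: "E z c" "E c z"
          proof -
            show "E z c"
            proof (cases "E z d")
              case True
              have "induced_P4 E a y c d" using ya \<open>E y c\<close> e yd unfolding induced_P4_def by blast
              then show ?thesis using dom'(2)[of a y c d z] zy yW by blast
            next
              case False
              then show ?thesis using z za yW unfolding L_def by blast
            qed
            then show "E c z" using sym by blast
          qed
          have "induced_P4 E a y c z" using ya \<open>E y c\<close> zc e yz za unfolding induced_P4_def by blast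
          then show False using dom'(1)[of a y c z b] e' bz W by blast
        qed
        then show ?thesis using zb True by blast
      qed
    qed
  qed
  then have f: "E y z \<longleftrightarrow> (if y \<in> L then E y c else E y b) \<and> (if z \<in> L then E z c else E z b)"
    if "y \<in> L" "z \<in> W - L" for y z using that by simp
  have LW: "L \<subseteq> W" unfolding L_def by auto
  have "rank_one_cut W E L"
    unfolding rank_one_cut_def
  proof (intro conjI)
    show "\<exists>f. \<forall>y\<in>L. \<forall>z\<in>W - L. E y z \<longleftrightarrow> f y \<and> f z"
      by (rule exI[of _ "\<lambda>v. if v \<in> L then E v c else E v b"]) (intro ballI f)
  qed (use LW abL W in auto)
  moreover have "card L \<ge> 2"
    using card_mono[of L "{a, b}"] finite_subset[OF LW fin] abL e irr by (cases "a = b") auto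
  moreover have "card (W - L) \<ge> 2"
    using card_mono[of "W - L" "{c, d}"] fin abL W e irr by (cases "c = d") auto
  ultimately show ?thesis by blast
qed

section \<open>P4-free graphs and the existence of splits\<close>

definition P4_free_on :: "'a set \<Rightarrow> ('a \<Rightarrow> 'a \<Rightarrow> bool) \<Rightarrow> bool" where
  "P4_free_on W F \<longleftrightarrow> (\<forall>a\<in>W. \<forall>b\<in>W. \<forall>c\<in>W. \<forall>d\<in>W. distinct [a, b, c, d] \<longrightarrow> \<not> induced_P4 F a b c d)"

text \<open>
  Stated for a relation \<open>F\<close> because it is applied to the adjacency relation and to its negation.
\<close>
lemma cograph_step:
  assumes fin: "finite W" and sym: "\<And>x y. F x y \<Longrightarrow> F y x" and free: "P4_free_on W F"
    and v: "v \<in> W" and U: "U \<subseteq> W - {v}" "U \<noteq> {}" "U \<noteq> W - {v}" "\<And>x y. x \<in> U \<Longrightarrow> y \<in> W - {v} - U \<Longrightarrow> \<not> F x y"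
  shows "\<exists>U\<subseteq>W. U \<noteq> {} \<and> U \<noteq> W \<and>
    ((\<forall>x\<in>U. \<forall>y\<in>W - U. F x y) \<or> (\<forall>x\<in>U. \<forall>y\<in>W - U. \<not> F x y))"
proof (cases "\<forall>y\<in>W - {v}. F v y")
  case True
  then have "\<forall>x\<in>{v}. \<forall>y\<in>W - {v}. F x y" by blast
  moreover have "{v} \<noteq> W" using U by auto
  ultimately show ?thesis using v by blast
next
  case False
  then obtain y where y: "y \<in> W" "y \<noteq> v" "\<not> F v y" by blast
  \<comment> \<open>No edge within \<open>W - {v}\<close> leaves such a set. A smallest one plays
    the role of the component of the non-neighbour \<open>y\<close> of \<open>v\<close>.\<close>
  define sep where "sep K \<longleftrightarrow> K \<subseteq> W - {v} \<and> K \<noteq> W - {v} \<and> y \<in> K \<and> (\<forall>a\<in>K. \<forall>b\<in>W - {v} - K. \<not> F a b)" for K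
  have "\<exists>K. sep K"
  proof (cases "y \<in> U")
    case True
    then have "sep U" using U unfolding sep_def by blast
    then show ?thesis ..
  next
    case False
    have "W - {v} - (W - {v} - U) = U" using U(1) by blast
    moreover have "\<not> F a b" if "a \<in> W - {v} - U" "b \<in> U" for a b using U(4)[OF that(2,1)] sym[of a b] by blast
    ultimately have "sep (W - {v} - U)" using U(1,2) False y unfolding sep_def by blast
    then show ?thesis ..
  qed
  then obtain K where K: "sep K" and min: "\<And>K'. sep K' \<Longrightarrow> card K \<le> card K'"
    using ex_has_least_nat[of sep _ card] by blast
  have KW: "K \<subseteq> W - {v}" "K \<noteq> W - {v}" "y \<in> K" and anti: "\<And>a b. a \<in> K \<Longrightarrow> b \<in> W - {v} - K \<Longrightarrow> \<not> F a b"
    using K unfolding sep_def by blast+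
  have finK: "finite K" using KW fin finite_subset by blast
  show ?thesis
  proof (cases "\<forall>k\<in>K. \<not> F v k")
    case True
    then have "\<forall>x\<in>K. \<forall>z\<in>W - K. \<not> F x z" using anti sym by blast
    moreover have "K \<subseteq> W" "K \<noteq> {}" "K \<noteq> W" using KW v by auto
    ultimately show ?thesis by blast
  next
    case False
    then obtain y1 where y1: "y1 \<in> K" "F v y1" by blast
    show ?thesis
    proof (cases "\<forall>z\<in>W - {v} - K. \<not> F v z")
      case True
      let ?U = "W - {v} - K"
      have "\<forall>x\<in>?U. \<forall>z\<in>W - ?U. \<not> F x z" using anti sym True by blast
      moreover have "?U \<subseteq> W" "?U \<noteq> {}" "?U \<noteq> W" using KW v by auto
      ultimately show ?thesis by blast
    next
      case False
      then obtain z where z: "z \<in> W" "z \<noteq> v" "z \<notin> K" "F v z" by blast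
      \<comment> \<open>The non-neighbours of \<open>v\<close> in \<open>K\<close> still contain
        \<open>y\<close>, so by minimality an edge leaves them. It ends at a neighbour
        \<open>w\<close> of \<open>v\<close> in \<open>K\<close>, which makes \<open>z v w k\<close>
        a P4.\<close>
      let ?K = "{k \<in> K. \<not> F v k}"
      have "?K \<subset> K" using y1 by blast
      then have "card ?K < card K" by (rule psubset_card_mono[OF finK])
      then have "\<not> sep ?K" using min[of ?K] by linarith
      moreover have "?K \<subseteq> W - {v}" "?K \<noteq> W - {v}" "y \<in> ?K" using KW y z by auto
      ultimately obtain k w where k: "k \<in> ?K" "w \<in> W - {v} - ?K" "F k w" unfolding sep_def by blast
      then have w: "w \<in> K" "F v w" using anti[of k w] by blast+
      have Fw: "F z v" "F w k" using sym z(4) k(3) by blast+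
      have n: "\<not> F z w" "\<not> F v k" "\<not> F z k" using anti[of w z] anti[of k z] sym w k z by blast+
      have "induced_P4 F z v w k" using Fw w n unfolding induced_P4_def by blast
      moreover have "distinct [z, v, w, k]" using z w k n KW by auto
      moreover have "z \<in> W" "v \<in> W" "w \<in> W" "k \<in> W" using z v k w KW by auto
      ultimately show ?thesis using free unfolding P4_free_on_def by blast
    qed
  qed
qed

lemma P4_free_on_compl:
  assumes "P4_free_on W F" "\<And>x y. F x y \<Longrightarrow> F y x" shows "P4_free_on W (\<lambda>x y. \<not> F x y)"
  unfolding P4_free_on_def
proof (intro ballI impI notI)
  fix a b c d assume W: "a \<in> W" "b \<in> W" "c \<in> W" "d \<in> W" and d: "distinct [a, b, c, d]"
    and p: "induced_P4 (\<lambda>x y. \<not> F x y) a b c d"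
  have "induced_P4 F b d a c" using p assms(2) unfolding induced_P4_def by blast
  moreover have "distinct [b, d, a, c]" using d by auto
  ultimately show False using assms(1) W unfolding P4_free_on_def by blast
qed

text \<open>Seinsche's theorem: a P4-free graph or its complement is disconnected. The induction
  deletes a vertex; if it is the complement of the rest that falls apart, the step is applied to the
  negated relation.\<close>

lemma cograph_decomposition:
  assumes "finite W" "card W \<ge> 2" "\<And>x y. F x y \<Longrightarrow> F y x" "P4_free_on W F"
  shows "\<exists>U\<subseteq>W. U \<noteq> {} \<and> U \<noteq> W \<and>
    ((\<forall>x\<in>U. \<forall>y\<in>W - U. F x y) \<or> (\<forall>x\<in>U. \<forall>y\<in>W - U. \<not> F x y))"
  using assms
proof (induction "card W" arbitrary: W)
  case (Suc n)
  obtain v where v: "v \<in> W" using Suc.prems(2) by fastforce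
  show ?case
  proof (cases "card W = 2")
    case True
    then obtain x y where W: "W = {x, y}" "x \<noteq> y" by (auto simp: card_2_iff)
    then have "{x} \<subseteq> W" "{x} \<noteq> W" "W - {x} = {y}" by auto
    then show ?thesis by (intro exI[of _ "{x}"]) simp
  next
    case False
    let ?W = "W - {v}"
    have "n = card ?W" "card ?W \<ge> 2" "finite ?W" using Suc.hyps(2) Suc.prems(1,2) v False by auto
    moreover have free: "P4_free_on ?W F" using Suc.prems(4) unfolding P4_free_on_def by blast
    ultimately obtain U where U: "U \<subseteq> ?W" "U \<noteq> {}" "U \<noteq> ?W"
      and alt: "(\<forall>x\<in>U. \<forall>y\<in>?W - U. F x y) \<or> (\<forall>x\<in>U. \<forall>y\<in>?W - U. \<not> F x y)"
      using Suc.hyps(1)[of ?W] Suc.prems(3) by blast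
    from alt show ?thesis
    proof
      assume "\<forall>x\<in>U. \<forall>y\<in>?W - U. \<not> F x y"
      then show ?thesis by (intro cograph_step[OF Suc.prems(1,3,4) v U]) auto
    next
      assume "\<forall>x\<in>U. \<forall>y\<in>?W - U. F x y"
      then have "\<exists>U\<subseteq>W. U \<noteq> {} \<and> U \<noteq> W \<and>
          ((\<forall>x\<in>U. \<forall>y\<in>W - U. \<not> F x y) \<or> (\<forall>x\<in>U. \<forall>y\<in>W - U. \<not> \<not> F x y))"
        by (intro cograph_step[OF Suc.prems(1) _ P4_free_on_compl[OF Suc.prems(4,3)] v U])
          (erule contrapos_nn, rule Suc.prems(3), simp_all)
      then show ?thesis by blast
    qed
  qed
qed simp

text \<open>Here \<open>A\<close> is a module. Modules supply the cuts of P4-free graphs; singletons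
  are the trivial instance.\<close>

lemma homogeneous_rank_one_cut:
  assumes "A \<subseteq> W" "A \<noteq> {}" "A \<noteq> W" "\<And>b. b \<in> W - A \<Longrightarrow> (\<forall>a\<in>A. E a b) \<or> (\<forall>a\<in>A. \<not> E a b)"
  shows "rank_one_cut W E A"
  unfolding rank_one_cut_def
proof (intro conjI)
  show "\<exists>f. \<forall>a\<in>A. \<forall>b\<in>W - A. E a b \<longleftrightarrow> f a \<and> f b"
    by (rule exI[of _ "\<lambda>v. v \<in> A \<or> (\<forall>a\<in>A. E a v)"]) (use assms(2,4) in blast)
qed (use assms in auto)

text \<open>In a connected P4-free graph the Seinsche decomposition is a join. If one side is a
  single vertex \<open>v\<close>, then \<open>v\<close> sees all others, so a module of
  \<open>W - {v}\<close> is one of \<open>W\<close>; decomposing \<open>W - {v}\<close>, which has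
  three or more vertices, yields a module with at least two.\<close>

lemma P4_dominated_has_rank_one_cut:
  assumes g: "graph W E" and con: "no_empty_cut W E" and dom: "P4_dominated W E" and c4: "card W \<ge> 4"
  shows "\<exists>A. rank_one_cut W E A \<and> card A \<ge> 2 \<and> card (W - A) \<ge> 2"
proof (cases "\<exists>a b c d. induced_P4 E a b c d")
  case True
  then show ?thesis using P4_rank_one_cut[OF g dom] by blast
next
  case False
  have sym: "E x y \<Longrightarrow> E y x" for x y using graphD(5)[OF g] by blast
  have fin: "finite W" by (rule graphD(1)[OF g])
  have free: "P4_free_on X E" for X using False unfolding P4_free_on_def by blast
  obtain U where U: "U \<subseteq> W" "U \<noteq> {}" "U \<noteq> W"
    and alt: "(\<forall>x\<in>U. \<forall>y\<in>W - U. E x y) \<or> (\<forall>x\<in>U. \<forall>y\<in>W - U. \<not> E x y)"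
    using cograph_decomposition[OF fin _ sym free] c4 by auto
  have "\<exists>x\<in>U. \<exists>y\<in>W - U. E x y" using con U unfolding no_empty_cut_def by blast
  then have join: "\<And>x y. x \<in> U \<Longrightarrow> y \<in> W - U \<Longrightarrow> E x y" using alt by blast
  have finU: "finite U" "finite (W - U)" using fin U finite_subset by blast+
  have card: "card U + card (W - U) = card W" using U(1) fin finU(1) by (simp add: card_Diff_subset card_mono)
  show ?thesis
  proof (cases "card U \<ge> 2 \<and> card (W - U) \<ge> 2")
    case True
    have "rank_one_cut W E U" by (rule homogeneous_rank_one_cut[OF U]) (use join in blast)
    then show ?thesis using True by blast
  next
    case False
    have "card U \<noteq> 0" "card (W - U) \<noteq> 0" using U finU by auto
    then have "card U = 1 \<or> card (W - U) = 1" using False by linarith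
    then obtain v where v: "U = {v} \<or> W - U = {v}" by (meson card_1_singletonE)
    have vW: "v \<in> W" using v U by blast
    have vj: "E x v" if "x \<in> W - {v}" for x
      using v
    proof
      assume "U = {v}" then show ?thesis using join[of v x] that sym by blast
    next
      assume a: "W - U = {v}"
      then have "x \<in> U" "v \<in> W - U" using that by auto
      then show ?thesis using join[of x v] by blast
    qed
    let ?W = "W - {v}"
    have c3: "card ?W \<ge> 3" using c4 vW fin by simp
    obtain X where X: "X \<subseteq> ?W" "X \<noteq> {}" "X \<noteq> ?W"
      and alt: "(\<forall>x\<in>X. \<forall>y\<in>?W - X. E x y) \<or> (\<forall>x\<in>X. \<forall>y\<in>?W - X. \<not> E x y)"
      using cograph_decomposition[OF _ _ sym free, of ?W] c3 fin by auto
    have main: "?thesis" if Y: "Y \<subseteq> ?W" "card Y \<ge> 2" "Y \<noteq> ?W"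
      and h: "\<And>b. b \<in> ?W - Y \<Longrightarrow> (\<forall>a\<in>Y. E a b) \<or> (\<forall>a\<in>Y. \<not> E a b)" for Y
    proof -
      have YW: "Y \<subseteq> W" "Y \<noteq> {}" "Y \<noteq> W" using Y vW by auto
      have "(\<forall>a\<in>Y. E a b) \<or> (\<forall>a\<in>Y. \<not> E a b)" if "b \<in> W - Y" for b
        using that h[of b] vj Y(1) by (cases "b = v") auto
      then have "rank_one_cut W E Y" by (rule homogeneous_rank_one_cut[OF YW])
      moreover obtain z where "z \<in> ?W" "z \<notin> Y" using Y by blast
      then have "{v, z} \<subseteq> W - Y" "v \<noteq> z" using vW Y by auto
      then have "card (W - Y) \<ge> 2" using card_mono[of "W - Y" "{v, z}"] fin by simp
      ultimately show ?thesis using Y by blast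
    qed
    have finX: "finite X" using X fin finite_subset by blast
    have cX: "card X + card (?W - X) = card ?W" using X fin finX by (simp add: card_Diff_subset card_mono)
    then have "card X \<ge> 2 \<or> card (?W - X) \<ge> 2" using c3 by linarith
    then show ?thesis
    proof
      assume "card X \<ge> 2"
      then show ?thesis by (rule main[OF X(1) _ X(3)]) (use alt in blast)
    next
      assume a: "card (?W - X) \<ge> 2"
      have "?W - X \<noteq> ?W" using X by blast
      moreover have "?W - (?W - X) = X" using X by blast
      ultimately show ?thesis using main[of "?W - X"] a alt sym by (metis Diff_subset)
    qed
  qed
qed

text \<open>If every split is crossed, the crossing closure turns all proper subsets into cuts of
  rank one, and the graph is a star or complete. Three vertices are treated apart because they admit
  no split to start from.\<close>

lemma P4_dominated_strong_cut:
  assumes g: "graph W E" and con: "no_empty_cut W E" and dom: "P4_dominated W E" and c3: "card W \<ge> 3"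
    and no: "\<not> star_graph W E" "\<not> complete_graph W E"
  shows "\<exists>A. rank_one_cut W E A \<and> card A \<ge> 2 \<and> card (W - A) \<ge> 2 \<and>
    (\<forall>Z. rank_one_cut W E Z \<longrightarrow> \<not> crosses W A Z)"
proof (rule ccontr)
  assume neg: "\<not> ?thesis"
  have fin: "finite W" by (rule graphD(1)[OF g])
  have "rank_one_cut W E A" if A: "A \<subseteq> W" "A \<noteq> {}" "A \<noteq> W" for A
  proof (cases "card W = 3")
    case True
    have finA: "finite A" "finite (W - A)" using A fin finite_subset by blast+
    have "card A + card (W - A) = 3" using card_Diff_subset[OF finA(1) A(1)] card_mono[OF fin A(1)] True by linarith
    moreover have "card A \<noteq> 0" "card (W - A) \<noteq> 0" using A finA by auto
    ultimately have "card A = 1 \<or> card (W - A) = 1" by linarith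
    then show ?thesis
    proof
      assume "card A = 1"
      then obtain v where "A = {v}" by (rule card_1_singletonE)
      then show ?thesis using homogeneous_rank_one_cut[OF A] by blast
    next
      assume "card (W - A) = 1"
      then obtain v where v: "W - A = {v}" by (rule card_1_singletonE)
      have "rank_one_cut W E (W - A)"
        by (rule homogeneous_rank_one_cut) (use v A in auto)
      then have "rank_one_cut W E (W - (W - A))" by (rule rank_one_cut_compl[OF g])
      then show ?thesis using A by (simp add: double_diff)
    qed
  next
    case False
    then have "card W \<ge> 4" using c3 by linarith
    then obtain A0 where A0: "rank_one_cut W E A0" "card A0 \<ge> 2" "card (W - A0) \<ge> 2"
      using P4_dominated_has_rank_one_cut[OF g con dom] by blast
    show ?thesis
    proof (rule crossing_family_all[where G="rank_one_cut W E", OF fin _ rank_one_cut_compl[OF g]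
          rank_one_cut_inter[OF g con] rank_one_cut_symdiff[OF g con] A0 _ A])
      show "\<And>A. rank_one_cut W E A \<Longrightarrow> A \<subseteq> W \<and> A \<noteq> {} \<and> A \<noteq> W" unfolding rank_one_cut_def by blast
      show "\<And>A. rank_one_cut W E A \<Longrightarrow> 2 \<le> card A \<Longrightarrow> 2 \<le> card (W - A) \<Longrightarrow>
          \<exists>Z. rank_one_cut W E Z \<and> crosses W A Z" using neg by blast
    qed
  qed
  then show False using all_cuts_rank_one_star_or_complete[OF g con] no by blast
qed

section \<open>Trees\<close>

text \<open>When the next node already occurs on the path, the path is cut back to that
  occurrence.\<close>

lemma rtranclp_distinct_path:
  assumes "R\<^sup>*\<^sup>* x y"
  shows "\<exists>p. p \<noteq> [] \<and> hd p = x \<and> last p = y \<and> distinct p \<and> (\<forall>i. Suc i < length p \<longrightarrow> R (p ! i) (p ! Suc i))"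
  using assms
proof (induction rule: rtranclp_induct)
  case base
  show ?case by (rule exI[of _ "[x]"]) auto
next
  case (step y z)
  then obtain p where p: "p \<noteq> []" "hd p = x" "last p = y" "distinct p"
    "\<And>i. Suc i < length p \<Longrightarrow> R (p ! i) (p ! Suc i)" by blast
  show ?case
  proof (cases "z \<in> set p")
    case True
    then obtain j where j: "j < length p" "p ! j = z" by (meson in_set_conv_nth)
    let ?q = "take (Suc j) p"
    have "last ?q = z" using j by (simp add: take_Suc_conv_app_nth)
    then show ?thesis using p j by (intro exI[of _ ?q]) (auto simp: hd_take)
  next
    case False
    have "R ((p @ [z]) ! i) ((p @ [z]) ! Suc i)" if "Suc i < length (p @ [z])" for i
    proof (cases "Suc i < length p")
      case True
      then show ?thesis using p(5) by (simp add: nth_append)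
    next
      case False
      then have "i = length p - 1" "Suc i = length p" using that by auto
      then show ?thesis using p(1,3) step(2) by (simp add: nth_append last_conv_nth)
    qed
    then show ?thesis using p False by (intro exI[of _ "p @ [z]"]) auto
  qed
qed

lemma rtranclp_leaves_set:
  assumes "R\<^sup>*\<^sup>* x y" "x \<in> U" "y \<notin> U"
  shows "\<exists>u w. R u w \<and> u \<in> U \<and> w \<notin> U"
  using assms by (induction rule: rtranclp_induct) auto

locale tree =
  fixes N :: "'n set" and ET :: "'n set set"
  assumes tree: "is_tree N ET"
begin

text \<open>The same closure as in \<open>side\<close>, so that \<open>side\<close> unfolds to
  it.\<close>

definition reach :: "'n set \<Rightarrow> 'n \<Rightarrow> 'n \<Rightarrow> bool" where
  "reach e = (tadj (ET - {e}))\<^sup>*\<^sup>*"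

text \<open>
  The edge at \<open>t\<close> on the path from \<open>t\<close> to \<open>x\<close>; unspecified for \<open>t = x\<close>.
\<close>
definition dir :: "'n \<Rightarrow> 'n \<Rightarrow> 'n set" where
  "dir t x = (THE f. f \<in> incident ET t \<and> \<not> reach f t x)"

lemma finite_nodes: "finite N"
  and edge_ends: "e \<in> ET \<Longrightarrow> \<exists>x y. x \<in> N \<and> y \<in> N \<and> x \<noteq> y \<and> e = {x, y}"
  and nodes_connected: "x \<in> N \<Longrightarrow> y \<in> N \<Longrightarrow> (tadj ET)\<^sup>*\<^sup>* x y"
  and no_cycle: "length c \<ge> 3 \<Longrightarrow> distinct c \<Longrightarrow> (\<And>i. Suc i < length c \<Longrightarrow> {c ! i, c ! Suc i} \<in> ET)
      \<Longrightarrow> {last c, hd c} \<notin> ET"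
proof -
  show "finite N" using tree unfolding is_tree_def by (elim conjE)
  show "e \<in> ET \<Longrightarrow> \<exists>x y. x \<in> N \<and> y \<in> N \<and> x \<noteq> y \<and> e = {x, y}"
    using tree unfolding is_tree_def by (elim conjE) (rule bspec)
  show "x \<in> N \<Longrightarrow> y \<in> N \<Longrightarrow> (tadj ET)\<^sup>*\<^sup>* x y" using tree unfolding is_tree_def by (elim conjE) simp
  show "length c \<ge> 3 \<Longrightarrow> distinct c \<Longrightarrow> (\<And>i. Suc i < length c \<Longrightarrow> {c ! i, c ! Suc i} \<in> ET)
      \<Longrightarrow> {last c, hd c} \<notin> ET" using tree unfolding is_tree_def by (elim conjE) blast
qed

lemma edge_nodes: "{x, y} \<in> ET \<Longrightarrow> x \<in> N \<and> y \<in> N \<and> x \<noteq> y"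
  using edge_ends[of "{x, y}"] by (auto simp: doubleton_eq_iff)

lemma finite_edges: "finite ET"
proof (rule finite_subset)
  show "ET \<subseteq> Pow N" using edge_ends by blast
qed (simp add: finite_nodes)

lemma finite_incident: "finite (incident ET t)"
  using finite_edges unfolding incident_def by simp

lemma incident_ends:
  assumes "f \<in> incident ET t" obtains r where "f = {t, r}" "r \<noteq> t" "r \<in> N" "t \<in> N" "{t, r} \<in> ET" "f \<in> incident ET r"
proof -
  obtain x y where "x \<in> N" "y \<in> N" "x \<noteq> y" "f = {x, y}" "f \<in> ET" "t \<in> f"
    using assms edge_ends unfolding incident_def by blast
  then show thesis using that[of y] that[of x] unfolding incident_def by (auto simp: insert_commute)
qed

lemma incident_iff: "{t, r} \<in> incident ET t \<longleftrightarrow> {t, r} \<in> ET" "{t, r} \<in> incident ET r \<longleftrightarrow> {t, r} \<in> ET"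
  unfolding incident_def by auto

lemma reach_refl [simp]: "reach e x x"
  unfolding reach_def by simp

lemma reach_sym: "reach e x y \<Longrightarrow> reach e y x"
proof -
  have "symp (tadj (ET - {e}))" by (auto simp: symp_def tadj_def insert_commute)
  then show "reach e x y \<Longrightarrow> reach e y x"
    unfolding reach_def using symp_rtranclp by (metis sympD)
qed

lemma reach_trans: "reach e x y \<Longrightarrow> reach e y z \<Longrightarrow> reach e x z"
  unfolding reach_def by simp

lemma reach_edge: "{x, y} \<in> ET \<Longrightarrow> {x, y} \<noteq> e \<Longrightarrow> reach e x y"
  unfolding reach_def by (rule r_into_rtranclp) (use edge_nodes in \<open>auto simp: tadj_def\<close>)

text \<open>A simple path avoiding the edge would be closed by it to a cycle. Lengths 1 and 2 are
  excluded because \<open>x \<noteq> y\<close> and because the edge itself is removed.\<close>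

lemma bridge: assumes "{x, y} \<in> ET" shows "\<not> reach {x, y} x y"
proof
  assume "reach {x, y} x y"
  then obtain p where p: "p \<noteq> []" "hd p = x" "last p = y" "distinct p"
    "\<And>i. Suc i < length p \<Longrightarrow> tadj (ET - {{x, y}}) (p ! i) (p ! Suc i)"
    using rtranclp_distinct_path unfolding reach_def by metis
  have xy: "x \<noteq> y" using assms edge_nodes by blast
  have "length p \<noteq> 1" using p(2,3) xy by (cases p) auto
  moreover have "length p \<noteq> 2"
  proof
    assume l: "length p = 2"
    then have "p ! 0 = x" "p ! 1 = y" using p(1,2,3) by (auto simp: hd_conv_nth last_conv_nth)
    then show False using p(5)[of 0] l by (simp add: tadj_def)
  qed
  ultimately have "length p \<ge> 3" using p(1) by (cases p; cases "tl p"; cases "tl (tl p)") auto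
  then have "{last p, hd p} \<notin> ET" using no_cycle p(4,5) unfolding tadj_def by blast
  then show False using assms p by (simp add: insert_commute)
qed

lemma reach_either:
  assumes "{x, y} \<in> ET" "z \<in> N" shows "reach {x, y} x z \<or> reach {x, y} y z"
proof -
  have "(tadj ET)\<^sup>*\<^sup>* x z" using nodes_connected edge_nodes[OF assms(1)] assms(2) by simp
  then show ?thesis
  proof (induction rule: rtranclp_induct)
    case (step u w)
    show ?case
    proof (cases "{u, w} = {x, y}")
      case True
      then have "w = x \<or> w = y" by (auto simp: doubleton_eq_iff)
      then show ?thesis by auto
    next
      case False
      then have "reach {x, y} u w" using step(2) reach_edge[of u w "{x, y}"] by (simp add: tadj_def)
      then show ?thesis
        using step.IH reach_trans[of "{x, y}" x u w] reach_trans[of "{x, y}" y u w] by blast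
    qed
  qed simp
qed

lemma reach_cong: "reach e x y \<Longrightarrow> reach e x z \<longleftrightarrow> reach e y z"
  using reach_sym[of e x y] reach_trans[of e x y z] reach_trans[of e y x z] by blast

lemma reach_commute: "reach e x y \<longleftrightarrow> reach e y x"
  using reach_sym[of e x y] reach_sym[of e y x] by blast

lemma tpath_exists: assumes "x \<in> N" "y \<in> N" shows "\<exists>p. tpath ET x y p"
  using rtranclp_distinct_path[OF nodes_connected[OF assms]] unfolding tpath_def tadj_def by blast

lemma tpath_take: "tpath ET x y p \<Longrightarrow> i < length p \<Longrightarrow> tpath ET x (p ! i) (take (Suc i) p)"
  unfolding tpath_def by (auto simp: last_conv_nth)

lemma tpath_drop: "tpath ET x y p \<Longrightarrow> i < length p \<Longrightarrow> tpath ET (p ! i) y (drop i p)"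
  unfolding tpath_def by (auto simp: hd_drop_conv_nth)

lemma tpath_reach:
  assumes "tpath ET x y p" "\<not> edge_on_path e p" shows "reach e x y"
proof -
  have "i < length p \<Longrightarrow> reach e x (p ! i)" for i
  proof (induction i)
    case 0
    then show ?case using assms unfolding tpath_def by (auto simp flip: hd_conv_nth)
  next
    case (Suc i)
    then have e: "{p ! i, p ! Suc i} \<in> ET" "{p ! i, p ! Suc i} \<noteq> e"
      using assms unfolding tpath_def edge_on_path_def by auto
    have "reach e x (p ! i)" using Suc by simp
    then show ?case using reach_edge[OF e] reach_trans by blast
  qed
  from this[of "length p - 1"] show ?thesis
    using assms unfolding tpath_def by (metis diff_less last_conv_nth length_greater_0_conv zero_less_one)
qed

text \<open>A simple path traverses an edge only once, and its pieces before and after lie on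
  different sides of that bridge. This replaces path conditions by \<open>reach\<close>.\<close>

lemma edge_on_path_iff:
  assumes p: "tpath ET x y p" shows "edge_on_path e p \<longleftrightarrow> \<not> reach e x y"
proof
  assume "edge_on_path e p"
  then obtain i where i: "Suc i < length p" "e = {p ! i, p ! Suc i}" unfolding edge_on_path_def by blast
  have d: "distinct p" and ed: "e \<in> ET" using p i unfolding tpath_def by auto
  have index: "j = i" if "Suc j < length p" "e = {p ! j, p ! Suc j}" for j
  proof -
    have "p ! i = p ! j \<and> p ! Suc i = p ! Suc j \<or> p ! i = p ! Suc j \<and> p ! Suc i = p ! j"
      using that(2) i(2) by (simp add: doubleton_eq_iff)
    then have "i = j \<or> i = Suc j \<and> Suc i = j"
      using nth_eq_iff_index_eq[OF d] that(1) i(1) by (meson Suc_lessD)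
    then show ?thesis by linarith
  qed
  have "\<not> edge_on_path e (take (Suc i) p)"
    unfolding edge_on_path_def
  proof
    assume "\<exists>j. Suc j < length (take (Suc i) p) \<and> e = {take (Suc i) p ! j, take (Suc i) p ! Suc j}"
    then obtain j where "Suc j < length p" "j < i" "e = {p ! j, p ! Suc j}" by auto
    then show False using index by blast
  qed
  then have 1: "reach e x (p ! i)" using tpath_reach tpath_take[OF p] i by (meson Suc_lessD)
  have "\<not> edge_on_path e (drop (Suc i) p)"
    unfolding edge_on_path_def
  proof
    assume "\<exists>j. Suc j < length (drop (Suc i) p) \<and> e = {drop (Suc i) p ! j, drop (Suc i) p ! Suc j}"
    then obtain j where "Suc j < length p - Suc i" "e = {p ! (Suc i + j), p ! Suc (Suc i + j)}" by auto
    then show False using index[of "Suc i + j"] by (simp del: not_less) linarith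
  qed
  then have 2: "reach e (p ! Suc i) y" using tpath_reach tpath_drop[OF p] i by blast
  have "\<not> reach e (p ! i) (p ! Suc i)" using bridge ed i by blast
  then show "\<not> reach e x y"
    using reach_cong[OF 1, of y] reach_commute[of e "p ! i" y] reach_cong[OF 2, of "p ! i"] reach_commute[of e y "p ! i"]
      reach_commute[of e "p ! i" "p ! Suc i"] by blast
qed (use tpath_reach[OF p] in blast)

lemma edge_on_all_paths_iff:
  assumes "x \<in> N" "y \<in> N"
  shows "(\<forall>p. tpath ET x y p \<longrightarrow> edge_on_path e p) \<longleftrightarrow> \<not> reach e x y"
  using edge_on_path_iff tpath_exists[OF assms] by blast

text \<open>Of the edges at \<open>t\<close>, a simple path starting in \<open>t\<close> contains
  only its first edge; this one alone separates \<open>t\<close> from \<open>x\<close>.\<close>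

lemma dir_unique:
  assumes "t \<in> N" "x \<in> N" "t \<noteq> x"
  shows "\<exists>!f. f \<in> incident ET t \<and> \<not> reach f t x"
proof -
  obtain p where p: "tpath ET t x p" using tpath_exists assms by blast
  then have hd: "p ! 0 = t" "last p = x" "distinct p" "p \<noteq> []" unfolding tpath_def by (auto simp: hd_conv_nth)
  have l: "Suc 0 < length p" using hd assms(3) by (cases p; cases "tl p") auto
  let ?f = "{p ! 0, p ! Suc 0}"
  have f: "?f \<in> ET" "edge_on_path ?f p" using p l unfolding tpath_def edge_on_path_def by auto
  have "g = ?f" if g: "g \<in> incident ET t" "edge_on_path g p" for g
  proof -
    obtain i where i: "Suc i < length p" "g = {p ! i, p ! Suc i}" using g(2) unfolding edge_on_path_def by blast
    have "t \<in> g" using g(1) unfolding incident_def by simp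
    then have "p ! i = p ! 0 \<or> p ! Suc i = p ! 0" using i hd(1) by auto
    then have "i = 0 \<or> Suc i = 0" using nth_eq_iff_index_eq[OF hd(3)] i(1) by (meson Suc_lessD l)
    then have "i = 0" by simp
    then show ?thesis using i by simp
  qed
  moreover have "?f \<in> incident ET t" using f(1) hd(1) unfolding incident_def by simp
  ultimately show ?thesis using f(2) unfolding edge_on_path_iff[OF p] by blast
qed

lemma dir_incident: "t \<in> N \<Longrightarrow> x \<in> N \<Longrightarrow> t \<noteq> x \<Longrightarrow> dir t x \<in> incident ET t"
  and dir_sep: "t \<in> N \<Longrightarrow> x \<in> N \<Longrightarrow> t \<noteq> x \<Longrightarrow> \<not> reach (dir t x) t x"
  unfolding dir_def by (use theI'[OF dir_unique, of t x] in simp_all)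

lemma sep_iff_dir:
  assumes "f \<in> incident ET t" "x \<in> N" shows "\<not> reach f t x \<longleftrightarrow> x \<noteq> t \<and> dir t x = f"
proof (cases "x = t")
  case False
  have t: "t \<in> N" using incident_ends[OF assms(1)] by blast
  show ?thesis
    using dir_unique[OF t assms(2)] dir_incident[OF t assms(2)] dir_sep[OF t assms(2)] assms(1) False by blast
qed simp

lemma dir_edge: "{t, r} \<in> ET \<Longrightarrow> dir t r = {t, r}"
  using sep_iff_dir[of "{t, r}" t r] bridge[of t r] incident_iff(1)[of t r] edge_nodes[of t r] by blast

text \<open>The edge \<open>{x, y}\<close> does not touch \<open>q\<close>, hence survives the
  removal of any edge at \<open>q\<close>.\<close>

lemma dir_const:
  assumes "{x, y} \<in> ET" "q \<in> N" "q \<noteq> x" "q \<noteq> y" shows "dir q x = dir q y"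
proof -
  have xy: "x \<in> N" "y \<in> N" using assms edge_nodes by auto
  let ?g = "dir q x"
  have g: "?g \<in> incident ET q" "\<not> reach ?g q x" using dir_incident dir_sep assms xy by auto
  then have "?g \<noteq> {x, y}" using assms(3,4) unfolding incident_def by auto
  then have "reach ?g x y" using reach_edge[OF assms(1), of ?g] by simp
  then have "\<not> reach ?g q y"
    using g(2) reach_cong[of ?g x y q] reach_commute[of ?g q x] reach_commute[of ?g q y] by blast
  then show ?thesis using sep_iff_dir[OF g(1)] xy by simp
qed

lemma reach_dir:
  assumes "reach f x y" "x \<in> N" "q \<in> N" "\<And>z. reach f x z \<Longrightarrow> z \<noteq> q"
  shows "dir q x = dir q y"
  using assms(1) unfolding reach_def
proof (induction rule: rtranclp_induct)
  case (step y z)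
  have "reach f x y" "reach f x z" using step unfolding reach_def by auto
  then have "q \<noteq> y" "q \<noteq> z" using assms(4) by blast+
  then show ?case using step dir_const[of y z q] assms(3) unfolding tadj_def by simp
qed simp

text \<open>An edge divides the nodes into two sides, so looking across it from \<open>t\<close> and
  looking across it from \<open>r\<close> exclude each other. The extra disjuncts treat the ends,
  where \<open>dir\<close> is unspecified.\<close>

lemma dir_flip:
  assumes "{t, r} \<in> ET" "x \<in> N"
  shows "(x \<noteq> t \<and> dir t x = {t, r}) \<longleftrightarrow> (x = r \<or> dir r x \<noteq> {t, r})"
proof -
  have f: "{t, r} \<in> incident ET t" "{t, r} \<in> incident ET r" using assms incident_iff by auto
  have "reach {t, r} t x \<longleftrightarrow> \<not> reach {t, r} r x"
    using reach_either[OF assms] bridge[OF assms(1)] reach_cong[of "{t, r}" t x r] reach_commute[of "{t, r}" x r]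
    by blast
  then show ?thesis using sep_iff_dir[OF f(1) assms(2)] sep_iff_dir[OF f(2) assms(2)] by blast
qed

text \<open>The main tool on trees: if \<open>t\<close> lies between \<open>q\<close> and
  \<open>x\<close>, then \<open>q\<close> looks towards \<open>x\<close> as towards
  \<open>t\<close>. The branch of \<open>x\<close> at \<open>t\<close> is connected and avoids
  \<open>q\<close>, so the direction from \<open>q\<close> cannot change inside it.\<close>

lemma dir_branch:
  assumes N: "t \<in> N" "q \<in> N" "x \<in> N" and ne: "q \<noteq> t" "x \<noteq> t" and d: "dir t q \<noteq> dir t x"
  shows "dir q x = dir q t"
proof -
  let ?f = "dir t x"
  have f: "?f \<in> incident ET t" "\<not> reach ?f t x" using dir_incident dir_sep N ne by auto
  then obtain r where r: "?f = {t, r}" "r \<noteq> t" "r \<in> N" "{t, r} \<in> ET" using incident_ends by blast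
  have rx: "reach ?f r x" using reach_either[OF r(4) N(3)] f(2) r(1) by simp
  have rt: "\<not> reach ?f t r" using bridge[OF r(4)] r(1) by simp
  have tq: "reach ?f t q" using sep_iff_dir[OF f(1) N(2)] d by blast
  have q: "z \<noteq> q" if "reach ?f r z" for z 
    using that tq rt reach_cong[of ?f r z t] reach_commute[of ?f t r] reach_commute[of ?f t z] by auto
  have "dir q r = dir q x" using reach_dir[OF rx r(3) N(2)] q by blast
  moreover have "dir q r = dir q t" using dir_const[of r t q] r N ne q[of r] by (auto simp: insert_commute)
  ultimately show ?thesis by simp
qed

end

section \<open>Split decompositions\<close>

locale split_decomposition =
  fixes V :: "'a set" and E :: "'a \<Rightarrow> 'a \<Rightarrow> bool"
    and N :: "'n set" and ET :: "'n set set"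
    and mu :: "'n \<Rightarrow> 'n set \<Rightarrow> 'n set \<Rightarrow> bool" and lf :: "'a \<Rightarrow> 'n"
  assumes graph: "graph V E" and connected: "connected_graph V E"
    and two_vertices: "card V \<ge> 2" and csd: "canonical_split_decomposition V E N ET mu lf"
begin

sublocale tree N ET
  using csd unfolding canonical_split_decomposition_def by unfold_locales (elim conjE)

abbreviation inner :: "'n set" where "inner \<equiv> tinternal N ET"
abbreviation inc :: "'n \<Rightarrow> 'n set set" where "inc \<equiv> incident ET"
abbreviation D :: "'n \<Rightarrow> 'a \<Rightarrow> 'n set" where "D t v \<equiv> dir t (lf v)"

text \<open>
  On leaves this is adjacency; allowing arbitrary nodes makes it decompose at every node of the path
  (\<open>acc_compose\<close>).
\<close>
definition acc :: "'n \<Rightarrow> 'n \<Rightarrow> bool" where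
  "acc x y \<longleftrightarrow> (\<forall>r\<in>N. r \<noteq> x \<longrightarrow> r \<noteq> y \<longrightarrow> dir r x \<noteq> dir r y \<longrightarrow> mu r (dir r x) (dir r y))"

lemma edge_graph: "E u v \<Longrightarrow> u \<in> V \<and> v \<in> V \<and> u \<noteq> v"
  using graph unfolding graph_def by blast

lemma E_sym: "E u v \<longleftrightarrow> E v u"
  by (rule graphD(5)[OF graph])

lemma finite_V: "finite V"
  by (rule graphD(1)[OF graph])

lemma leaf_bij: "bij_betw lf V (tleaves N ET)"
  using csd unfolding canonical_split_decomposition_def by (elim conjE)

lemma leaf_in_tree: "v \<in> V \<Longrightarrow> lf v \<in> N"
  using bij_betwE[OF leaf_bij] unfolding tleaves_def by blast

lemma leaf_inj: "u \<in> V \<Longrightarrow> v \<in> V \<Longrightarrow> lf u = lf v \<longleftrightarrow> u = v"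
  using leaf_bij unfolding bij_betw_def inj_on_def by blast

lemma inner_in_tree: "t \<in> inner \<Longrightarrow> t \<in> N"
  unfolding tinternal_def by blast

lemma leaf_not_inner: "v \<in> V \<Longrightarrow> t \<in> inner \<Longrightarrow> lf v \<noteq> t"
  using bij_betwE[OF leaf_bij] unfolding tinternal_def by blast

lemma leaf_or_inner: "x \<in> N \<Longrightarrow> x \<in> inner \<or> (\<exists>v\<in>V. lf v = x)"
proof -
  assume "x \<in> N"
  then have "x \<in> inner \<or> x \<in> lf ` V" using bij_betw_imp_surj_on[OF leaf_bij] unfolding tinternal_def by blast
  then show ?thesis by blast
qed

lemma inner_card: "t \<in> inner \<Longrightarrow> card (inc t) \<ge> 3"
  and inner_label: "t \<in> inner \<Longrightarrow> label_graph (inc t) (mu t)"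
proof -
  have "\<forall>t\<in>inner. card (inc t) \<ge> 3 \<and> label_graph (inc t) (mu t)"
    using csd unfolding canonical_split_decomposition_def by (elim conjE)
  then show "t \<in> inner \<Longrightarrow> card (inc t) \<ge> 3" "t \<in> inner \<Longrightarrow> label_graph (inc t) (mu t)" by blast+
qed

lemma innerI: assumes "f \<in> inc t" "g \<in> inc t" "f \<noteq> g" shows "t \<in> inner"
proof -
  have "card {f, g} \<le> card (inc t)" using assms finite_incident by (intro card_mono) auto
  moreover have "t \<in> N" using incident_ends[OF assms(1)] by blast
  ultimately show ?thesis using assms(3) unfolding tinternal_def tleaves_def by simp
qed

lemma between_inner: "r \<in> N \<Longrightarrow> x \<in> N \<Longrightarrow> y \<in> N \<Longrightarrow> r \<noteq> x \<Longrightarrow> r \<noteq> y \<Longrightarrow> dir r x \<noteq> dir r y \<Longrightarrow> r \<in> inner"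
  using innerI[of "dir r x" r "dir r y"] dir_incident[of r x] dir_incident[of r y] by simp

lemma D_inc: "t \<in> inner \<Longrightarrow> v \<in> V \<Longrightarrow> D t v \<in> inc t"
  using dir_incident[of t "lf v"] leaf_in_tree leaf_not_inner inner_in_tree by metis

lemma third_incident:
  assumes "t \<in> inner" obtains k where "k \<in> inc t" "k \<noteq> f" "k \<noteq> g"
proof -
  have "\<not> inc t \<subseteq> {f, g}"
  proof
    assume "inc t \<subseteq> {f, g}"
    then have "card (inc t) \<le> card {f, g}" by (intro card_mono) auto
    also have "\<dots> \<le> 2" by (simp add: card_insert_if)
    finally show False using inner_card[OF assms] by simp
  qed
  then show thesis using that by blast
qed

lemma label_graph_graph: "t \<in> inner \<Longrightarrow> graph (inc t) (mu t)"
  using inner_label[of t] finite_incident[of t] unfolding graph_def label_graph_def by blast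

lemma mu_sym: "t \<in> inner \<Longrightarrow> mu t f g \<longleftrightarrow> mu t g f"
  by (rule graphD(5)[OF label_graph_graph])

lemma mu_irr: "t \<in> inner \<Longrightarrow> \<not> mu t f f"
  by (rule graphD(4)[OF label_graph_graph])

lemma path_inner:
  assumes p: "tpath ET x y p" and i: "0 < i" "Suc i < length p"
  shows "p ! i \<in> N" "p ! i \<noteq> x" "p ! i \<noteq> y" "dir (p ! i) x = {p ! (i - 1), p ! i}"
    "dir (p ! i) y = {p ! i, p ! Suc i}" "dir (p ! i) x \<noteq> dir (p ! i) y"
proof -
  have d: "distinct p" and hl: "p ! 0 = x" "p ! (length p - 1) = y"
    and ed: "\<And>j. Suc j < length p \<Longrightarrow> {p ! j, p ! Suc j} \<in> ET"
    using p unfolding tpath_def by (auto simp: hd_conv_nth last_conv_nth)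
  obtain j where j: "i = Suc j" using i by (cases i) auto
  have e: "{p ! j, p ! i} \<in> ET" "{p ! i, p ! Suc i} \<in> ET" using ed[of j] ed[of i] i j by auto
  show N: "p ! i \<in> N" using edge_nodes[OF e(1)] by blast
  have N': "p ! j \<in> N" "p ! Suc i \<in> N" using edge_nodes e by blast+
  have xy: "x \<in> N" "y \<in> N"
  proof -
    show "x \<in> N" using ed[of 0] edge_nodes hl i by (metis One_nat_def Suc_lessD Suc_lessI less_trans zero_less_Suc)
    have "{p ! (length p - 2), p ! (length p - 1)} \<in> ET"
      using ed[of "length p - 2"] i by (simp add: Suc_diff_Suc numeral_2_eq_2)
    then show "y \<in> N" using edge_nodes hl by metis
  qed
  have idx: "p ! m = p ! n \<longleftrightarrow> m = n" if "m < length p" "n < length p" for m n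
    using nth_eq_iff_index_eq[OF d that] .
  have l: "0 < length p" "i < length p" "length p - 1 < length p" "i \<noteq> 0" "i \<noteq> length p - 1" using i by auto
  show ne: "p ! i \<noteq> x" "p ! i \<noteq> y" using idx[OF l(2,1)] idx[OF l(2,3)] hl l(4,5) by simp_all
  have f: "{p ! j, p ! i} \<in> inc (p ! i)" "{p ! i, p ! Suc i} \<in> inc (p ! i)"
    using e unfolding incident_def by auto
  have pt: "tpath ET x (p ! i) (take (Suc i) p)" using tpath_take[OF p] i by simp
  have "edge_on_path {p ! j, p ! i} (take (Suc i) p)"
    unfolding edge_on_path_def by (rule exI[of _ j]) (use i j in auto)
  then have "\<not> reach {p ! j, p ! i} (p ! i) x" using edge_on_path_iff[OF pt] reach_commute by blast
  then show dx: "dir (p ! i) x = {p ! (i - 1), p ! i}" using sep_iff_dir[OF f(1) xy(1)] j by simp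
  have pd: "tpath ET (p ! i) y (drop i p)" using tpath_drop[OF p] i by simp
  have "edge_on_path {p ! i, p ! Suc i} (drop i p)"
    unfolding edge_on_path_def by (rule exI[of _ 0]) (use i in auto)
  then have "\<not> reach {p ! i, p ! Suc i} (p ! i) y" using edge_on_path_iff[OF pd] by blast
  then show dy: "dir (p ! i) y = {p ! i, p ! Suc i}" using sep_iff_dir[OF f(2) xy(2)] by simp
  have "p ! j \<noteq> p ! Suc i" "p ! j \<noteq> p ! i" using idx[of j "Suc i"] idx[of j i] i j by auto
  then show "dir (p ! i) x \<noteq> dir (p ! i) y" using dx dy j by (auto simp: doubleton_eq_iff)
qed

text \<open>If \<open>r\<close> were off the path, \<open>dir r\<close> would be constant along
  it.\<close>

lemma between_on_path:
  assumes p: "tpath ET x y p" and r: "r \<in> N" "r \<noteq> x" "r \<noteq> y" "dir r x \<noteq> dir r y"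
  shows "\<exists>i. 0 < i \<and> Suc i < length p \<and> p ! i = r"
proof -
  have hl: "p ! 0 = x" "p ! (length p - 1) = y" "p \<noteq> []"
    and ed: "\<And>j. Suc j < length p \<Longrightarrow> {p ! j, p ! Suc j} \<in> ET"
    using p unfolding tpath_def by (auto simp: hd_conv_nth last_conv_nth)
  have "r \<in> set p"
  proof (rule ccontr)
    assume n: "r \<notin> set p"
    have "i < length p \<Longrightarrow> dir r (p ! i) = dir r x" for i
    proof (induction i)
      case (Suc i)
      then have "r \<noteq> p ! i" "r \<noteq> p ! Suc i" using n nth_mem by (metis Suc_lessD)+
      then show ?case using Suc dir_const[OF ed r(1)] by simp
    qed (simp add: hl)
    from this[of "length p - 1"] show False using hl r(4) by simp
  qed
  then obtain i where i: "i < length p" "p ! i = r" by (meson in_set_conv_nth)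
  moreover have "i \<noteq> 0" using i hl r by auto
  moreover have "i \<noteq> length p - 1" using i hl r by auto
  ultimately show ?thesis by (intro exI[of _ i]) linarith
qed

text \<open>The inner nodes of the path are exactly those that see its ends in different directions,
  and these directions are the two label vertices. From here on adjacency needs no paths.\<close>

lemma adj_iff_acc:
  assumes uv: "u \<in> V" "v \<in> V" "u \<noteq> v"
  shows "E u v \<longleftrightarrow> acc (lf u) (lf v)"
proof -
  define ok where "ok p \<longleftrightarrow> (\<forall>i. 0 < i \<and> Suc i < length p \<longrightarrow>
              mu (p ! i) {p ! (i - 1), p ! i} {p ! i, p ! Suc i})" for p
  have "\<forall>u\<in>V. \<forall>v\<in>V. u \<noteq> v \<longrightarrow> (E u v \<longleftrightarrow> (\<forall>p. tpath ET (lf u) (lf v) p \<longrightarrow> ok p))"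
    using csd unfolding canonical_split_decomposition_def ok_def by (elim conjE)
  then have 1: "E u v \<longleftrightarrow> (\<forall>p. tpath ET (lf u) (lf v) p \<longrightarrow> ok p)" using uv by blast
  have 2: "ok p \<longleftrightarrow> acc (lf u) (lf v)" if p: "tpath ET (lf u) (lf v) p" for p
  proof
    assume ok: "ok p"
    show "acc (lf u) (lf v)"
      unfolding acc_def
    proof (intro ballI impI)
      fix r assume r: "r \<in> N" "r \<noteq> lf u" "r \<noteq> lf v" "dir r (lf u) \<noteq> dir r (lf v)"
      obtain i where i: "0 < i" "Suc i < length p" "p ! i = r" using between_on_path[OF p r] by blast
      have "mu (p ! i) {p ! (i - 1), p ! i} {p ! i, p ! Suc i}" using ok i(1,2) unfolding ok_def by blast
      then show "mu r (dir r (lf u)) (dir r (lf v))"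
        using path_inner(4,5)[OF p i(1,2)] by (simp add: i(3))
    qed
  next
    assume a: "acc (lf u) (lf v)"
    show "ok p"
      unfolding ok_def
    proof (intro allI impI, elim conjE)
      fix i assume i: "0 < i" "Suc i < length p"
      show "mu (p ! i) {p ! (i - 1), p ! i} {p ! i, p ! Suc i}"
        using a path_inner[OF p i] unfolding acc_def by metis
    qed
  qed
  obtain p where "tpath ET (lf u) (lf v) p" using tpath_exists leaf_in_tree uv by blast
  then show ?thesis using 1 2 by blast
qed

lemma acc_sym: assumes "x \<in> N" "y \<in> N" shows "acc x y \<longleftrightarrow> acc y x"
proof -
  have "acc y x" if a: "acc x y" "x \<in> N" "y \<in> N" for x y
    unfolding acc_def
  proof (intro ballI impI)
    fix r assume r: "r \<in> N" "r \<noteq> y" "r \<noteq> x" "dir r y \<noteq> dir r x"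
    then have "r \<in> inner" using between_inner a by blast
    moreover have "mu r (dir r x) (dir r y)" using a(1) r unfolding acc_def by simp
    ultimately show "mu r (dir r y) (dir r x)" using mu_sym by blast
  qed
  then show ?thesis using assms by blast
qed

lemma acc_edge: assumes "{x, y} \<in> ET" shows "acc x y"
  unfolding acc_def using dir_const[OF assms] by blast

text \<open>The node \<open>t\<close> lies on the path from \<open>u\<close> to \<open>v\<close>. By
  \<open>sub\<close>, a node strictly between \<open>t\<close> and \<open>u\<close> sees
  \<open>v\<close> where it sees \<open>t\<close>, so the conditions on the two halves are those on
  the whole path.\<close>

lemma acc_compose:
  assumes N: "t \<in> N" "u \<in> N" "v \<in> N" and ne: "t \<noteq> u" "t \<noteq> v" and d: "dir t u \<noteq> dir t v"
  shows "acc u v \<longleftrightarrow> acc t u \<and> acc t v \<and> mu t (dir t u) (dir t v)"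
proof -
  have sub: "r \<noteq> v \<and> dir r v = dir r t"
    if r: "r \<in> N" "r \<noteq> t" "r \<noteq> u" "dir r t \<noteq> dir r u" and N: "u \<in> N" "v \<in> N" and ne: "t \<noteq> u" "t \<noteq> v"
      and d: "dir t u \<noteq> dir t v" for r u v
  proof -
    have "dir t u = dir t r" using dir_branch[of r t u] r N \<open>t \<in> N\<close> ne by auto
    then show ?thesis using dir_branch[of t r v] r N \<open>t \<in> N\<close> ne d by auto
  qed
  show ?thesis
  proof
    assume a: "acc u v"
    have "mu t (dir t u) (dir t v)" using a N ne d unfolding acc_def by blast
    moreover have "acc t u"
      unfolding acc_def
    proof (intro ballI impI)
      fix r assume r: "r \<in> N" "r \<noteq> t" "r \<noteq> u" "dir r t \<noteq> dir r u"
      have s: "r \<noteq> v" "dir r v = dir r t" using sub[OF r N(2,3) ne d] by auto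
      have "mu r (dir r u) (dir r v)" using a r s unfolding acc_def by metis
      then show "mu r (dir r t) (dir r u)"
        using s mu_sym[OF between_inner[OF r(1) N(1,2) r(2,3,4)], of "dir r u" "dir r t"] by simp
    qed
    moreover have "acc t v"
      unfolding acc_def
    proof (intro ballI impI)
      fix r assume r: "r \<in> N" "r \<noteq> t" "r \<noteq> v" "dir r t \<noteq> dir r v"
      have s: "r \<noteq> u" "dir r u = dir r t" using sub[OF r N(3,2) ne(2,1) d[symmetric]] by auto
      have "mu r (dir r u) (dir r v)" using a r s unfolding acc_def by metis
      then show "mu r (dir r t) (dir r v)" using s by simp
    qed
    ultimately show "acc t u \<and> acc t v \<and> mu t (dir t u) (dir t v)" by blast
  next
    assume a: "acc t u \<and> acc t v \<and> mu t (dir t u) (dir t v)"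
    show "acc u v"
      unfolding acc_def
    proof (intro ballI impI)
      fix r assume r: "r \<in> N" "r \<noteq> u" "r \<noteq> v" "dir r u \<noteq> dir r v"
      show "mu r (dir r u) (dir r v)"
      proof (cases "r = t")
        case True then show ?thesis using a by simp
      next
        case False
        show ?thesis
        proof (cases "dir r t = dir r u")
          case True
          then have "mu r (dir r t) (dir r v)" using a r False unfolding acc_def by metis
          then show ?thesis using True by simp
        next
          case ne': False
          have "dir r v = dir r t" using sub[OF r(1) False r(2) ne' N(2,3) ne d] by blast
          moreover have "mu r (dir r t) (dir r u)" using a r False ne' unfolding acc_def by metis
          ultimately show ?thesis using mu_sym[OF between_inner[OF r(1) N(2,3) r(2,3,4)], of "dir r u" "dir r t"] by simp
        qed
      qed
    qed
  qed
qed

text \<open>A rank statement: each branch at \<open>t\<close> meets the rest of \<open>G\<close>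
  only through its accessible vertices, and the label decides which branches are joined. Most
  adjacencies below are computed with it.\<close>

lemma adj_at:
  assumes "t \<in> inner" "u \<in> V" "v \<in> V" "D t u \<noteq> D t v"
  shows "E u v \<longleftrightarrow> acc t (lf u) \<and> acc t (lf v) \<and> mu t (D t u) (D t v)"
proof -
  have "u \<noteq> v" using assms by auto
  moreover have "t \<noteq> lf u" "t \<noteq> lf v" using leaf_not_inner assms by blast+
  ultimately show ?thesis
    using adj_iff_acc[of u v] acc_compose[of t "lf u" "lf v"] assms leaf_in_tree inner_in_tree by simp
qed

text \<open>An inner node has a further edge to go on through, and the set of nodes beyond the edge
  shrinks at each move.\<close>

lemma leaf_beyond: assumes "{t, r} \<in> ET" shows "\<exists>v\<in>V. lf v \<noteq> t \<and> D t v = {t, r}"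
  using assms
proof (induction "card {x \<in> N. x \<noteq> t \<and> dir t x = {t, r}}" arbitrary: t r rule: less_induct)
  case less
  have tr: "t \<in> N" "r \<in> N" "t \<noteq> r" using edge_nodes[OF less.prems] by auto
  show ?case
  proof (cases "r \<in> inner")
    case False
    then obtain v where "v \<in> V" "lf v = r" using leaf_or_inner tr by blast
    then show ?thesis using dir_edge[OF less.prems] tr(3) by (intro bexI[of _ v]) simp_all
  next
    case True
    obtain k where k: "k \<in> inc r" "k \<noteq> {t, r}" using third_incident[OF True] by metis
    obtain q where q: "k = {r, q}" "{r, q} \<in> ET" using incident_ends[OF k(1)] by metis
    have sub: "x \<noteq> t \<and> dir t x = {t, r}" if "x \<in> N" "x \<noteq> r" "dir r x = {r, q}" for x
      using dir_flip[OF less.prems that(1)] that(2,3) k(2) q(1) by metis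
    have "{x \<in> N. x \<noteq> r \<and> dir r x = {r, q}} \<subset> {x \<in> N. x \<noteq> t \<and> dir t x = {t, r}}"
    proof (rule psubsetI)
      have "r \<in> {x \<in> N. x \<noteq> t \<and> dir t x = {t, r}}" using dir_edge[OF less.prems] tr by simp
      then show "{x \<in> N. x \<noteq> r \<and> dir r x = {r, q}} \<noteq> {x \<in> N. x \<noteq> t \<and> dir t x = {t, r}}" by blast
    qed (use sub in blast)
    then have "card {x \<in> N. x \<noteq> r \<and> dir r x = {r, q}} < card {x \<in> N. x \<noteq> t \<and> dir t x = {t, r}}"
      using finite_nodes by (intro psubset_card_mono) auto
    from less.hyps[OF this q(2)] show ?thesis using sub leaf_in_tree by blast
  qed
qed

lemma leaf_in_branch: assumes "t \<in> inner" "f \<in> inc t" shows "\<exists>v\<in>V. D t v = f"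
  using incident_ends[OF assms(2)] leaf_beyond by metis

section \<open>Labels as connected induced subgraphs of \<open>G\<close>\<close>

lemma crossing_edge:
  assumes "u \<in> V" "v \<in> V" "P u" "\<not> P v" shows "\<exists>x y. E x y \<and> P x \<and> \<not> P y"
proof -
  have "E\<^sup>*\<^sup>* u v" using connected assms unfolding connected_graph_def by blast
  then show ?thesis using rtranclp_leaves_set[of E u v "Collect P"] assms by blast
qed

text \<open>Connectedness gives an edge of \<open>G\<close> leaving the branch; its end inside the
  branch is accessible from \<open>t\<close>.\<close>

lemma rep_exists:
  assumes t: "t \<in> inner" and f: "f \<in> inc t" shows "\<exists>v. v \<in> V \<and> D t v = f \<and> acc t (lf v)"
proof -
  obtain g where g: "g \<in> inc t" "g \<noteq> f" using third_incident[OF t] by metis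
  obtain u where u: "u \<in> V" "D t u = f" using leaf_in_branch[OF t f] by blast
  obtain v where v: "v \<in> V" "D t v = g" using leaf_in_branch[OF t g(1)] by blast
  obtain x y where xy: "E x y" "D t x = f" "D t y \<noteq> f"
    using crossing_edge[of u v "\<lambda>x. D t x = f"] u v g by auto
  then show ?thesis using adj_at[OF t, of x y] edge_graph[OF xy(1)] by auto
qed

definition rep :: "'n \<Rightarrow> 'n set \<Rightarrow> 'a" where
  "rep t f = (SOME v. v \<in> V \<and> D t v = f \<and> acc t (lf v))"

lemma rep:
  assumes "t \<in> inner" "f \<in> inc t" shows "rep t f \<in> V" "D t (rep t f) = f" "acc t (lf (rep t f))"
  using someI_ex[OF rep_exists[OF assms]] unfolding rep_def by blast+

text \<open>One accessible vertex per branch exhibits the label as an induced subgraph of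
  \<open>G\<close>.\<close>

lemma rep_adj:
  assumes "t \<in> inner" "f \<in> inc t" "g \<in> inc t" shows "E (rep t f) (rep t g) \<longleftrightarrow> mu t f g"
proof (cases "f = g")
  case True
  then show ?thesis using edge_graph mu_irr[OF assms(1)] by auto
next
  case False
  then show ?thesis using adj_at[OF assms(1), of "rep t f" "rep t g"] rep[OF assms(1,2)] rep[OF assms(1,3)] by simp
qed

lemma label_no_empty_cut: assumes t: "t \<in> inner" shows "no_empty_cut (inc t) (mu t)"
  unfolding no_empty_cut_def
proof (intro allI impI)
  fix A assume A: "A \<subseteq> inc t" "A \<noteq> {}" "A \<noteq> inc t"
  obtain f g where fg: "f \<in> A" "g \<in> inc t" "g \<notin> A" using A by blast
  have f: "f \<in> inc t" using fg A by blast
  obtain x y where xy: "E x y" "D t x \<in> A" "D t y \<notin> A"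
    using crossing_edge[of "rep t f" "rep t g" "\<lambda>x. D t x \<in> A"] rep[OF t f] rep[OF t fg(2)] fg by auto
  have V: "x \<in> V" "y \<in> V" using edge_graph[OF xy(1)] by auto
  have "D t x \<noteq> D t y" using xy by metis
  then have "mu t (D t x) (D t y)" using adj_at[OF t V] xy by blast
  then show "\<exists>a\<in>A. \<exists>b\<in>inc t - A. mu t a b" using xy D_inc[OF t V(2)] by blast
qed

lemma label_P4_dominated:
  assumes t: "t \<in> inner" and dom: "P4_dominated V E" shows "P4_dominated (inc t) (mu t)"
  unfolding P4_dominated_def
proof (intro ballI impI)
  fix a b c d x assume i: "a \<in> inc t" "b \<in> inc t" "c \<in> inc t" "d \<in> inc t" "x \<in> inc t"
    and p: "induced_P4 (mu t) a b c d"
  have "induced_P4 E (rep t a) (rep t b) (rep t c) (rep t d)"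
    using p i unfolding induced_P4_def by (simp add: rep_adj[OF t])
  from P4_dominatedD[OF dom graph this rep(1)[OF t i(5)]]
  show "\<not> (mu t x a \<and> mu t x d) \<and> (mu t x b \<or> mu t x c)" using i by (simp add: rep_adj[OF t])
qed

section \<open>Branches, strong splits and canonicity\<close>

definition branch :: "'n \<Rightarrow> 'n set \<Rightarrow> 'a set" where
  "branch t f = {v \<in> V. lf v \<noteq> t \<and> D t v = f}"

lemma branch_inner: "t \<in> inner \<Longrightarrow> branch t f = {v \<in> V. D t v = f}"
  unfolding branch_def using leaf_not_inner by blast

lemma side_eq_branch:
  assumes "{t, r} \<in> ET"
  shows "side V ET lf {t, r} r = branch t {t, r}" "side V ET lf {t, r} t = V - branch t {t, r}"
proof -
  have f: "{t, r} \<in> inc t" using assms incident_iff by blast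
  have 1: "(\<lambda>a b. tadj (ET - {{t, r}}) a b)\<^sup>*\<^sup>* x y \<longleftrightarrow> reach {t, r} x y" for x y
    unfolding reach_def by simp
  have 2: "reach {t, r} r (lf v) \<longleftrightarrow> \<not> reach {t, r} t (lf v)" if "v \<in> V" for v
    using reach_either[OF assms leaf_in_tree[OF that]] bridge[OF assms] reach_cong[of "{t, r}" t "lf v" r]
      reach_commute[of "{t, r}" r "lf v"] by blast
  have 3: "\<not> reach {t, r} t (lf v) \<longleftrightarrow> v \<in> branch t {t, r}" if "v \<in> V" for v
    using sep_iff_dir[OF f leaf_in_tree[OF that]] that unfolding branch_def by blast
  show "side V ET lf {t, r} r = branch t {t, r}" "side V ET lf {t, r} t = V - branch t {t, r}"
    unfolding side_def 1 using 2 3 unfolding branch_def by blast+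
qed

lemma strong_splits_eq:
  "{{A, B} | A B. is_strong_split V E A B} =
     {{side V ET lf e x, side V ET lf e y} | e x y.
        e \<in> ET \<and> e = {x, y} \<and> x \<noteq> y \<and> x \<in> inner \<and> y \<in> inner}"
  using csd unfolding canonical_split_decomposition_def by (elim conjE)

lemma edge_split_not_crossed:
  assumes e: "{t, r} \<in> ET" "t \<in> inner" "r \<in> inner" and sp: "is_split V E A1 B1"
  shows "\<not> (branch t {t, r} \<inter> A1 \<noteq> {} \<and> branch t {t, r} \<inter> B1 \<noteq> {} \<and>
    (V - branch t {t, r}) \<inter> A1 \<noteq> {} \<and> (V - branch t {t, r}) \<inter> B1 \<noteq> {})"
proof -
  have "t \<noteq> r" using edge_nodes[OF e(1)] by blast
  then have "{side V ET lf {t, r} t, side V ET lf {t, r} r} \<in> {{A, B} | A B. is_strong_split V E A B}"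
    unfolding strong_splits_eq using e by blast
  then have "\<exists>A B. {V - branch t {t, r}, branch t {t, r}} = {A, B} \<and> is_strong_split V E A B"
    unfolding side_eq_branch[OF e(1)] mem_Collect_eq .
  then obtain A B where AB: "{V - branch t {t, r}, branch t {t, r}} = {A, B}" "is_strong_split V E A B"
    by (elim exE conjE) (rule that)
  have s: "\<not> (A \<inter> A1 \<noteq> {} \<and> A \<inter> B1 \<noteq> {} \<and> B \<inter> A1 \<noteq> {} \<and> B \<inter> B1 \<noteq> {})"
    using AB(2) sp unfolding is_strong_split_def by blast
  have "V - branch t {t, r} = A \<and> branch t {t, r} = B \<or> V - branch t {t, r} = B \<and> branch t {t, r} = A"
    using AB(1) unfolding doubleton_eq_iff by blast
  then show ?thesis using s by blast
qed

lemma strong_split_edge: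
  assumes "is_strong_split V E A B"
  shows "\<exists>x y. {x, y} \<in> ET \<and> {A, B} = {V - branch x {x, y}, branch x {x, y}}"
proof -
  have "{A, B} \<in> {{A, B} | A B. is_strong_split V E A B}" using assms by blast
  then obtain x y where "{x, y} \<in> ET" "{A, B} = {side V ET lf {x, y} x, side V ET lf {x, y} y}"
    unfolding strong_splits_eq by blast
  then show ?thesis unfolding side_eq_branch[OF \<open>{x, y} \<in> ET\<close>] by blast
qed

lemma branch_subset:
  assumes e: "{x, y} \<in> ET" and t: "t \<in> inner" and tx: "reach {x, y} t x"
  shows "branch x {x, y} \<subseteq> branch t (dir t y)"
proof
  fix v assume v: "v \<in> branch x {x, y}"
  then have V: "v \<in> V" unfolding branch_def by blast
  have ex: "{x, y} \<in> inc x" using e incident_iff by blast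
  have "\<not> reach {x, y} x (lf v)"
    using sep_iff_dir[OF ex leaf_in_tree[OF V]] v unfolding branch_def by blast
  then have yv: "reach {x, y} y (lf v)" using reach_either[OF e leaf_in_tree[OF V]] by blast
  have yx: "\<not> reach {x, y} y x" using bridge[OF e] reach_commute by blast
  have "z \<noteq> t" if "reach {x, y} y z" for z using that yx reach_trans[OF _ tx] by blast
  then have "dir t y = D t v" using reach_dir[OF yv] edge_nodes[OF e] inner_in_tree[OF t] by blast
  then show "v \<in> branch t (dir t y)" unfolding branch_inner[OF t] using V by simp
qed

text \<open>The side of the edge that does not contain \<open>t\<close> lies in one branch at
  \<open>t\<close>. This shows that a split with two branches at \<open>t\<close> on either side is
  not given by an edge of \<open>T\<close>.\<close>

lemma edge_side_in_branch:
  assumes e: "{x, y} \<in> ET" and t: "t \<in> inner"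
  shows "\<exists>f. branch x {x, y} \<subseteq> branch t f \<or> V - branch x {x, y} \<subseteq> branch t f"
proof -
  have e': "{y, x} \<in> ET" using e by (simp add: insert_commute)
  have c: "V - branch x {x, y} = branch y {x, y}"
    using side_eq_branch(2)[OF e] side_eq_branch(1)[OF e'] by (simp add: insert_commute)
  show ?thesis
  proof (cases "reach {x, y} t x")
    case True
    then show ?thesis using branch_subset[OF e t] by blast
  next
    case False
    then have "reach {x, y} t y"
      using reach_either[OF e inner_in_tree[OF t]] reach_commute[of _ t] by blast
    then show ?thesis using branch_subset[OF e' t] c by (auto simp: insert_commute)
  qed
qed

text \<open>If the far end of \<open>f\<close> is inner, the split of the edge \<open>f\<close> is
  strong and may not be crossed. If it is a leaf, the branch has a single vertex and cannot meet
  both sides.\<close>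

lemma branch_split_trivial:
  assumes t: "t \<in> inner" and f: "f \<in> inc t" and sp: "is_split V E A1 B1"
    and ne: "branch t f \<inter> A1 \<noteq> {}" "branch t f \<inter> B1 \<noteq> {}"
  shows "A1 \<subseteq> branch t f \<or> B1 \<subseteq> branch t f"
proof -
  obtain r where r: "f = {t, r}" "{t, r} \<in> ET" "r \<in> N" "f \<in> inc r" "r \<noteq> t" using incident_ends[OF f] by metis
  have AB: "A1 \<union> B1 = V" "A1 \<inter> B1 = {}" using sp unfolding is_split_def by auto
  show ?thesis
  proof (cases "r \<in> inner")
    case True
    have "\<not> ((V - branch t f) \<inter> A1 \<noteq> {} \<and> (V - branch t f) \<inter> B1 \<noteq> {})"
      using edge_split_not_crossed[OF r(2) t True sp] ne r(1) by simp
    then show ?thesis using AB by blast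
  next
    case False
    have lfr: "lf v = r" if v: "v \<in> branch t f" for v
    proof (rule ccontr)
      assume n: "lf v \<noteq> r"
      have V: "v \<in> V" "lf v \<noteq> t \<and> D t v = {t, r}" using v r(1) unfolding branch_def by auto
      have lN: "lf v \<in> N" using leaf_in_tree V by blast
      have "D r v \<noteq> f" using dir_flip[OF r(2) lN] V(2) n r(1) by blast
      then have "r \<in> inner" using innerI[OF dir_incident[OF r(3) lN] r(4)] n by auto
      then show False using False by blast
    qed
    have "u = v" if uv: "u \<in> branch t f" "v \<in> branch t f" for u v
    proof -
      have "u \<in> V" "v \<in> V" using uv unfolding branch_def by blast+
      then show ?thesis using leaf_inj[of u v] lfr[OF uv(1)] lfr[OF uv(2)] by simp
    qed
    then show ?thesis using ne AB by blast
  qed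
qed

text \<open>The lift \<open>?A\<close> of a strong cut \<open>A\<close> of the label consists of
  whole branches at \<open>t\<close>. It cannot be the split of an edge because both of its sides
  meet at least two branches.\<close>

lemma label_star_or_complete:
  assumes t: "t \<in> inner" and dom: "P4_dominated V E"
  shows "star_graph (inc t) (mu t) \<or> complete_graph (inc t) (mu t)"
proof (rule ccontr)
  assume "\<not> ?thesis"
  then obtain A where A: "rank_one_cut (inc t) (mu t) A" "card A \<ge> 2" "card (inc t - A) \<ge> 2"
    and nocross: "\<And>Z. rank_one_cut (inc t) (mu t) Z \<Longrightarrow> \<not> crosses (inc t) A Z"
    using P4_dominated_strong_cut[OF label_graph_graph[OF t] label_no_empty_cut[OF t]
        label_P4_dominated[OF t dom] inner_card[OF t]] by blast
  obtain h where AI: "A \<subseteq> inc t" and h: "\<And>f g. f \<in> A \<Longrightarrow> g \<in> inc t - A \<Longrightarrow> mu t f g \<longleftrightarrow> h f \<and> h g"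
    using A(1) unfolding rank_one_cut_def by auto
  let ?A = "{v \<in> V. D t v \<in> A}"
  have two: "\<exists>f g. f \<in> X \<and> g \<in> X \<and> f \<noteq> g" if "card X \<ge> 2" for X :: "'n set set"
    using that by (metis card_2_iff' card_le_Suc0_iff_eq card.infinite not_less_eq_eq numeral_2_eq_2 zero_le)
  obtain f1 g1 where 1: "f1 \<in> A" "g1 \<in> A" "f1 \<noteq> g1" using two[OF A(2)] by blast
  obtain f2 g2 where 2: "f2 \<in> inc t - A" "g2 \<in> inc t - A" "f2 \<noteq> g2" using two[OF A(3)] by blast
  have i1: "f1 \<in> inc t" "g1 \<in> inc t" using 1 AI by blast+
  have i2: "f2 \<in> inc t" "g2 \<in> inc t" using 2 by blast+
  note r1 = rep(2)[OF t i1(1)] rep(2)[OF t i1(2)]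
  note r2 = rep(2)[OF t i2(1)] rep(2)[OF t i2(2)]
  have m1: "rep t f1 \<in> ?A" "rep t g1 \<in> ?A" using rep(1)[OF t] i1 r1 1 by simp_all
  have n1: "rep t f1 \<noteq> rep t g1" using r1 1(3) by metis
  have m2: "rep t f2 \<in> V - ?A" "rep t g2 \<in> V - ?A" using rep(1)[OF t] i2 r2 2 by simp_all
  have n2: "rep t f2 \<noteq> rep t g2" using r2 2(3) by metis
  have split: "is_split V E ?A (V - ?A)"
    unfolding is_split_def
  proof (intro conjI ballI impI)
    show "card ?A \<ge> 2" using card_mono[of ?A "{rep t f1, rep t g1}"] m1 n1 finite_V by simp
    show "card (V - ?A) \<ge> 2" using card_mono[of "V - ?A" "{rep t f2, rep t g2}"] m2 n2 finite_V by simp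
    have adj: "E a b \<longleftrightarrow> (acc t (lf a) \<and> h (D t a)) \<and> (acc t (lf b) \<and> h (D t b))"
      if "a \<in> ?A" "b \<in> V - ?A" for a b
    proof -
      have "D t a \<in> A" "D t b \<in> inc t - A" "a \<in> V" "b \<in> V" using that D_inc[OF t, of b] by auto
      then show ?thesis using adj_at[OF t, of a b] h[of "D t a" "D t b"] by (metis DiffD2)
    qed
    fix a b assume ab: "a \<in> ?A" "b \<in> V - ?A" "\<exists>b'\<in>V - ?A. E a b'" "\<exists>a'\<in>?A. E a' b"
    obtain b' where b': "b' \<in> V - ?A" "E a b'" using ab(3) by blast
    obtain a' where a': "a' \<in> ?A" "E a' b" using ab(4) by blast
    show "E a b" using adj[OF ab(1,2)] adj[OF ab(1) b'(1)] adj[OF a'(1) ab(2)] b'(2) a'(2) by blast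
  qed auto
  have strong: "\<not> (?A \<inter> A1 \<noteq> {} \<and> ?A \<inter> B1 \<noteq> {} \<and> (V - ?A) \<inter> A1 \<noteq> {} \<and> (V - ?A) \<inter> B1 \<noteq> {})"
    if sp: "is_split V E A1 B1" for A1 B1
  proof
    assume corners: "?A \<inter> A1 \<noteq> {} \<and> ?A \<inter> B1 \<noteq> {} \<and> (V - ?A) \<inter> A1 \<noteq> {} \<and> (V - ?A) \<inter> B1 \<noteq> {}"
    have AB: "A1 \<union> B1 = V" "A1 \<inter> B1 = {}" using sp unfolding is_split_def by auto
    have rect: "E a b" if "a \<in> A1" "b \<in> B1" "b' \<in> B1" "E a b'" "a' \<in> A1" "E a' b" for a b a' b'
      using sp that unfolding is_split_def by blast
    have branchA: "branch t f \<subseteq> ?A \<or> branch t f \<inter> ?A = {}" for f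
      unfolding branch_inner[OF t] by auto
    \<comment> \<open>A split cutting the branch \<open>f\<close> would have a side inside it. As
      \<open>?A\<close> contains or misses that branch, a corner would be empty. So the crossing
      split is a union of branches and comes from a set \<open>C\<close> of label vertices.\<close>
    have pure: "branch t f \<inter> A1 = {} \<or> branch t f \<inter> B1 = {}" if "f \<in> inc t" for f
    proof (rule ccontr)
      assume "\<not> ?thesis"
      then have "A1 \<subseteq> branch t f \<or> B1 \<subseteq> branch t f" using branch_split_trivial[OF t that sp] by blast
      then show False using branchA[of f] corners by blast
    qed
    define C where "C = {f \<in> inc t. branch t f \<inter> A1 \<noteq> {}}"
    have inb: "v \<in> branch t (D t v)" if "v \<in> V" for v using that unfolding branch_inner[OF t] by simp
    have DC: "D t v \<in> C \<longleftrightarrow> v \<in> A1" if v: "v \<in> V" for v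
      using pure[OF D_inc[OF t v]] inb[OF v] D_inc[OF t v] v AB unfolding C_def by blast
    have repC: "rep t f \<in> A1 \<longleftrightarrow> f \<in> C" if "f \<in> inc t" for f
      using DC[of "rep t f"] rep[OF t that] by simp
    obtain v1 v2 v3 v4 where v: "v1 \<in> ?A" "v1 \<in> A1" "v2 \<in> ?A" "v2 \<in> B1" "v3 \<in> V - ?A" "v3 \<in> A1" "v4 \<in> V - ?A" "v4 \<in> B1"
      using corners by blast
    have v': "v2 \<notin> A1" "v4 \<notin> A1" "v1 \<in> V" "v2 \<in> V" "v3 \<in> V" "v4 \<in> V" using v AB by auto
    have d: "D t v1 \<in> A \<inter> C" "D t v2 \<in> A - C" "D t v3 \<in> C - A" "D t v4 \<in> inc t - (A \<union> C)"
      using DC v v' D_inc[OF t] by auto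
    have CI: "C \<subseteq> inc t" "C \<noteq> {}" "C \<noteq> inc t" using d AI unfolding C_def by auto
    have "rank_one_cut (inc t) (mu t) C"
      unfolding rank_one_cut_iff[OF CI label_graph_graph[OF t]]
    proof (intro ballI impI)
      fix f g assume fg: "f \<in> C" "g \<in> inc t - C" "\<exists>g'\<in>inc t - C. mu t f g'" "\<exists>f'\<in>C. mu t f' g"
      obtain g' where g': "g' \<in> inc t - C" "mu t f g'" using fg(3) by blast
      obtain f' where f': "f' \<in> C" "mu t f' g" using fg(4) by blast
      have I: "f \<in> inc t" "f' \<in> inc t" "g \<in> inc t" "g' \<in> inc t" using fg g' f' CI by auto
      have "rep t f \<in> A1" "rep t f' \<in> A1" "rep t g \<notin> A1" "rep t g' \<notin> A1"
        using repC I fg g' f' by auto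
      moreover have "rep t g \<in> V" "rep t g' \<in> V" using rep[OF t] I by auto
      ultimately have "E (rep t f) (rep t g)"
        using rect[of "rep t f" "rep t g" "rep t g'" "rep t f'"] AB g' f' I by (auto simp: rep_adj[OF t])
      then show "mu t f g" using rep_adj[OF t I(1,3)] by blast
    qed
    moreover have "crosses (inc t) A C" using d unfolding crosses_def by blast
    ultimately show False using nocross by blast
  qed
  have "is_strong_split V E ?A (V - ?A)" unfolding is_strong_split_def using split strong by blast
  from strong_split_edge[OF this] obtain x y where xy: "{x, y} \<in> ET" "{?A, V - ?A} = {V - branch x {x, y}, branch x {x, y}}"
    by blast
  obtain f where f: "branch x {x, y} \<subseteq> branch t f \<or> V - branch x {x, y} \<subseteq> branch t f"
    using edge_side_in_branch[OF xy(1) t] by blast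
  have d: "branch x {x, y} = ?A \<or> branch x {x, y} = V - ?A" "V - branch x {x, y} = ?A \<or> V - branch x {x, y} = V - ?A"
    using xy(2) unfolding doubleton_eq_iff by blast+
  have sub: "?A \<subseteq> X \<or> V - ?A \<subseteq> X" if "S = ?A \<or> S = V - ?A" "S \<subseteq> X" for S X using that by blast
  from f have "?A \<subseteq> branch t f \<or> V - ?A \<subseteq> branch t f"
    by (rule disjE) (rule sub[OF d(1)], assumption, rule sub[OF d(2)], assumption)
  then show False
  proof
    assume "?A \<subseteq> branch t f"
    then have "D t (rep t f1) = f" "D t (rep t g1) = f" using m1 unfolding branch_inner[OF t] by blast+
    then show False using 1(3) r1 by simp
  next
    assume "V - ?A \<subseteq> branch t f"
    then have "D t (rep t f2) = f" "D t (rep t g2) = f" using m2 unfolding branch_inner[OF t] by blast+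
    then show False using 2(3) r2 by simp
  qed
qed

text \<open>One branch at either end of \<open>{t, r}\<close> is put into \<open>?A\<close>. With
  \<open>\<psi>\<close> as frontier this is a split, yet the representatives for \<open>g\<close>,
  \<open>h\<close>, \<open>k\<close>, \<open>l\<close> show that it crosses the strong split of the
  edge.\<close>

lemma no_crossing_split_of_edge:
  assumes e: "{t, r} \<in> ET" "t \<in> inner" "r \<in> inner"
    and g: "g \<in> inc t" "g \<noteq> {t, r}" and k: "k \<in> inc t" "k \<noteq> {t, r}" "k \<noteq> g"
    and h: "h \<in> inc r" "h \<noteq> {t, r}" and l: "l \<in> inc r" "l \<noteq> {t, r}" "l \<noteq> h"
    and rank: "\<And>a b. a \<in> V \<Longrightarrow> b \<in> V \<Longrightarrow> D t a = g \<or> D r a = h \<Longrightarrow> \<not> (D t b = g \<or> D r b = h) \<Longrightarrow>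
      E a b \<longleftrightarrow> \<psi> a \<and> \<psi> b"
  shows False
proof -
  let ?A = "{v \<in> V. D t v = g \<or> D r v = h}"
  let ?X = "branch t {t, r}"
  have flip: "D t v = {t, r} \<longleftrightarrow> D r v \<noteq> {t, r}" if "v \<in> V" for v
    using dir_flip[OF e(1) leaf_in_tree[OF that]] leaf_not_inner[OF that] e(2,3) by blast
  have r1: "rep t g \<in> ?A" "rep t g \<in> V - ?X"
    using rep[OF e(2) g(1)] g unfolding branch_inner[OF e(2)] by auto
  have r2: "rep r h \<in> ?A" "rep r h \<in> ?X"
    using rep[OF e(3) h(1)] h flip[of "rep r h"] unfolding branch_inner[OF e(2)] by auto
  have r3: "rep t k \<in> V - ?A" "rep t k \<in> V - ?X"
    using rep[OF e(2) k(1)] k flip[of "rep t k"] h unfolding branch_inner[OF e(2)] by auto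
  have r4: "rep r l \<in> V - ?A" "rep r l \<in> ?X"
    using rep[OF e(3) l(1)] l flip[of "rep r l"] g unfolding branch_inner[OF e(2)] by auto
  have ne: "rep t g \<noteq> rep r h" "rep t k \<noteq> rep r l" using r1(2) r2(2) r3(2) r4(2) by (metis DiffD2)+
  have "is_split V E ?A (V - ?A)"
    unfolding is_split_def
  proof (intro conjI ballI impI)
    show "card ?A \<ge> 2" using card_mono[of ?A "{rep t g, rep r h}"] r1 r2 ne finite_V by simp
    show "card (V - ?A) \<ge> 2" using card_mono[of "V - ?A" "{rep t k, rep r l}"] r3 r4 ne finite_V by simp
    fix a b assume ab: "a \<in> ?A" "b \<in> V - ?A" "\<exists>b'\<in>V - ?A. E a b'" "\<exists>a'\<in>?A. E a' b"
    obtain b' where b': "b' \<in> V - ?A" "E a b'" using ab(3) by blast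
    obtain a' where a': "a' \<in> ?A" "E a' b" using ab(4) by blast
    have adj: "E a b \<longleftrightarrow> \<psi> a \<and> \<psi> b" if "a \<in> ?A" "b \<in> V - ?A" for a b
      by (rule rank) (use that in auto)
    show "E a b" using adj[OF ab(1,2)] adj[OF ab(1) b'(1)] adj[OF a'(1) ab(2)] b'(2) a'(2) by blast
  qed auto
  from edge_split_not_crossed[OF e this] show False using r1 r2 r3 r4 by blast
qed

lemma adj_across_edge:
  assumes e: "{t, r} \<in> ET" "t \<in> inner" "r \<in> inner" and ab: "a \<in> V" "b \<in> V" "D t a \<noteq> {t, r}" "D r b \<noteq> {t, r}"
  shows "E a b \<longleftrightarrow> acc t (lf a) \<and> mu t (D t a) {t, r} \<and> acc r (lf b) \<and> mu r {t, r} (D r b)"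
proof -
  have e': "{r, t} \<in> ET" using e(1) by (simp add: insert_commute)
  have tb: "D t b = {t, r}"
    using dir_flip[OF e(1) leaf_in_tree[OF ab(2)]] ab(4) by blast
  have rt: "dir r t = {t, r}" using dir_edge[OF e'] by (simp add: insert_commute)
  have "acc t (lf b) \<longleftrightarrow> acc r t \<and> acc r (lf b) \<and> mu r {t, r} (D r b)"
    using acc_compose[of r t "lf b"] leaf_in_tree[OF ab(2)] inner_in_tree e leaf_not_inner[OF ab(2) e(3)]
      edge_nodes[OF e(1)] rt ab(4) by metis
  moreover have "acc r t" by (rule acc_edge[OF e'])
  ultimately show ?thesis using adj_at[OF e(2) ab(1,2)] ab(3) tb by auto
qed

text \<open>Two adjacent cliques could be merged into a larger one, so one branch of each together
  form a split; its frontier is accessibility from the nearer end of the edge.\<close>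

lemma no_adjacent_cliques:
  assumes e: "{t, r} \<in> ET" "t \<in> inner" "r \<in> inner"
    and "is_clique (inc t) (mu t)" "is_clique (inc r) (mu r)"
  shows False
proof -
  have mt: "mu t f g" if "f \<in> inc t" "g \<in> inc t" "f \<noteq> g" for f g using assms(4) that unfolding is_clique_def by blast
  have mr: "mu r f g" if "f \<in> inc r" "g \<in> inc r" "f \<noteq> g" for f g using assms(5) that unfolding is_clique_def by blast
  have f: "{t, r} \<in> inc t" "{t, r} \<in> inc r" using e incident_iff by auto
  obtain g where g: "g \<in> inc t" "g \<noteq> {t, r}" using third_incident[OF e(2)] by metis
  obtain k where k: "k \<in> inc t" "k \<noteq> {t, r}" "k \<noteq> g" using third_incident[OF e(2)] by metis
  obtain h where h: "h \<in> inc r" "h \<noteq> {t, r}" using third_incident[OF e(3)] by metis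
  obtain l where l: "l \<in> inc r" "l \<noteq> {t, r}" "l \<noteq> h" using third_incident[OF e(3)] by metis
  have flip: "D t v = {t, r} \<longleftrightarrow> D r v \<noteq> {t, r}" if "v \<in> V" for v
    using dir_flip[OF e(1) leaf_in_tree[OF that]] leaf_not_inner[OF that] e(2,3) by blast
  define \<psi> where "\<psi> v \<longleftrightarrow> (if D t v = {t, r} then acc r (lf v) else acc t (lf v))" for v
  show False
  proof (rule no_crossing_split_of_edge[OF e g k h l, of \<psi>])
    fix a b assume ab: "a \<in> V" "b \<in> V" and d: "D t a = g \<or> D r a = h" "\<not> (D t b = g \<or> D r b = h)"
    note inc = D_inc[OF e(2) ab(1)] D_inc[OF e(2) ab(2)] D_inc[OF e(3) ab(1)] D_inc[OF e(3) ab(2)]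
    show "E a b \<longleftrightarrow> \<psi> a \<and> \<psi> b"
    proof (cases "D t a = {t, r}")
      case ta: True
      have ra: "D r a \<noteq> {t, r}" "D r a = h" using flip[OF ab(1)] ta d(1) g(2) by metis+
      show ?thesis
      proof (cases "D t b = {t, r}")
        case True
        have "D r a \<noteq> D r b" using ra d by metis
        then show ?thesis using adj_at[OF e(3) ab] mr inc ta True unfolding \<psi>_def by simp
      next
        case False
        show ?thesis
          using adj_across_edge[OF e ab(2,1) False ra(1)] mt[OF inc(2) f(1) False] mr[OF f(2) inc(3)] ra(1) ta False
            E_sym[of a b] unfolding \<psi>_def by auto
      qed
    next
      case ta: False
      have ga: "D t a = g" using flip[OF ab(1)] ta d(1) h(2) by metis
      show ?thesis
      proof (cases "D t b = {t, r}")
        case True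
        then have rb: "D r b \<noteq> {t, r}" using flip ab by blast
        show ?thesis
          using adj_across_edge[OF e ab ta rb] mt[OF inc(1) f(1) ta] mr[OF f(2) inc(4)] rb ta True
          unfolding \<psi>_def by auto
      next
        case False
        have "D t a \<noteq> D t b" using ga d by metis
        then show ?thesis using adj_at[OF e(2) ab] mt inc ta False unfolding \<psi>_def by simp
      qed
    qed
  qed
qed

lemma star_mu:
  assumes "star_with_center (inc t) (mu t) c"
  shows "c \<in> inc t" "mu t f g \<longleftrightarrow> f \<in> inc t \<and> g \<in> inc t \<and> f \<noteq> g \<and> (f = c \<or> g = c)"
  using assms unfolding star_with_center_def by blast+

text \<open>These stars could be merged into one star with centre \<open>c\<close>. The centre
  branch at \<open>r\<close> together with a leaf branch \<open>g\<close> at \<open>t\<close> forms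
  a split: vertices behind \<open>g\<close> have neighbours outside their branch only behind
  \<open>c\<close>, so \<open>\<psi>\<close> is false on them.\<close>

lemma no_center_leaf_edge:
  assumes e: "{t, r} \<in> ET" "t \<in> inner" "r \<in> inner"
    and st: "star_with_center (inc t) (mu t) {t, r}" and sr: "star_with_center (inc r) (mu r) c" and c: "c \<noteq> {t, r}"
  shows False
proof -
  note mt = star_mu(2)[OF st] and mr = star_mu(2)[OF sr]
  have f: "{t, r} \<in> inc t" "{t, r} \<in> inc r" using e incident_iff by auto
  obtain g where g: "g \<in> inc t" "g \<noteq> {t, r}" using third_incident[OF e(2)] by metis
  obtain k where k: "k \<in> inc t" "k \<noteq> {t, r}" "k \<noteq> g" using third_incident[OF e(2)] by metis
  have h: "c \<in> inc r" "c \<noteq> {t, r}" using star_mu(1)[OF sr] c by auto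
  obtain l where l: "l \<in> inc r" "l \<noteq> {t, r}" "l \<noteq> c" using third_incident[OF e(3)] by metis
  have flip: "D t v = {t, r} \<longleftrightarrow> D r v \<noteq> {t, r}" if "v \<in> V" for v
    using dir_flip[OF e(1) leaf_in_tree[OF that]] leaf_not_inner[OF that] e(2,3) by blast
  define \<psi> where "\<psi> v \<longleftrightarrow> (if D t v = {t, r} then acc r (lf v) else acc t (lf v) \<and> D t v \<noteq> g)" for v
  show False
  proof (rule no_crossing_split_of_edge[OF e g k h l, of \<psi>])
    fix a b assume ab: "a \<in> V" "b \<in> V" and d: "D t a = g \<or> D r a = c" "\<not> (D t b = g \<or> D r b = c)"
    note inc = D_inc[OF e(2) ab(1)] D_inc[OF e(2) ab(2)] D_inc[OF e(3) ab(1)] D_inc[OF e(3) ab(2)]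
    show "E a b \<longleftrightarrow> \<psi> a \<and> \<psi> b"
    proof (cases "D t a = {t, r}")
      case ta: True
      have ra: "D r a \<noteq> {t, r}" "D r a = c" using flip[OF ab(1)] ta d(1) g(2) by metis+
      show ?thesis
      proof (cases "D t b = {t, r}")
        case True
        have "D r a \<noteq> D r b" using ra d by metis
        then show ?thesis using adj_at[OF e(3) ab] mr inc ta True ra(2) unfolding \<psi>_def by simp
      next
        case False
        have "mu t (D t b) {t, r}" "mu r {t, r} (D r a)" using mt mr inc f False ra by auto
        then show ?thesis
          using adj_across_edge[OF e ab(2,1) False ra(1)] ta False E_sym[of a b] d(2) unfolding \<psi>_def by auto
      qed
    next
      case ta: False
      have ga: "D t a = g" using flip[OF ab(1)] ta d(1) c by metis
      have "\<not> E a b"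
      proof (cases "D t b = {t, r}")
        case True
        then have rb: "D r b \<noteq> {t, r}" using flip ab by blast
        have "\<not> mu r {t, r} (D r b)" using mr d(2) c by auto
        then show ?thesis using adj_across_edge[OF e ab ta rb] by blast
      next
        case False
        have "D t a \<noteq> D t b" using ga d by metis
        moreover have "\<not> mu t (D t a) (D t b)" using mt ta False by auto
        ultimately show ?thesis using adj_at[OF e(2) ab] by blast
      qed
      moreover have "\<not> \<psi> a" using ga g unfolding \<psi>_def by simp
      ultimately show ?thesis by blast
    qed
  qed
qed

section \<open>Stars, cliques and pointing in terms of directions\<close>

abbreviation star_at :: "'n \<Rightarrow> 'n set \<Rightarrow> bool" where
  "star_at t c \<equiv> star_with_center (inc t) (mu t) c"

abbreviation clique_at :: "'n \<Rightarrow> bool" where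
  "clique_at t \<equiv> is_clique (inc t) (mu t)"

definition between :: "'n \<Rightarrow> 'n \<Rightarrow> 'n set" where
  "between x y = {r \<in> N. r \<noteq> x \<and> r \<noteq> y \<and> dir r x \<noteq> dir r y}"

text \<open>The pairs of condition (ii) without any restriction on their distance;
  \<open>apart_iff\<close> translates to \<open>points_to_node\<close>.\<close>

definition apart :: "'n \<Rightarrow> 'n \<Rightarrow> bool" where
  "apart s s' \<longleftrightarrow> s \<in> inner \<and> s' \<in> inner \<and> s \<noteq> s' \<and>
     (\<exists>c. star_at s c \<and> c \<noteq> dir s s') \<and> (\<exists>c. star_at s' c \<and> c \<noteq> dir s' s)"

text \<open>Degree at least 3 leaves a third edge, and its adjacency to \<open>c\<close> contradicts
  \<open>c'\<close> being the centre.\<close>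

lemma center_unique: "star_at t c \<Longrightarrow> star_at t c' \<Longrightarrow> c = c'"
proof (rule ccontr)
  assume s: "star_at t c" "star_at t c'" and ne: "c \<noteq> c'"
  have c: "c \<in> inc t" "c' \<in> inc t" using star_mu(1) s by blast+
  have "card (inc t) \<ge> 3" using s unfolding star_with_center_def by blast
  then have "t \<in> inner" using innerI[OF c ne] by blast
  then obtain k where k: "k \<in> inc t" "k \<noteq> c" "k \<noteq> c'" by (rule third_incident)
  then have "mu t c k" using star_mu(2)[OF s(1)] c by auto
  then show False using star_mu(2)[OF s(2)] ne k by auto
qed

lemma star_not_clique: assumes "t \<in> inner" "star_at t c" shows "\<not> clique_at t"
proof
  assume cl: "clique_at t"
  obtain f where f: "f \<in> inc t" "f \<noteq> c" using third_incident[OF assms(1)] by metis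
  obtain g where g: "g \<in> inc t" "g \<noteq> c" "g \<noteq> f" using third_incident[OF assms(1)] by metis
  have "mu t f g" using cl f g unfolding is_clique_def by metis
  then show False using star_mu(2)[OF assms(2)] f g by auto
qed

lemma clique_mu: "clique_at t \<Longrightarrow> f \<in> inc t \<Longrightarrow> g \<in> inc t \<Longrightarrow> f \<noteq> g \<Longrightarrow> mu t f g"
  unfolding is_clique_def by blast

lemma star_or_clique:
  assumes "t \<in> inner" "P4_dominated V E" shows "(\<exists>c. star_at t c) \<or> clique_at t"
  using label_star_or_complete[OF assms]
proof
  assume "star_graph (inc t) (mu t)"
  then show ?thesis using inner_card[OF assms(1)] finite_incident unfolding star_graph_def star_with_center_def by blast
next
  assume "complete_graph (inc t) (mu t)"
  moreover have "mu t f g \<Longrightarrow> f \<in> inc t \<and> g \<in> inc t \<and> f \<noteq> g" for f g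
    using label_graph_graph[OF assms(1)] unfolding graph_def by blast
  ultimately have "clique_at t" unfolding is_clique_def complete_graph_def by blast
  then show ?thesis ..
qed

lemma points_to_node_iff:
  assumes "t \<in> N" "x \<in> N"
  shows "points_to_node ET mu t x \<longleftrightarrow> (\<exists>c. star_at t c \<and> x \<noteq> t \<and> dir t x = c)"
proof -
  have "star_at t c \<Longrightarrow> (\<forall>p. tpath ET t x p \<longrightarrow> edge_on_path c p) \<longleftrightarrow> x \<noteq> t \<and> dir t x = c" for c
    using edge_on_all_paths_iff[OF assms] sep_iff_dir[OF star_mu(1) assms(2)] by simp
  then show ?thesis unfolding points_to_node_def by blast
qed

lemma points_to_edge_iff:
  assumes "t \<in> N" "e \<in> ET"
  shows "points_to_edge ET mu t e \<longleftrightarrow> (\<exists>c. star_at t c \<and> (\<exists>z\<in>e. z \<noteq> t \<and> dir t z = c))"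
proof -
  have "z \<in> N" if "z \<in> e" for z using edge_ends[OF assms(2)] that by blast
  then have "star_at t c \<Longrightarrow> z \<in> e \<Longrightarrow> (\<forall>p. tpath ET t z p \<longrightarrow> edge_on_path c p) \<longleftrightarrow> z \<noteq> t \<and> dir t z = c" for c z
    using edge_on_all_paths_iff[OF assms(1)] sep_iff_dir[OF star_mu(1)] by simp
  then show ?thesis unfolding points_to_edge_def by blast
qed

text \<open>\<open>points_to_set\<close> inspects only shortest paths into \<open>S\<close>. When
  \<open>t\<close> sees all of \<open>S\<close> in one direction, it does not matter which path is
  shortest; that one exists is needed for the direction from left to right.\<close>

lemma points_to_set_iff:
  assumes t: "t \<in> N" "t \<notin> S" and S: "S \<subseteq> N" "S \<noteq> {}" and same: "\<And>z z'. z \<in> S \<Longrightarrow> z' \<in> S \<Longrightarrow> dir t z = dir t z'"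
  shows "points_to_set ET mu t S \<longleftrightarrow> (\<exists>c. star_at t c \<and> (\<forall>z\<in>S. dir t z = c))"
proof -
  have on: "edge_on_path c p \<longleftrightarrow> dir t z = c" if "star_at t c" "z \<in> S" "tpath ET t z p" for c z p
  proof -
    have z: "z \<in> N" "z \<noteq> t" using that(2) S t by blast+
    show ?thesis using edge_on_path_iff[OF that(3)] sep_iff_dir[OF star_mu(1)[OF that(1)] z(1)] z(2) by blast
  qed
  obtain z0 where z0: "z0 \<in> S" using S by blast
  then obtain p0 where p0: "tpath ET t z0 p0" using tpath_exists[OF t(1)] S by blast
  define P where "P = (\<lambda>(z, p). z \<in> S \<and> tpath ET t z p)"
  have "P (z0, p0)" using z0 p0 unfolding P_def by simp
  then obtain zp where zp: "P zp" "\<And>y. P y \<Longrightarrow> length (snd zp) \<le> length (snd y)"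
    using ex_has_least_nat[of P "(z0, p0)" "\<lambda>y. length (snd y)"] by blast
  obtain z1 p1 where [simp]: "zp = (z1, p1)" by (cases zp)
  have near: "z1 \<in> S" "tpath ET t z1 p1" "\<forall>z'\<in>S. \<forall>p'. tpath ET t z' p' \<longrightarrow> length p1 \<le> length p'"
    using zp(1) zp(2)[of "(z', p')" for z' p'] unfolding P_def by auto
  show ?thesis
  proof
    assume "points_to_set ET mu t S"
    then obtain c where c: "star_at t c" "edge_on_path c p1" using near unfolding points_to_set_def by blast
    then have "dir t z1 = c" using on near by blast
    then have "\<forall>z\<in>S. dir t z = c" using same near(1) by blast
    then show "\<exists>c. star_at t c \<and> (\<forall>z\<in>S. dir t z = c)" using c by blast
  next
    assume "\<exists>c. star_at t c \<and> (\<forall>z\<in>S. dir t z = c)"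
    then obtain c where c: "star_at t c" "\<forall>z\<in>S. dir t z = c" by blast
    then have "edge_on_path c p" if "z \<in> S" "tpath ET t z p" for z p using on that by blast
    then show "points_to_set ET mu t S" using c(1) unfolding points_to_set_def by blast
  qed
qed

lemma between_sym: "between x y = between y x"
  unfolding between_def by auto

lemma between_mono:
  assumes N: "s \<in> N" "s' \<in> N" and r: "r \<in> between s s'"
  shows "between r s' \<subset> between s s'" "dir s' r = dir s' s"
proof -
  have r': "r \<in> N" "r \<noteq> s" "r \<noteq> s'" "dir r s \<noteq> dir r s'" using r unfolding between_def by auto
  have "x \<in> between s s'" if x: "x \<in> between r s'" for x
  proof -
    have x': "x \<in> N" "x \<noteq> r" "x \<noteq> s'" "dir x r \<noteq> dir x s'" using x unfolding between_def by auto
    have "dir r s' = dir r x" using dir_branch[of x r s'] x' r' N by auto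
    then have "dir r x \<noteq> dir r s" "x \<noteq> s" using r' by auto
    then have "dir x s = dir x r" using dir_branch[of r x s] x' r' N by auto
    then show ?thesis using x' \<open>x \<noteq> s\<close> unfolding between_def by auto
  qed
  moreover have "r \<notin> between r s'" unfolding between_def by auto
  ultimately show "between r s' \<subset> between s s'" using r by blast
  show "dir s' r = dir s' s" using dir_branch[of r s' s] r' N by auto
qed

lemma next_on_path:
  assumes "x \<in> N" "y \<in> N" "x \<noteq> y"
  obtains q where "{x, q} \<in> ET" "dir x y = {x, q}" "q = y \<or> q \<in> between x y"
proof -
  obtain q where q: "dir x y = {x, q}" "{x, q} \<in> ET" "q \<in> N" "q \<noteq> x"
    using incident_ends[OF dir_incident[OF assms]] by metis
  have "{q, x} \<in> ET" using q(2) by (simp add: insert_commute)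
  then have qx: "dir q x = {x, q}" using dir_edge[of q x] by (simp add: insert_commute)
  have "q = y \<or> dir q y \<noteq> {x, q}" using dir_flip[OF q(2) assms(2)] q(1) assms(3) by blast
  then have "q = y \<or> q \<in> between x y" using q qx unfolding between_def by auto
  then show thesis using that q by blast
qed

lemma apart_sym: "apart s s' \<Longrightarrow> apart s' s"
  unfolding apart_def by blast

section \<open>From the class to the conditions on the tree\<close>

lemma no_apart_common_edge:
  assumes no: "\<And>s s'. \<not> apart s s'"
  shows "\<exists>e\<in>ET. \<forall>t\<in>inner. is_star (inc t) (mu t) \<longrightarrow> points_to_edge ET mu t e"
proof (cases "\<exists>t c. t \<in> inner \<and> star_at t c")
  case False
  \<comment> \<open>Without stars any edge of \<open>T\<close> will do; two vertices of
    \<open>G\<close> provide one.\<close>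
  have "\<not> card V \<le> Suc 0" using two_vertices by simp
  then obtain u v where uv: "u \<in> V" "v \<in> V" "u \<noteq> v" using finite_V card_le_Suc0_iff_eq by metis
  then have "lf u \<in> N" "lf v \<in> N" "lf u \<noteq> lf v" using leaf_in_tree leaf_inj by auto
  then have "dir (lf u) (lf v) \<in> ET" using dir_incident unfolding incident_def by blast
  then show ?thesis using False unfolding is_star_def by blast
next
  case True
  define B where "B t c = {x \<in> N. x \<noteq> t \<and> dir t x = c}" for t c
  define P where "P = (\<lambda>(t, c). t \<in> inner \<and> star_at t c)"
  obtain t0 c0 where "P (t0, c0)" using True unfolding P_def by auto
  then obtain tc where tc: "P tc" "\<And>y. P y \<Longrightarrow> card (case tc of (t, c) \<Rightarrow> B t c) \<le> card (case y of (t, c) \<Rightarrow> B t c)"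
    using ex_has_least_nat[of P "(t0, c0)" "\<lambda>y. card (case y of (t, c) \<Rightarrow> B t c)"] by blast
  obtain t c where [simp]: "tc = (t, c)" by (cases tc)
  have t: "t \<in> inner" "star_at t c" and min: "\<And>s d. s \<in> inner \<Longrightarrow> star_at s d \<Longrightarrow> card (B t c) \<le> card (B s d)"
    using tc(1) tc(2)[of "(s, d)" for s d] unfolding P_def by auto
  have tN: "t \<in> N" using inner_in_tree t by blast
  obtain r where r: "c = {t, r}" "{t, r} \<in> ET" "r \<noteq> t" using incident_ends[OF star_mu(1)[OF t(2)]] by metis
  have "points_to_edge ET mu s c" if s: "s \<in> inner" "is_star (inc s) (mu s)" for s
  proof -
    obtain d where d: "star_at s d" using s unfolding is_star_def by blast
    have sN: "s \<in> N" using inner_in_tree s by blast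
    show ?thesis
    proof (cases "s = t")
      case True
      then show ?thesis
        using points_to_edge_iff[OF tN, of c] t(2) r dir_edge[OF r(2)] by auto
    next
      case False
      have "dir s t = d"
      proof (rule ccontr)
        assume n: "dir s t \<noteq> d"
        \<comment> \<open>As the pair is not apart, \<open>t\<close> must point to \<open>s\<close>.
          Then \<open>s\<close> and all that lies beyond its centre edge are beyond the centre edge
          of \<open>t\<close>, against minimality.\<close>
        then have "dir t s = c" using no[of s t] d t s False center_unique unfolding apart_def by blast
        have "B s d \<subset> B t c"
        proof (rule psubsetI)
          show "B s d \<subseteq> B t c"
          proof
            fix x assume "x \<in> B s d"
            then have x: "x \<in> N" "x \<noteq> s" "dir s x = d" unfolding B_def by auto
            then have "dir t x = dir t s" using dir_branch[of s t x] n False sN tN by auto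
            then show "x \<in> B t c" using x n \<open>dir t s = c\<close> unfolding B_def by auto
          qed
          have "s \<in> B t c" "s \<notin> B s d" using \<open>dir t s = c\<close> sN False unfolding B_def by auto
          then show "B s d \<noteq> B t c" by blast
        qed
        moreover have "finite (B t c)" using finite_nodes unfolding B_def by simp
        ultimately have "card (B s d) < card (B t c)" by (rule psubset_card_mono[rotated])
        then show False using min[OF s(1) d] by simp
      qed
      moreover have "c \<in> ET" "t \<in> c" using r by auto
      ultimately have "\<exists>z\<in>c. z \<noteq> s \<and> dir s z = d" using False by (intro bexI[of _ t]) auto
      then have "\<exists>d. star_at s d \<and> (\<exists>z\<in>c. z \<noteq> s \<and> dir s z = d)" using d by (intro exI[of _ d] conjI)
      then show ?thesis unfolding points_to_edge_iff[OF sN \<open>c \<in> ET\<close>] .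
    qed
  qed
  then show ?thesis using r by blast
qed

text \<open>Closeness is measured by the number of nodes between. A star between \<open>s\<close>
  and \<open>s'\<close> fails to point to one of them and forms a closer pair with it.\<close>

lemma apart_minimal:
  assumes bags: "\<And>t. t \<in> inner \<Longrightarrow> (\<exists>c. star_at t c) \<or> clique_at t"
    and ap: "apart s0 s0'"
  shows "\<exists>s s'. apart s s' \<and> (\<forall>r\<in>between s s'. clique_at r)"
proof -
  define P where "P = (\<lambda>(s, s'). apart s s')"
  have "P (s0, s0')" using ap unfolding P_def by simp
  then obtain ss where ss: "P ss" "\<And>y. P y \<Longrightarrow> card (case ss of (s, s') \<Rightarrow> between s s') \<le> card (case y of (s, s') \<Rightarrow> between s s')"
    using ex_has_least_nat[of P "(s0, s0')" "\<lambda>y. card (case y of (s, s') \<Rightarrow> between s s')"] by blast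
  obtain s s' where [simp]: "ss = (s, s')" by (cases ss)
  have a: "apart s s'" and min: "\<And>u v. apart u v \<Longrightarrow> card (between s s') \<le> card (between u v)"
    using ss(1) ss(2)[of "(u, v)" for u v] unfolding P_def by auto
  have N: "s \<in> N" "s' \<in> N" "s \<in> inner" "s' \<in> inner" using a inner_in_tree unfolding apart_def by blast+
  have fin: "finite (between s s')" using finite_nodes unfolding between_def by simp
  have "clique_at r" if r: "r \<in> between s s'" for r
  proof (rule ccontr)
    assume n: "\<not> clique_at r"
    have r': "r \<in> N" "r \<noteq> s" "r \<noteq> s'" "dir r s \<noteq> dir r s'" using r unfolding between_def by auto
    have ri: "r \<in> inner" using between_inner[of r s s'] r' N by blast
    then obtain e where e: "star_at r e" using bags n by blast
    have rsym: "r \<in> between s' s" using r between_sym by blast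
    show False
    proof (cases "e = dir r s'")
      case False
      then have "apart r s'" using a e ri r' between_mono(2)[OF N(1,2) r] unfolding apart_def by auto
      from min[OF this] show False using psubset_card_mono[OF fin between_mono(1)[OF N(1,2) r]] by linarith
    next
      case True
      then have "apart r s" using a e ri r' between_mono(2)[OF N(2,1) rsym] unfolding apart_def by auto
      moreover have "between r s \<subset> between s s'"
        using between_mono(1)[OF N(2,1) rsym] unfolding between_sym[of s' s] .
      ultimately show False using min[of r s] psubset_card_mono[OF fin, of "between r s"] by linarith
    qed
  qed
  then show ?thesis using a by blast
qed

lemma acc_if_between_cliques:
  assumes "x \<in> N" "y \<in> N" "\<And>r. r \<in> between x y \<Longrightarrow> clique_at r" shows "acc x y"
  unfolding acc_def
proof (intro ballI impI)
  fix r assume r: "r \<in> N" "r \<noteq> x" "r \<noteq> y" "dir r x \<noteq> dir r y"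
  then have "clique_at r" using assms(3) unfolding between_def by blast
  then show "mu r (dir r x) (dir r y)"
    using clique_mu dir_incident[OF r(1)] r assms(1,2) by metis
qed

text \<open>If more than one node lay between, the first two would be adjacent cliques.\<close>

lemma apart_structure:
  assumes ap: "apart s s'" and cl: "\<And>r. r \<in> between s s' \<Longrightarrow> clique_at r"
  shows "{s, s'} \<in> ET \<or> (\<exists>s''. s'' \<in> inner \<and> s'' \<noteq> s \<and> s'' \<noteq> s' \<and> {s, s''} \<in> ET \<and> {s'', s'} \<in> ET \<and> clique_at s'')"
proof -
  have N: "s \<in> N" "s' \<in> N" "s \<in> inner" "s' \<in> inner" "s \<noteq> s'" using ap inner_in_tree unfolding apart_def by blast+
  obtain q where q: "{s, q} \<in> ET" "q = s' \<or> q \<in> between s s'" using next_on_path[OF N(1,2,5)] by metis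
  show ?thesis
  proof (cases "q = s'")
    case False
    then have qb: "q \<in> between s s'" using q by blast
    then have q': "q \<in> N" "q \<noteq> s" "q \<noteq> s'" "q \<in> inner"
      using between_inner[of q s s'] N unfolding between_def by auto
    obtain p where p: "{q, p} \<in> ET" "p = s' \<or> p \<in> between q s'" using next_on_path[OF q'(1) N(2) q'(3)] by metis
    have "p = s'"
    proof (rule ccontr)
      assume "p \<noteq> s'"
      then have pb: "p \<in> between q s'" using p by blast
      then have "p \<in> inner" using between_inner[of p q s'] N q' unfolding between_def by auto
      moreover have "clique_at p" using cl between_mono(1)[OF N(1,2) qb] pb by blast
      ultimately show False using no_adjacent_cliques[OF p(1) q'(4)] cl[OF qb] by blast
    qed
    then show ?thesis using q q' p cl[OF qb] by blast
  qed (use q in blast)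
qed

text \<open>\<open>a\<close> and \<open>d\<close> sit behind leaf edges, \<open>b\<close> and
  \<open>x\<close> behind the centres. The star \<open>s\<close> blocks \<open>a\<close> from
  \<open>x\<close> and \<open>d\<close>, the star \<open>s'\<close> blocks \<open>b\<close> from
  \<open>d\<close>, and \<open>acc s s'\<close> joins \<open>b\<close> to \<open>x\<close>.\<close>

lemma P4_of_apart:
  assumes s: "s \<in> inner" "s' \<in> inner" "s \<noteq> s'" and st: "star_at s c" "star_at s' c'"
    and ne: "c \<noteq> dir s s'" "c' \<noteq> dir s' s" and ac: "acc s s'" and V: "a \<in> V" "b \<in> V" "x \<in> V" "d \<in> V"
    and a: "D s a \<noteq> c" "D s a \<noteq> dir s s'" "acc s (lf a)" and b: "D s b = c" "acc s (lf b)"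
    and x: "D s' x = c'" "acc s' (lf x)" and d: "D s' d \<noteq> c'" "D s' d \<noteq> dir s' s" "acc s' (lf d)"
  shows "induced_P4 E a b x d"
proof -
  have N: "s \<in> N" "s' \<in> N" using s inner_in_tree by blast+
  have branch: "D t v = dir t t'" if "t \<in> inner" "t' \<in> inner" "t \<noteq> t'" "v \<in> V" "D t' v \<noteq> dir t' t" for t t' v
    using dir_branch[of t' t "lf v"] that inner_in_tree leaf_in_tree leaf_not_inner by metis
  have Dx: "D s x = dir s s'" "D s d = dir s s'" using branch[OF s V(3)] branch[OF s V(4)] x d ne by auto
  have Da: "D s' a = dir s' s" "D s' b = dir s' s"
    using branch[OF s(2,1) s(3)[symmetric] V(1)] branch[OF s(2,1) s(3)[symmetric] V(2)] a b ne by auto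
  have ss: "dir s s' \<in> inc s" "dir s' s \<in> inc s'" using dir_incident N s(3) by auto
  have ms: "mu s f g \<longleftrightarrow> f \<in> inc s \<and> g \<in> inc s \<and> f \<noteq> g \<and> (f = c \<or> g = c)" for f g by (rule star_mu(2)[OF st(1)])
  have ms': "mu s' f g \<longleftrightarrow> f \<in> inc s' \<and> g \<in> inc s' \<and> f \<noteq> g \<and> (f = c' \<or> g = c')" for f g by (rule star_mu(2)[OF st(2)])
  have i: "c \<in> inc s" "c' \<in> inc s'" using star_mu(1) st by blast+
  have sl: "s' \<noteq> s" "s' \<noteq> lf x" "s' \<noteq> lf d" using s leaf_not_inner V by blast+
  have "acc s (lf x) \<longleftrightarrow> acc s' s \<and> acc s' (lf x) \<and> mu s' (dir s' s) (D s' x)"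
    using acc_compose[OF N(2,1) leaf_in_tree[OF V(3)] sl(1,2)] x ne by simp
  then have accx: "acc s (lf x)" using x ms' ss i ne ac acc_sym[OF N] by simp
  have e1: "E a b" using adj_at[OF s(1) V(1,2)] a b ms i D_inc[OF s(1) V(1)] by simp
  have e2: "E b x" using adj_at[OF s(1) V(2,3)] b Dx accx ms i ss ne by simp
  have e3: "E x d" using adj_at[OF s(2) V(3,4)] x d ms' i D_inc[OF s(2) V(4)] by simp
  have n1: "\<not> E a x" using adj_at[OF s(1) V(1,3)] a Dx ms ne by simp
  have n2: "\<not> E b d" using adj_at[OF s(2) V(2,4)] d Da ms' ne by simp
  have n3: "\<not> E a d" using adj_at[OF s(1) V(1,4)] a Dx ms ne by simp
  show ?thesis using e1 e2 e3 n1 n2 n3 unfolding induced_P4_def by blast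
qed

text \<open>Supplies a middle vertex of a P4 that \<open>t\<close> sees in the direction of
  \<open>s\<close>. The obstacle is that \<open>t\<close> may itself lie behind the centre of
  \<open>s\<close>. Then the node \<open>r\<close> across the centre edge is not \<open>t\<close>,
  and by \<open>no_center_leaf_edge\<close> it is a clique or a star centred towards
  \<open>s\<close>; so a third branch at \<open>r\<close>, away from \<open>t\<close>, is accessible
  from \<open>s\<close>.\<close>

lemma center_representative_avoiding:
  assumes bags: "\<And>t. t \<in> inner \<Longrightarrow> (\<exists>c. star_at t c) \<or> clique_at t"
    and s: "s \<in> inner" "star_at s c" and t: "t \<in> inner" "t \<noteq> s" "star_at t e" "e \<noteq> dir t s"
  shows "\<exists>b\<in>V. D s b = c \<and> acc s (lf b) \<and> D t b = dir t s"
proof -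
  have N: "s \<in> N" "t \<in> N" using s t inner_in_tree by blast+
  have ci: "c \<in> inc s" by (rule star_mu(1)[OF s(2)])
  show ?thesis
  proof (cases "dir s t = c")
    case False
    have r: "rep s c \<in> V" "D s (rep s c) = c" "acc s (lf (rep s c))" using rep[OF s(1) ci] by auto
    have "D t (rep s c) = dir t s"
      using dir_branch[of s t "lf (rep s c)"] N r False t leaf_in_tree leaf_not_inner s by metis
    then show ?thesis using r by blast
  next
    case True
    obtain r where r: "c = {s, r}" "{s, r} \<in> ET" "r \<in> N" "r \<noteq> s" "c \<in> inc r" using incident_ends[OF ci] by metis
    have "{r, s} \<in> ET" using r(2) by (simp add: insert_commute)
    then have rs: "dir r s = c" using dir_edge[of r s] r(1) by (simp add: insert_commute)
    have rt: "r \<noteq> t \<Longrightarrow> dir r t \<noteq> c" using dir_flip[OF r(2) N(2)] t(2) True r(1) by blast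
    have ri: "r \<in> inner"
    proof (cases "r = t")
      case False
      then show ?thesis using innerI[OF r(5) dir_incident[OF r(3) N(2)]] rt by auto
    qed (use t in blast)
    have cr: "\<forall>d. star_at r d \<longrightarrow> d = c" using no_center_leaf_edge[OF r(2) s(1) ri] s(2) r(1) by blast
    have nt: "r \<noteq> t"
    proof
      assume "r = t"
      then show False using cr t(3,4) rs by blast
    qed
    obtain k where k: "k \<in> inc r" "k \<noteq> c" "k \<noteq> dir r t" using third_incident[OF ri] by metis
    have m: "mu r c k"
    proof (cases "clique_at r")
      case True then show ?thesis using clique_mu r k by metis
    next
      case False
      then have "star_at r c" using bags[OF ri] cr by blast
      then show ?thesis using star_mu(2)[of r c c k] r(5) k by auto
    qed
    let ?b = "rep r k"
    have b: "?b \<in> V" "D r ?b = k" "acc r (lf ?b)" using rep[OF ri k(1)] by auto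
    have lN: "lf ?b \<in> N" "r \<noteq> lf ?b" using leaf_in_tree[OF b(1)] leaf_not_inner[OF b(1) ri] by simp_all
    have "acc s (lf ?b)"
      using acc_compose[OF r(3) N(1) lN(1) r(4) lN(2)] rs b k m acc_edge[OF \<open>{r, s} \<in> ET\<close>] by simp
    moreover have "D s ?b = c" using dir_flip[OF r(2) lN(1)] b(2) k(2) r(1) by blast
    moreover have "D t ?b = dir t r" using dir_branch[of r t "lf ?b"] r N lN nt k b by metis
    moreover have "dir t r = dir t s" using dir_const[OF \<open>{r, s} \<in> ET\<close> N(2)] nt t by metis
    ultimately show ?thesis using b(1) by metis
  qed
qed

lemma other_stars_point:
  assumes dom: "P4_dominated V E" and ap: "apart s s'" and cl: "\<And>r. r \<in> between s s' \<Longrightarrow> clique_at r"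
    and t: "t \<in> inner" "star_at t e" "t \<noteq> s" "t \<noteq> s'"
  shows "dir t s = e \<and> dir t s' = e"
proof -
  have bags: "\<And>t. t \<in> inner \<Longrightarrow> (\<exists>c. star_at t c) \<or> clique_at t" using star_or_clique dom by blast
  have s: "s \<in> inner" "s' \<in> inner" "s \<noteq> s'" using ap unfolding apart_def by auto
  obtain c c' where st: "star_at s c" "star_at s' c'" and ne: "c \<noteq> dir s s'" "c' \<noteq> dir s' s"
    using ap unfolding apart_def by blast
  have N: "s \<in> N" "s' \<in> N" "t \<in> N" using s t inner_in_tree by blast+
  \<comment> \<open>Only cliques lie between the pair, so the star \<open>t\<close> sees both of its
    nodes in one direction.\<close>
  have "t \<notin> between s s'" using cl star_not_clique t by blast
  then have same: "dir t s = dir t s'" using N t unfolding between_def by blast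
  have "dir t s = e"
  proof (rule ccontr)
    assume n: "dir t s \<noteq> e"
    obtain b where b: "b \<in> V" "D s b = c" "acc s (lf b)" "D t b = dir t s"
      using center_representative_avoiding[OF bags s(1) st(1) t(1,3,2)] n by metis
    obtain x where x: "x \<in> V" "D s' x = c'" "acc s' (lf x)" "D t x = dir t s"
      using center_representative_avoiding[OF bags s(2) st(2) t(1,4,2)] n same by metis
    obtain f where f: "f \<in> inc s" "f \<noteq> c" "f \<noteq> dir s s'" using third_incident[OF s(1)] by metis
    obtain f' where f': "f' \<in> inc s'" "f' \<noteq> c'" "f' \<noteq> dir s' s" using third_incident[OF s(2)] by metis
    \<comment> \<open>Both \<open>k\<close> and the direction of the pair are leaf edges of
      \<open>t\<close>, so \<open>t\<close> blocks the representative of \<open>k\<close> from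
      \<open>b\<close> and \<open>x\<close>.\<close>
    obtain k where k: "k \<in> inc t" "k \<noteq> e" "k \<noteq> dir t s" using third_incident[OF t(1)] by metis
    have "acc s s'" by (rule acc_if_between_cliques[OF N(1,2) cl])
    then have P: "induced_P4 E (rep s f) b x (rep s' f')"
      using P4_of_apart[OF s st ne _ _ b(1) x(1)] rep[OF s(1) f(1)] rep[OF s(2) f'(1)] f f' b x by simp
    note w = rep[OF t(1) k(1)]
    have "\<not> mu t k (dir t s)" using star_mu(2)[OF t(2)] k n by auto
    then have "\<not> E (rep t k) b" "\<not> E (rep t k) x"
      using adj_at[OF t(1) w(1) b(1)] adj_at[OF t(1) w(1) x(1)] w b(4) x(4) k(3) by auto
    then show False using P4_dominatedD(2)[OF dom graph P w(1)] by blast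
  qed
  then show ?thesis using same by simp
qed

text \<open>The second alternative of condition (ii) as the theorem spells it out, apart from the
  requirement on the other stars; \<open>S\<close> includes the middle clique if there is
  one.\<close>

abbreviation point_apart :: "'n \<Rightarrow> 'n \<Rightarrow> 'n set \<Rightarrow> bool" where
  "point_apart s s' S \<equiv> s \<in> inner \<and> s' \<in> inner \<and> s \<noteq> s' \<and>
         is_star (inc s) (mu s) \<and> is_star (inc s') (mu s') \<and>
         \<not> points_to_node ET mu s s' \<and> \<not> points_to_node ET mu s' s \<and>
         (({s, s'} \<in> ET \<and> S = {s, s'}) \<or>
          (\<exists>s''. s'' \<in> inner \<and> s'' \<noteq> s \<and> s'' \<noteq> s' \<and> {s, s''} \<in> ET \<and> {s'', s'} \<in> ET \<and>
                 clique_at s'' \<and> S = {s, s', s''}))"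

lemma apart_iff:
  "apart s s' \<longleftrightarrow> s \<in> inner \<and> s' \<in> inner \<and> s \<noteq> s' \<and>
         is_star (inc s) (mu s) \<and> is_star (inc s') (mu s') \<and>
         \<not> points_to_node ET mu s s' \<and> \<not> points_to_node ET mu s' s"
proof (cases "s \<in> inner \<and> s' \<in> inner \<and> s \<noteq> s'")
  case True
  have key: "(\<exists>c. star_at t c \<and> c \<noteq> f) \<longleftrightarrow> is_star (inc t) (mu t) \<and> \<not> star_at t f" for t f
    unfolding is_star_def using center_unique by blast
  have N: "s \<in> N" "s' \<in> N" "s' \<noteq> s" "s \<noteq> s'" using True inner_in_tree by auto
  have p: "points_to_node ET mu s s' \<longleftrightarrow> star_at s (dir s s')" "points_to_node ET mu s' s \<longleftrightarrow> star_at s' (dir s' s)"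
    using points_to_node_iff[OF N(1,2)] points_to_node_iff[OF N(2,1)] N(3,4) by simp_all
  show ?thesis unfolding apart_def key p using True by blast
qed (auto simp: apart_def)

text \<open>\<open>S\<close> is the node set of a path in \<open>T\<close> and \<open>t\<close> is
  off it, so \<open>dir_const\<close> applies to each of its edges.\<close>

lemma point_apart_same_dir:
  assumes S: "point_apart s s' S" and t: "t \<in> N" "t \<notin> S"
  shows "s \<in> S" "s' \<in> S" "S \<subseteq> N" "z \<in> S \<Longrightarrow> dir t z = dir t s"
proof -
  show m: "s \<in> S" "s' \<in> S" using S by auto
  show "S \<subseteq> N" using S inner_in_tree by auto
  from S have "({s, s'} \<in> ET \<and> S = {s, s'}) \<or> (\<exists>s''. {s, s''} \<in> ET \<and> {s'', s'} \<in> ET \<and> S = {s, s', s''})" by blast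
  then show "z \<in> S \<Longrightarrow> dir t z = dir t s"
  proof (elim disjE exE conjE)
    assume "z \<in> S" "{s, s'} \<in> ET" "S = {s, s'}"
    then show ?thesis using dir_const[of s s' t] t by auto
  next
    fix s'' assume "z \<in> S" "{s, s''} \<in> ET" "{s'', s'} \<in> ET" "S = {s, s', s''}"
    then show ?thesis using dir_const[of s s'' t] dir_const[of s'' s' t] t by auto
  qed
qed

lemma point_apart_star_notin:
  assumes "point_apart s s' S" "t \<in> inner" "star_at t c" "t \<noteq> s" "t \<noteq> s'" shows "t \<notin> S"
  using assms star_not_clique by blast

lemma star_points_to_set_iff:
  assumes S: "point_apart s s' S" and t: "t \<in> inner" "star_at t c" "t \<noteq> s" "t \<noteq> s'"
  shows "points_to_set ET mu t S \<longleftrightarrow> (\<forall>z\<in>S. dir t z = c)"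
proof -
  have n: "t \<notin> S" by (rule point_apart_star_notin[OF S t])
  have tN: "t \<in> N" using t inner_in_tree by blast
  note sd = point_apart_same_dir[OF S tN n]
  have "points_to_set ET mu t S \<longleftrightarrow> (\<exists>c. star_at t c \<and> (\<forall>z\<in>S. dir t z = c))"
  proof (rule points_to_set_iff[OF tN n sd(3)])
    show "S \<noteq> {}" using sd(1) by blast
    show "dir t z = dir t z'" if "z \<in> S" "z' \<in> S" for z z' using sd(4)[OF that(1)] sd(4)[OF that(2)] by simp
  qed
  then show ?thesis using t(2) center_unique by blast
qed

lemma P4_dominated_imp:
  assumes dom: "P4_dominated V E"
  shows "(\<forall>t\<in>inner. is_star (inc t) (mu t) \<or> is_clique (inc t) (mu t)) \<and>
     ((\<exists>e\<in>ET. \<forall>t\<in>inner. is_star (inc t) (mu t) \<longrightarrow> points_to_edge ET mu t e) \<or>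
      (\<exists>s s' S. point_apart s s' S \<and>
         (\<forall>t\<in>inner. is_star (inc t) (mu t) \<and> t \<notin> {s, s'} \<longrightarrow> points_to_set ET mu t S)))"
proof -
  have bags: "\<And>t. t \<in> inner \<Longrightarrow> (\<exists>c. star_at t c) \<or> clique_at t" using star_or_clique dom by blast
  then have 1: "\<forall>t\<in>inner. is_star (inc t) (mu t) \<or> is_clique (inc t) (mu t)" unfolding is_star_def by blast
  show ?thesis
  proof (cases "\<exists>s s'. apart s s'")
    case False
    then show ?thesis using 1 no_apart_common_edge by blast
  next
    case True
    then obtain s s' where ap: "apart s s'" and cl: "\<And>r. r \<in> between s s' \<Longrightarrow> clique_at r"
      using apart_minimal[OF bags] by blast
    obtain S where S: "point_apart s s' S"
      using apart_structure[OF ap cl] ap unfolding apart_iff by blast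
    have "points_to_set ET mu t S" if t: "t \<in> inner" "is_star (inc t) (mu t)" "t \<notin> {s, s'}" for t
    proof -
      obtain e where e: "star_at t e" using t(2) unfolding is_star_def by blast
      have ne: "t \<noteq> s" "t \<noteq> s'" using t(3) by auto
      have tN: "t \<in> N" using t inner_in_tree by blast
      have "dir t s = e" using other_stars_point[OF dom ap cl t(1) e ne] by blast
      then show ?thesis
        using star_points_to_set_iff[OF S t(1) e ne]
          point_apart_same_dir(4)[OF S tN point_apart_star_notin[OF S t(1) e ne]] by blast
    qed
    then have "\<forall>t\<in>inner. is_star (inc t) (mu t) \<and> t \<notin> {s, s'} \<longrightarrow> points_to_set ET mu t S" by simp
    then show ?thesis
      using S by (intro conjI[OF 1] disjI2 exI[of _ s] exI[of _ s'] exI[of _ S] conjI[of "point_apart s s' S"])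
  qed
qed

section \<open>From the conditions on the tree to the class\<close>

text \<open>
  The star \<open>s\<close> blocks the path from \<open>a\<close> to \<open>x\<close>: it has \<open>b\<close> behind its centre, \<open>a\<close> behind one leaf edge, and
  \<open>x\<close>, \<open>d\<close> and the opposite star \<open>s'\<close> behind another one.
\<close>
definition P4_at :: "'a \<Rightarrow> 'a \<Rightarrow> 'a \<Rightarrow> 'a \<Rightarrow> 'n \<Rightarrow> 'n \<Rightarrow> bool" where
  "P4_at a b x d s s' \<longleftrightarrow> s \<in> inner \<and> star_at s (D s b) \<and> D s a \<noteq> D s b \<and> D s x \<noteq> D s b \<and> D s a \<noteq> D s x \<and>
     D s d = D s x \<and> acc s (lf a) \<and> acc s (lf b) \<and> acc s (lf x) \<and> dir s s' = D s x"

text \<open>Some label between \<open>a\<close> and \<open>x\<close> blocks them; it is a star in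
  which both directions are leaves. The vertex \<open>b\<close> is not in the branch of
  \<open>a\<close>, else it would be blocked from \<open>x\<close> too, and then its adjacency to
  \<open>a\<close> puts it behind the centre.\<close>

lemma blocking_star:
  assumes bags: "\<And>t. t \<in> inner \<Longrightarrow> (\<exists>c. star_at t c) \<or> clique_at t"
    and e: "E a b" "E b x" "\<not> E a x" "a \<noteq> x"
  shows "\<exists>s. s \<in> inner \<and> star_at s (D s b) \<and> D s a \<noteq> D s b \<and> D s x \<noteq> D s b \<and> D s a \<noteq> D s x \<and>
    acc s (lf a) \<and> acc s (lf b) \<and> acc s (lf x)"
proof -
  have V: "a \<in> V" "b \<in> V" "x \<in> V" using edge_graph e by blast+
  have "\<not> acc (lf a) (lf x)" using adj_iff_acc[OF V(1,3) e(4)] e(3) by blast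
  then obtain s where s: "s \<in> N" "s \<noteq> lf a" "s \<noteq> lf x" "D s a \<noteq> D s x" "\<not> mu s (D s a) (D s x)"
    unfolding acc_def by blast
  have si: "s \<in> inner" using between_inner[OF s(1)] s leaf_in_tree V by blast
  note i = D_inc[OF si V(1)] D_inc[OF si V(2)] D_inc[OF si V(3)]
  have "\<not> clique_at s" using clique_mu i s by blast
  then obtain c where c: "star_at s c" using bags[OF si] by blast
  have ac: "D s a \<noteq> c" "D s x \<noteq> c" using star_mu(2)[OF c] s i by blast+
  have ab: "D s a \<noteq> D s b"
  proof
    assume eq: "D s a = D s b"
    then have "mu s (D s b) (D s x)" using adj_at[OF si V(2,3)] e(2) s(4) by simp
    then show False using eq s(5) by simp
  qed
  have 1: "acc s (lf a) \<and> acc s (lf b) \<and> mu s (D s a) (D s b)" using adj_at[OF si V(1,2) ab] e(1) by blast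
  then have bc: "D s b = c" using star_mu(2)[OF c] ac by blast
  then have "D s b \<noteq> D s x" using ac by blast
  then have "acc s (lf x)" using adj_at[OF si V(2,3)] e(2) by blast
  then show ?thesis using si c bc ac ab 1 s(4) by blast
qed

text \<open>Otherwise \<open>s'\<close> would see both \<open>u\<close> and \<open>v\<close> through
  \<open>s\<close>.\<close>

lemma dir_of_common_branch:
  assumes "s \<in> inner" "s' \<in> inner" "s \<noteq> s'" "u \<in> V" "v \<in> V" "D s u = D s v" "D s' u \<noteq> D s' v"
  shows "dir s s' = D s u"
proof (rule ccontr)
  assume "dir s s' \<noteq> D s u"
  then have "D s' u = dir s' s" "D s' v = dir s' s"
    using dir_branch[of s s' "lf u"] dir_branch[of s s' "lf v"] assms inner_in_tree leaf_in_tree leaf_not_inner by metis+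
  then show False using assms by simp
qed

text \<open>If not, the edge \<open>x d\<close> puts \<open>d\<close> behind the centre of
  \<open>s\<close>, together with \<open>b\<close> and hence \<open>s'\<close>. Then
  \<open>s'\<close> sees \<open>a\<close> and \<open>x\<close> through \<open>s\<close>, in its
  centre direction, and \<open>a\<close> would be adjacent to \<open>d\<close>.\<close>

lemma far_end_direction:
  assumes e: "E x d" "\<not> E a d" "E a b" and ne: "a \<noteq> d"
    and s: "s \<in> inner" "star_at s (D s b)" "D s a \<noteq> D s b" "D s x \<noteq> D s b" "D s a \<noteq> D s x"
    and s': "s' \<in> inner" "star_at s' (D s' x)" "D s' b \<noteq> D s' x" "D s' d \<noteq> D s' x" "D s' b \<noteq> D s' d" "acc s' (lf d)"
  shows "D s d = D s x"
proof (rule ccontr)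
  assume n: "D s d \<noteq> D s x"
  have V: "a \<in> V" "b \<in> V" "x \<in> V" "d \<in> V" using edge_graph e by blast+
  have "mu s (D s x) (D s d)" using adj_at[OF s(1) V(3,4)] e(1) n by auto
  then have db: "D s b = D s d" using star_mu(2)[OF s(2)] s(4) by metis
  have ss: "s \<noteq> s'" using s(2,4) s'(2) center_unique by metis
  have dss: "dir s s' = D s b" by (rule dir_of_common_branch[OF s(1) s'(1) ss V(2,4) db s'(5)])
  have br: "D s' v = dir s' s" if "v \<in> V" "D s v \<noteq> D s b" for v
    using dir_branch[of s s' "lf v"] that dss ss s s' inner_in_tree leaf_in_tree leaf_not_inner by metis
  have ax: "D s' a = D s' x" using br[OF V(1)] br[OF V(3)] s by simp
  have "acc s' (lf a)" using adj_at[OF s'(1) V(1,2)] ax s'(3) e(3) by auto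
  moreover have "mu s' (D s' a) (D s' d)" using star_mu(2)[OF s'(2)] ax s'(4) D_inc[OF s'(1)] V by auto
  ultimately have "E a d" using adj_at[OF s'(1) V(1,4)] ax s'(4,6) by auto
  then show False using e by blast
qed

text \<open>\<open>s\<close> blocks \<open>a\<close> from \<open>x\<close>, and \<open>s'\<close>
  blocks \<open>d\<close> from \<open>b\<close>; reversing the P4 exchanges the two.\<close>

lemma P4_stars:
  assumes bags: "\<And>t. t \<in> inner \<Longrightarrow> (\<exists>c. star_at t c) \<or> clique_at t"
    and p: "induced_P4 E a b x d"
  shows "\<exists>s s'. s \<noteq> s' \<and> P4_at a b x d s s' \<and> P4_at d x b a s' s"
proof -
  have e: "E a b" "E b x" "E x d" "\<not> E a x" "\<not> E b d" "\<not> E a d" using p unfolding induced_P4_def by auto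
  have e': "E d x" "E x b" "E b a" "\<not> E d b" "\<not> E x a" "\<not> E d a" using e E_sym by blast+
  have V: "a \<in> V" "b \<in> V" "x \<in> V" "d \<in> V" using edge_graph e by blast+
  have ne: "a \<noteq> x" "d \<noteq> b" "a \<noteq> d" "d \<noteq> a" using e e' by metis+
  obtain s where s: "s \<in> inner" "star_at s (D s b)" "D s a \<noteq> D s b" "D s x \<noteq> D s b" "D s a \<noteq> D s x"
    and as: "acc s (lf a)" "acc s (lf b)" "acc s (lf x)"
    using blocking_star[OF bags e(1,2,4) ne(1)] by blast
  obtain s' where s': "s' \<in> inner" "star_at s' (D s' x)" "D s' d \<noteq> D s' x" "D s' b \<noteq> D s' x" "D s' d \<noteq> D s' b"
    and as': "acc s' (lf d)" "acc s' (lf x)" "acc s' (lf b)"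
    using blocking_star[OF bags e'(1,2,4) ne(2)] by blast
  have ss: "s \<noteq> s'" using s(2,4) s'(2) center_unique by metis
  have 1: "D s d = D s x"
    by (rule far_end_direction[OF e(3,6,1) ne(3) s s'(1,2,4,3) s'(5)[symmetric] as'(1)])
  have 2: "D s' a = D s' b"
    by (rule far_end_direction[OF e'(3,6,1) ne(4) s' s(1,2,4,3) s(5)[symmetric] as(1)])
  have "dir s s' = D s x" by (rule dir_of_common_branch[OF s(1) s'(1) ss V(3,4) 1[symmetric] s'(3)[symmetric]])
  moreover have "dir s' s = D s' b"
    by (rule dir_of_common_branch[OF s'(1) s(1) ss[symmetric] V(2,1) 2[symmetric] s(3)[symmetric]])
  ultimately have "P4_at a b x d s s'" "P4_at d x b a s' s"
    unfolding P4_at_def using s s' as as' 1 2 by auto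
  then show ?thesis using ss by blast
qed

lemma P4_at_apart: "s \<noteq> s' \<Longrightarrow> P4_at a b x d s s' \<Longrightarrow> P4_at d x b a s' s \<Longrightarrow> apart s s'"
  unfolding P4_at_def apart_def by metis

text \<open>From \<open>s'\<close>, the end of \<open>e\<close> that \<open>s\<close> points to is
  seen through \<open>s\<close>, and the end that \<open>s'\<close> points to is not. But
  \<open>s'\<close> is neither end, so it sees both in one direction.\<close>

lemma common_edge_no_apart:
  assumes e: "e \<in> ET" and pt: "\<And>t. t \<in> inner \<Longrightarrow> is_star (inc t) (mu t) \<Longrightarrow> points_to_edge ET mu t e"
  shows "\<not> apart s s'"
proof
  assume ap: "apart s s'"
  have s: "s \<in> inner" "s' \<in> inner" "s \<noteq> s'" using ap unfolding apart_def by auto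
  obtain c c' where c: "star_at s c" "c \<noteq> dir s s'" "star_at s' c'" "c' \<noteq> dir s' s" using ap unfolding apart_def by blast
  have N: "s \<in> N" "s' \<in> N" using s inner_in_tree by blast+
  have z: "\<exists>z\<in>e. z \<noteq> t \<and> dir t z = d" if "t \<in> inner" "star_at t d" for t d
  proof -
    have "points_to_edge ET mu t e" using pt that unfolding is_star_def by blast
    then show ?thesis using points_to_edge_iff[of t e] inner_in_tree that e center_unique by blast
  qed
  obtain z where z1: "z \<in> e" "z \<noteq> s" "dir s z = c" using z[OF s(1) c(1)] by blast
  obtain z' where z2: "z' \<in> e" "z' \<noteq> s'" "dir s' z' = c'" using z[OF s(2) c(3)] by blast
  have zN: "z \<in> N" using edge_ends[OF e] z1 by blast
  have zs: "dir s' z = dir s' s" using dir_branch[of s s' z] N zN s z1 c by auto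
  have "z \<noteq> z'" using zs z2 c by auto
  then have "e = {z, z'}" using edge_ends[OF e] z1(1) z2(1) by blast
  moreover have "z \<noteq> s'" using z1 c by auto
  ultimately have "dir s' z = dir s' z'" using dir_const[of z z' s'] e N z2 by auto
  then show False using zs z2 c by simp
qed

text \<open>A star \<open>s\<close> outside the given pair points to all of \<open>S\<close>. Hence
  \<open>s'\<close> is not in \<open>S\<close> and points to \<open>S\<close> as well. As
  \<open>s\<close> sees \<open>s'\<close> and \<open>S\<close> in different directions,
  \<open>s'\<close> sees \<open>S\<close> through \<open>s\<close> and would point to
  \<open>s\<close>.\<close>

lemma unique_apart:
  assumes S: "point_apart s0 s0' S"
    and pt: "\<And>t. t \<in> inner \<Longrightarrow> is_star (inc t) (mu t) \<Longrightarrow> t \<notin> {s0, s0'} \<Longrightarrow> points_to_set ET mu t S"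
    and ap: "apart s s'"
  shows "s \<in> {s0, s0'}"
proof (rule ccontr)
  assume n: "s \<notin> {s0, s0'}"
  have s: "s \<in> inner" "s' \<in> inner" "s \<noteq> s'" using ap unfolding apart_def by auto
  obtain c c' where c: "star_at s c" "c \<noteq> dir s s'" "star_at s' c'" "c' \<noteq> dir s' s" using ap unfolding apart_def by blast
  have N: "s \<in> N" "s' \<in> N" using s inner_in_tree by blast+
  have all: "\<forall>z\<in>S. dir t z = d" if "t \<in> inner" "star_at t d" "t \<notin> {s0, s0'}" for t d
    using star_points_to_set_iff[OF S that(1,2)] pt[OF that(1) _ that(3)] that unfolding is_star_def by blast
  have m: "s0 \<in> S" "s0' \<in> S" "s0 \<in> N" using S inner_in_tree by auto
  have 1: "\<forall>z\<in>S. dir s z = c" by (rule all[OF s(1) c(1) n])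
  have "s' \<notin> S" using 1 c by blast
  then have "s' \<notin> {s0, s0'}" using m by blast
  then have 2: "\<forall>z\<in>S. dir s' z = c'" by (rule all[OF s(2) c(3)])
  have "dir s s0 \<noteq> dir s s'" "s0 \<noteq> s" using 1 m c n by auto
  then have "dir s' s0 = dir s' s" using dir_branch[of s s' s0] N m s by auto
  then show False using 2 m c by auto
qed

text \<open>No label between \<open>z\<close> and \<open>y\<close> can block: cliques never do,
  stars outside the pair have their centre towards \<open>z\<close>, and by \<open>sep\<close> the
  pair itself is not between.\<close>

lemma acc_to_apart_set:
  assumes bags: "\<And>t. t \<in> inner \<Longrightarrow> (\<exists>c. star_at t c) \<or> clique_at t"
    and pt: "\<And>t c. t \<in> inner \<Longrightarrow> star_at t c \<Longrightarrow> t \<notin> {s, s'} \<Longrightarrow> dir t z = c"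
    and z: "z \<in> N" and y: "y \<in> V" and sep: "s \<noteq> z \<Longrightarrow> dir s z = D s y" "s' \<noteq> z \<Longrightarrow> dir s' z = D s' y"
  shows "acc z (lf y)"
  unfolding acc_def
proof (intro ballI impI)
  fix r assume r: "r \<in> N" "r \<noteq> z" "r \<noteq> lf y" "dir r z \<noteq> D r y"
  have yN: "lf y \<in> N" using leaf_in_tree[OF y] .
  have ri: "r \<in> inner" by (rule between_inner[OF r(1) z yN r(2,3,4)])
  have i: "dir r z \<in> inc r" "D r y \<in> inc r" using dir_incident r z yN by auto
  show "mu r (dir r z) (D r y)"
  proof (cases "clique_at r")
    case True then show ?thesis using clique_mu i r by blast
  next
    case False
    then obtain c where c: "star_at r c" using bags[OF ri] by blast
    have "r \<notin> {s, s'}" using sep r by auto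
    then have "dir r z = c" using pt ri c by blast
    then show ?thesis using star_mu(2)[OF c] i r by auto
  qed
qed

text \<open>Seen from \<open>s'\<close>, such a \<open>y\<close> is where \<open>b\<close> is, so
  \<open>s'\<close> blocks it from \<open>d\<close>. At \<open>s\<close> it reaches \<open>x\<close>
  if it is behind the centre and \<open>b\<close> otherwise.\<close>

lemma P4_at_dominated:
  assumes p: "induced_P4 E a b x d" and P: "P4_at a b x d s s'" "P4_at d x b a s' s" and ss: "s \<noteq> s'"
    and y: "y \<in> V" and near: "D s y \<noteq> dir s s'" and ac: "acc s (lf y)"
  shows "\<not> E y d \<and> (E y b \<or> E y x)"
proof -
  have e: "E a b" "E x d" using p unfolding induced_P4_def by auto
  have V: "a \<in> V" "b \<in> V" "x \<in> V" "d \<in> V" using edge_graph e by blast+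
  have s: "s \<in> inner" "star_at s (D s b)" "D s x \<noteq> D s b" "acc s (lf b)" "acc s (lf x)" "dir s s' = D s x"
    using P(1) unfolding P4_at_def by auto
  have s': "s' \<in> inner" "star_at s' (D s' x)" "D s' d \<noteq> D s' x" "D s' b \<noteq> D s' x" "D s' d \<noteq> D s' b" "dir s' s = D s' b"
    using P(2) unfolding P4_at_def by auto
  have "D s' y = dir s' s"
    using dir_branch[of s s' "lf y"] near ss s s' y inner_in_tree leaf_in_tree leaf_not_inner by metis
  then have y': "D s' y = D s' b" using s' by simp
  have "\<not> mu s' (D s' y) (D s' d)" using star_mu(2)[OF s'(2)] y' s'(3,4) by auto
  then have "\<not> E y d" using adj_at[OF s'(1) y V(4)] y' s'(5) by auto
  moreover have "E y b \<or> E y x"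
  proof (cases "D s y = D s b")
    case True
    have "mu s (D s y) (D s x)" using star_mu(2)[OF s(2)] True s(3) D_inc[OF s(1)] V by auto
    then show ?thesis using adj_at[OF s(1) y V(3)] True s(3,5) ac by auto
  next
    case False
    have "mu s (D s y) (D s b)" using star_mu(2)[OF s(2)] False D_inc[OF s(1)] V y by auto
    then show ?thesis using adj_at[OF s(1) y V(2)] False s(4) ac by auto
  qed
  ultimately show ?thesis by blast
qed

text \<open>Three positions of \<open>y\<close>: on the outer side of \<open>s\<close>, on that of
  \<open>s'\<close> (the reversed P4), or between the two. The last one requires the middle clique
  \<open>r\<close>; through it \<open>y\<close> reaches \<open>b\<close>, while \<open>s\<close>
  blocks \<open>y\<close> from \<open>a\<close>.\<close>

lemma apart_set_P4_dominated:
  assumes bags: "\<And>t. t \<in> inner \<Longrightarrow> (\<exists>c. star_at t c) \<or> clique_at t"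
    and S: "point_apart s s' S"
    and pt: "\<And>t. t \<in> inner \<Longrightarrow> is_star (inc t) (mu t) \<Longrightarrow> t \<notin> {s, s'} \<Longrightarrow> points_to_set ET mu t S"
    and p: "induced_P4 E a b x d" and P: "P4_at a b x d s s'" "P4_at d x b a s' s" and y: "y \<in> V"
  shows "\<not> (E y a \<and> E y d) \<and> (E y b \<or> E y x)"
proof -
  have ss: "s \<noteq> s'" "s' \<noteq> s" and si: "s \<in> inner" "s' \<in> inner" using S by auto
  have N: "s \<in> N" "s' \<in> N" using si inner_in_tree by auto
  have e: "E a b" "E b x" "E x d" using p unfolding induced_P4_def by auto
  have V: "a \<in> V" "b \<in> V" "x \<in> V" "d \<in> V" using edge_graph e by blast+
  have all: "dir t z = c" if "t \<in> inner" "star_at t c" "t \<notin> {s, s'}" "z \<in> S" for t z c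
    using star_points_to_set_iff[OF S that(1,2)] pt[OF that(1) _ that(3)] that unfolding is_star_def by blast
  have m: "s \<in> S" "s' \<in> S" using S by auto
  have yN: "lf y \<in> N" "lf y \<noteq> s" "lf y \<noteq> s'" using leaf_in_tree[OF y] leaf_not_inner[OF y] si by auto
  have p': "induced_P4 E d x b a" using p E_sym unfolding induced_P4_def by blast
  show ?thesis
  proof (cases "D s y = dir s s'")
    case near: False
    have "dir s' s = D s' y" using dir_branch[of s s' "lf y"] N yN ss near by auto
    then have "acc s (lf y)" using acc_to_apart_set[OF bags _ N(1) y] all m(1) by blast
    then show ?thesis using P4_at_dominated[OF p P ss(1) y near] by blast
  next
    case s_far: True
    show ?thesis
    proof (cases "D s' y = dir s' s")
      case near: False
      have "acc s' (lf y)" using acc_to_apart_set[OF bags _ N(2) y] all m(2) s_far by metis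
      then show ?thesis using P4_at_dominated[OF p' P(2,1) ss(2) y near] by blast
    next
      case s'_far: True
      \<comment> \<open>If \<open>s\<close> and \<open>s'\<close> were adjacent,
        \<open>dir_flip\<close> would put \<open>y\<close> on the outer side of one of them.\<close>
      have "{s, s'} \<notin> ET"
      proof
        assume e: "{s, s'} \<in> ET"
        then have "{s', s} \<in> ET" by (simp add: insert_commute)
        then have "dir s s' = {s, s'}" "dir s' s = {s, s'}" using dir_edge e by (auto simp: insert_commute)
        then show False using dir_flip[OF e yN(1)] s_far s'_far yN by blast
      qed
      then obtain r where r: "r \<in> inner" "r \<noteq> s" "r \<noteq> s'" "{s, r} \<in> ET" "{r, s'} \<in> ET" "clique_at r" "S = {s, s', r}"
        using S by blast
      have rN: "r \<in> N" using r inner_in_tree by blast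
      have d1: "dir s s' = dir s r" using dir_const[OF r(5) N(1)] r ss by auto
      have d2: "dir s' s = dir s' r" using dir_const[OF r(4) N(2)] r ss by auto
      have "acc r (lf y)"
        using acc_to_apart_set[OF bags _ rN y] all r(7) s_far s'_far d1 d2 by (metis insertCI)
      have Pb: "D s b \<noteq> dir s s'" "D s a \<noteq> dir s s'" "D s a \<noteq> D s b" "star_at s (D s b)"
        using P(1) unfolding P4_at_def by auto
      have Px: "D s' x \<noteq> dir s' s" using P(2) unfolding P4_at_def by auto
      have lN: "lf b \<in> N" "lf x \<in> N" "lf b \<noteq> s" "lf x \<noteq> s'" using leaf_in_tree leaf_not_inner V si by auto
      have rb: "D r b = dir r s" using dir_branch[of s r "lf b"] N rN lN r d1 Pb(1) by auto
      have rx: "D r x = dir r s'" using dir_branch[of s' r "lf x"] N rN lN r d2 Px by auto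
      have rs: "{r, s} \<in> ET" using r(4) by (simp add: insert_commute)
      have rdir: "dir r s = {r, s}" "dir r s' = {r, s'}" using dir_edge[OF rs] dir_edge[OF r(5)] by auto
      then have rne: "dir r s \<noteq> dir r s'" using ss r by (auto simp: doubleton_eq_iff)
      have "acc r (lf b)" using adj_at[OF r(1) V(2,3)] rb rx rne e(2) by auto
      have sr: "dir s r = {r, s}" using dir_edge[OF r(4)] by (simp add: insert_commute)
      have "D r y \<noteq> dir r s" using dir_flip[OF r(4) yN(1)] s_far d1 sr rdir leaf_not_inner[OF y r(1)] yN
        by (auto simp: insert_commute)
      then have "mu r (D r y) (D r b)" using clique_mu[OF r(6) D_inc[OF r(1) y] D_inc[OF r(1) V(2)]] rb by simp
      then have "E y b" using adj_at[OF r(1) y V(2)] \<open>acc r (lf y)\<close> \<open>acc r (lf b)\<close> \<open>D r y \<noteq> dir r s\<close> rb by auto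
      moreover have "\<not> mu s (D s y) (D s a)" using star_mu(2)[OF Pb(4)] s_far Pb by auto
      then have "\<not> E y a" using adj_at[OF si(1) y V(1)] s_far Pb by auto
      ultimately show ?thesis by blast
    qed
  qed
qed

text \<open>Every P4 comes from a pair that is apart. A common edge excludes such pairs; otherwise
  the pair is the given one, in either order, and the second order is the first for the reversed
  P4.\<close>

lemma P4_dominated_if:
  assumes bag: "\<forall>t\<in>inner. is_star (inc t) (mu t) \<or> is_clique (inc t) (mu t)"
    and pt: "(\<exists>e\<in>ET. \<forall>t\<in>inner. is_star (inc t) (mu t) \<longrightarrow> points_to_edge ET mu t e) \<or>
      (\<exists>s s' S. point_apart s s' S \<and>
         (\<forall>t\<in>inner. is_star (inc t) (mu t) \<and> t \<notin> {s, s'} \<longrightarrow> points_to_set ET mu t S))"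
  shows "P4_dominated V E"
  unfolding P4_dominated_def
proof (intro ballI impI)
  fix a b x d y assume y: "y \<in> V" and p: "induced_P4 E a b x d"
  have bags: "(\<exists>c. star_at t c) \<or> clique_at t" if "t \<in> inner" for t using bag that unfolding is_star_def by blast
  obtain s s' where ss: "s \<noteq> s'" and P: "P4_at a b x d s s'" "P4_at d x b a s' s" using P4_stars[OF bags p] by blast
  have ap: "apart s s'" by (rule P4_at_apart[OF ss P])
  from pt show "\<not> (E y a \<and> E y d) \<and> (E y b \<or> E y x)"
  proof
    assume "\<exists>e\<in>ET. \<forall>t\<in>inner. is_star (inc t) (mu t) \<longrightarrow> points_to_edge ET mu t e"
    then show ?thesis using common_edge_no_apart ap by blast
  next
    assume "\<exists>s s' S. point_apart s s' S \<and>
         (\<forall>t\<in>inner. is_star (inc t) (mu t) \<and> t \<notin> {s, s'} \<longrightarrow> points_to_set ET mu t S)"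
    then obtain s0 s0' S where S: "point_apart s0 s0' S"
      and to: "\<And>t. t \<in> inner \<Longrightarrow> is_star (inc t) (mu t) \<Longrightarrow> t \<notin> {s0, s0'} \<Longrightarrow> points_to_set ET mu t S" by blast
    have "s \<in> {s0, s0'}" "s' \<in> {s0, s0'}"
      using unique_apart[OF S to ap] unique_apart[OF S to apart_sym[OF ap]] by auto
    then consider "s = s0" "s' = s0'" | "s = s0'" "s' = s0" using ss by auto
    then show ?thesis
    proof cases
      case 1
      then show ?thesis using apart_set_P4_dominated[OF bags S to p _ _ y] P by simp
    next
      case 2
      have p': "induced_P4 E d x b a" using p E_sym unfolding induced_P4_def by blast
      have "\<not> (E y d \<and> E y a) \<and> (E y x \<or> E y b)"
        using apart_set_P4_dominated[OF bags S to p' _ _ y] P 2 by simp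
      then show ?thesis by blast
    qed
  qed
qed

end

theorem theorem2:
  fixes V :: "'a set" and E :: "'a \<Rightarrow> 'a \<Rightarrow> bool"
    and N :: "'n set" and ET :: "'n set set"
    and mu :: "'n \<Rightarrow> 'n set \<Rightarrow> 'n set \<Rightarrow> bool" and lf :: "'a \<Rightarrow> 'n"
  assumes "graph V E" and "connected_graph V E" and "card V \<ge> 2"
    and "canonical_split_decomposition V E N ET mu lf"
  shows "DH_coDH V E \<longleftrightarrow>
    ((\<forall>t\<in>tinternal N ET. is_star (incident ET t) (mu t) \<or> is_clique (incident ET t) (mu t)) \<and>
     ((\<exists>e\<in>ET. \<forall>t\<in>tinternal N ET. is_star (incident ET t) (mu t) \<longrightarrow> points_to_edge ET mu t e) \<or>
      (\<exists>s s' S. s \<in> tinternal N ET \<and> s' \<in> tinternal N ET \<and> s \<noteq> s' \<and>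
         is_star (incident ET s) (mu s) \<and> is_star (incident ET s') (mu s') \<and>
         \<not> points_to_node ET mu s s' \<and> \<not> points_to_node ET mu s' s \<and>
         (({s, s'} \<in> ET \<and> S = {s, s'}) \<or>
          (\<exists>s''. s'' \<in> tinternal N ET \<and> s'' \<noteq> s \<and> s'' \<noteq> s' \<and> {s, s''} \<in> ET \<and> {s'', s'} \<in> ET \<and>
                 is_clique (incident ET s'') (mu s'') \<and> S = {s, s', s''})) \<and>
         (\<forall>t\<in>tinternal N ET. is_star (incident ET t) (mu t) \<and> t \<notin> {s, s'} \<longrightarrow>
            points_to_set ET mu t S))))"
proof -
  interpret split_decomposition V E N ET mu lf by unfold_locales (fact assms)+
  show ?thesis
    using P4_dominated_imp P4_dominated_if unfolding DH_coDH_iff_P4_dominated[OF assms(1)] conj_assoc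
    by (intro iffI conjI) (elim conjE, assumption | blast)+
qed

end
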